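(* Let $G$ be a complex Lie group with Lie algebra $\mathfrak g$ and a left-invariant Hermitian metric $g$, and let $r$ denote the Riemannian scalar curvature of $g$ and $k=\mathrm{tr}_gK(g)$. The following facts are equivalent: (1) $r=k$; (2) $G$ is unimodular; (3) $K(g)=\mathrm{Ric}^{1,1}(g)$. Moreover, if one of these holds, then $K(g)=\mathrm{Ric}(g)$ if and only if the Killing form of $\mathfrak g$ vanishes. In particular, if $G$ is nilpotent then $K(g)=\mathrm{Ric}(g)$.
   Context: A complex Lie group is always endowed with the complex structure $J$ making multiplication holomorphic ($J$ bi-invariant); unimodular means $\mathrm{tr}\,\mathrm{ad}_X=0$ for all $X\in\mathfrak g$. The Killing form is $\mathrm B(X,Y)=\mathrm{tr}(\mathrm{ad}_X\mathrm{ad}_Y)$. $\mathrm{Ric}$ is the Levi-Civita Ricci tensor and $\mathrm{Ric}^{1,1}=\frac12(\mathrm{Ric}(\cdot,\cdot)+\mathrm{Ric}(J\cdot,J\cdot))$. The tensor $K$: let $\nabla$ be the Chern connection of $(J,g)$ (the unique connection with $\nabla J=\nabla g=0$ whose torsion $T$ has vanishing $(1,1)$-part) and $\Omega$ its curvature. In a $(1,0)$-frame put $T_{ij\bar k}=g_{a\bar k}T_{ij}^a$ (with $T_{\bar i\bar j k}=\overline{T_{ij\bar k}}$), $S_{i\bar j}=g^{k\bar l}\Omega_{k\bar l i\bar j}$, where $\Omega_{k\bar l i\bar j}=g(\nabla_k\nabla_{\bar l}Z_i-\nabla_{\bar l}\nabla_kZ_i-\nabla_{[Z_k,Z_{\bar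 l}]}Z_i,Z_{\bar j})$, and $Q^1_{i\bar j}=g^{k\bar l}g^{m\bar n}T_{ik\bar n}T_{\bar j\bar l m}$, $Q^2_{i\bar j}=g^{\bar l k}g^{\bar n m}T_{\bar l\bar n i}T_{km\bar j}$, $Q^3_{i\bar j}=g^{\bar l k}g^{\bar n m}T_{ik\bar l}T_{\bar j\bar n m}$, $Q^4_{i\bar j}=\frac12 g^{\bar l k}g^{\bar n m}(T_{mk\bar l}T_{\bar n\bar j i}+T_{\bar n\bar l k}T_{mi\bar j})$. Set $Q=\frac12Q^1-\frac14Q^2-\frac12Q^3+Q^4$ and $K(g)=S-Q$, viewed as a $J$-invariant symmetric 2-tensor. Trace convention: for a symmetric 2-tensor $h$, $\mathrm{tr}_gh=g^{\bar j i}h_{i\bar j}=\sum_i h(Z_i,\bar Z_i)$ in a unitary frame ($g(Z_i,\bar Z_j)=\delta_{ij}$, $g$ extended complex bilinearly). Both $k=\mathrm{tr}_gK$ and the scalar curvature $r=\mathrm{tr}_g\mathrm{Ric}$ are computed with this trace. *)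

theory Defs
  imports "HOL-Analysis.Analysis" "HOL-Algebra.Generated_Groups"
begin

section \<open>Smooth and holomorphic maps between open sets\<close>

text \<open>Meant for open \<open>S\<close> and finite-dimensional domains, where it is the usual \<open>C\<^sup>k\<close>.\<close>

fun Ck_on :: "nat \<Rightarrow> ('a::real_normed_vector \<Rightarrow> 'b::real_normed_vector) \<Rightarrow> 'a set \<Rightarrow> bool" where
  "Ck_on 0 f S \<longleftrightarrow> continuous_on S f"
| "Ck_on (Suc k) f S \<longleftrightarrow>
     f differentiable_on S \<and> (\<forall>v. Ck_on k (\<lambda>x. frechet_derivative f (at x) v) S)"

definition smooth_on :: "('a::real_normed_vector \<Rightarrow> 'b::real_normed_vector) \<Rightarrow> 'a set \<Rightarrow> bool" where
  "smooth_on f S \<longleftrightarrow> (\<forall>k. Ck_on k f S)"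

text \<open>\<open>J1\<close> and \<open>J2\<close> are the complex structures (multiplication by \<open>\<i>\<close>) of the two model spaces;
  holomorphic means smooth with complex linear differential.\<close>

definition holo_on :: "('a::real_normed_vector \<Rightarrow> 'a) \<Rightarrow> ('b::real_normed_vector \<Rightarrow> 'b)
    \<Rightarrow> ('a \<Rightarrow> 'b) \<Rightarrow> 'a set \<Rightarrow> bool" where
  "holo_on J1 J2 f S \<longleftrightarrow> smooth_on f S \<and>
     (\<forall>x\<in>S. \<forall>v. frechet_derivative f (at x) (J1 v) = J2 (frechet_derivative f (at x) v))"

definition cJ :: "complex^'n \<Rightarrow> complex^'n" where
  "cJ v = \<i> *s v"


section \<open>Complex manifolds and complex Lie groups\<close>

type_synonym ('m, 'e) chart = "'m set \<times> ('m \<Rightarrow> 'e)"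

definition chart_inv :: "('m, 'e) chart \<Rightarrow> 'e \<Rightarrow> 'm" where
  "chart_inv c = inv_into (fst c) (snd c)"

definition complex_atlas :: "('m::topological_space, complex^'n) chart set \<Rightarrow> bool" where
  "complex_atlas A \<longleftrightarrow>
     (\<Union>c\<in>A. fst c) = UNIV \<and>
     (\<forall>c\<in>A. open (fst c) \<and> open (snd c ` fst c) \<and>
            homeomorphism (fst c) (snd c ` fst c) (snd c) (chart_inv c)) \<and>
     (\<forall>c\<in>A. \<forall>d\<in>A. holo_on cJ cJ (snd d \<circ> chart_inv c) (snd c ` (fst c \<inter> fst d)))"

definition prod_atlas :: "('m, 'e) chart set \<Rightarrow> ('k, 'f) chart set \<Rightarrow> ('m \<times> 'k, 'e \<times> 'f) chart set" where
  "prod_atlas A B = {(fst c \<times> fst d, map_prod (snd c) (snd d)) | c d. c \<in> A \<and> d \<in> B}"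

definition holomorphic_map :: "('e::real_normed_vector \<Rightarrow> 'e) \<Rightarrow> ('f::real_normed_vector \<Rightarrow> 'f)
    \<Rightarrow> ('m::topological_space, 'e) chart set \<Rightarrow> ('k::topological_space, 'f) chart set
    \<Rightarrow> ('m \<Rightarrow> 'k) \<Rightarrow> bool" where
  "holomorphic_map J1 J2 A B F \<longleftrightarrow> continuous_on UNIV F \<and>
     (\<forall>c\<in>A. \<forall>d\<in>B. holo_on J1 J2 (snd d \<circ> F \<circ> chart_inv c) (snd c ` (fst c \<inter> F -` fst d)))"

definition complex_lie_group ::
    "'g::{t2_space, second_countable_topology} monoid \<Rightarrow> ('g, complex^'n) chart set \<Rightarrow> bool" where
  "complex_lie_group G A \<longleftrightarrow> group G \<and> carrier G = UNIV \<and> complex_atlas A \<and>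
     holomorphic_map (map_prod cJ cJ) cJ (prod_atlas A A) A (\<lambda>(x, y). x \<otimes>\<^bsub>G\<^esub> y) \<and>
     holomorphic_map cJ cJ A A (\<lambda>x. inv\<^bsub>G\<^esub> x)"


section \<open>Tangent vectors and vector fields\<close>

text \<open>One chart around each point \<open>p\<close> is selected, and the tangent space at \<open>p\<close> is identified with
  the model space \<open>complex^'n\<close> by means of that chart; its complex structure is then \<open>cJ\<close>, since
  all charts are holomorphic. A vector field assigns to \<open>p\<close> its coordinate vector in the
  selected chart at \<open>p\<close>.\<close>

definition chart_at :: "('m, 'e) chart set \<Rightarrow> 'm \<Rightarrow> ('m, 'e) chart" where
  "chart_at A p = (SOME c. c \<in> A \<and> p \<in> fst c)"

definition crd :: "('m, 'e) chart set \<Rightarrow> 'm \<Rightarrow> 'm \<Rightarrow> 'e" where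
  "crd A p = snd (chart_at A p)"

definition crd_inv :: "('m, 'e) chart set \<Rightarrow> 'm \<Rightarrow> 'e \<Rightarrow> 'm" where
  "crd_inv A p = chart_inv (chart_at A p)"

definition mdiff :: "('m, 'e::real_normed_vector) chart set \<Rightarrow> ('m \<Rightarrow> 'm) \<Rightarrow> 'm \<Rightarrow> 'e \<Rightarrow> 'e" where
  "mdiff A F p = frechet_derivative (crd A (F p) \<circ> F \<circ> crd_inv A p) (at (crd A p p))"

definition dfun :: "('m, 'e::real_normed_vector) chart set \<Rightarrow> ('m \<Rightarrow> real) \<Rightarrow> 'm \<Rightarrow> 'e \<Rightarrow> real" where
  "dfun A f p = frechet_derivative (f \<circ> crd_inv A p) (at (crd A p p))"

definition smooth_fun :: "('m, 'e::real_normed_vector) chart set \<Rightarrow> ('m \<Rightarrow> real) \<Rightarrow> bool" where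
  "smooth_fun A f \<longleftrightarrow> (\<forall>c\<in>A. smooth_on (f \<circ> chart_inv c) (snd c ` fst c))"

text \<open>The coordinate expression of a vector field in an arbitrary chart \<open>c\<close>.\<close>

definition vf_in_chart :: "('m, 'e::real_normed_vector) chart set \<Rightarrow> ('m, 'e) chart
    \<Rightarrow> ('m \<Rightarrow> 'e) \<Rightarrow> 'e \<Rightarrow> 'e" where
  "vf_in_chart A c X x = (let q = chart_inv c x in
     frechet_derivative (snd c \<circ> crd_inv A q) (at (crd A q q)) (X q))"

definition smooth_vf :: "('m, 'e::real_normed_vector) chart set \<Rightarrow> ('m \<Rightarrow> 'e) \<Rightarrow> bool" where
  "smooth_vf A X \<longleftrightarrow> (\<forall>c\<in>A. smooth_on (vf_in_chart A c X) (snd c ` fst c))"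

definition vf_bracket :: "('m, 'e::real_normed_vector) chart set \<Rightarrow> ('m \<Rightarrow> 'e) \<Rightarrow> ('m \<Rightarrow> 'e) \<Rightarrow> 'm \<Rightarrow> 'e" where
  "vf_bracket A X Y p =
     frechet_derivative (vf_in_chart A (chart_at A p) Y) (at (crd A p p)) (X p) -
     frechet_derivative (vf_in_chart A (chart_at A p) X) (at (crd A p p)) (Y p)"


section \<open>The Lie algebra\<close>

text \<open>The left-invariant vector field with value \<open>v\<close> at the point \<open>p\<close>.\<close>

definition linv :: "'g monoid \<Rightarrow> ('g, 'e::real_normed_vector) chart set \<Rightarrow> 'g \<Rightarrow> 'e \<Rightarrow> 'g \<Rightarrow> 'e" where
  "linv G A p v q = mdiff A (\<lambda>x. (q \<otimes>\<^bsub>G\<^esub> inv\<^bsub>G\<^esub> p) \<otimes>\<^bsub>G\<^esub> x) p v"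

text \<open>The Lie algebra is the tangent space at the identity, with \<open>lie_ad G A u v = [u, v]\<close>.
  It is a complex Lie algebra; traces below are traces of complex linear maps.\<close>

definition lie_ad :: "'g monoid \<Rightarrow> ('g, complex^'n) chart set \<Rightarrow> complex^'n \<Rightarrow> complex^'n \<Rightarrow> complex^'n" where
  "lie_ad G A u v = vf_bracket A (linv G A \<one>\<^bsub>G\<^esub> u) (linv G A \<one>\<^bsub>G\<^esub> v) \<one>\<^bsub>G\<^esub>"

definition unimodular :: "'g monoid \<Rightarrow> ('g, complex^'n) chart set \<Rightarrow> bool" where
  "unimodular G A \<longleftrightarrow> (\<forall>u. trace (matrix (lie_ad G A u)) = 0)"

definition killing_form :: "'g monoid \<Rightarrow> ('g, complex^'n) chart set \<Rightarrow> complex^'n \<Rightarrow> complex^'n \<Rightarrow> complex" where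
  "killing_form G A u v = trace (matrix (lie_ad G A u \<circ> lie_ad G A v))"

fun lower_central :: "'g monoid \<Rightarrow> nat \<Rightarrow> 'g set" where
  "lower_central G 0 = carrier G"
| "lower_central G (Suc k) = generate G
     {h \<otimes>\<^bsub>G\<^esub> x \<otimes>\<^bsub>G\<^esub> inv\<^bsub>G\<^esub> h \<otimes>\<^bsub>G\<^esub> inv\<^bsub>G\<^esub> x | h x. h \<in> carrier G \<and> x \<in> lower_central G k}"

definition nilpotent_group :: "'g monoid \<Rightarrow> bool" where
  "nilpotent_group G \<longleftrightarrow> (\<exists>k. lower_central G k = {\<one>\<^bsub>G\<^esub>})"


section \<open>Metrics and connections\<close>

type_synonym ('m, 'n) metric = "'m \<Rightarrow> complex^'n \<Rightarrow> complex^'n \<Rightarrow> real"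
type_synonym ('m, 'n) conn =
  "('m \<Rightarrow> complex^'n) \<Rightarrow> ('m \<Rightarrow> complex^'n) \<Rightarrow> 'm \<Rightarrow> complex^'n"

definition hermitian_metric :: "('m, complex^'n) chart set \<Rightarrow> ('m, 'n::finite) metric \<Rightarrow> bool" where
  "hermitian_metric A g \<longleftrightarrow>
     (\<forall>p. bilinear (g p)) \<and>
     (\<forall>p v w. g p v w = g p w v) \<and>
     (\<forall>p v. v \<noteq> 0 \<longrightarrow> g p v v > 0) \<and>
     (\<forall>p v w. g p (cJ v) (cJ w) = g p v w) \<and>
     (\<forall>X Y. smooth_vf A X \<longrightarrow> smooth_vf A Y \<longrightarrow> smooth_fun A (\<lambda>p. g p (X p) (Y p)))"

definition left_invariant :: "'g monoid \<Rightarrow> ('g, complex^'n) chart set \<Rightarrow> ('g, 'n::finite) metric \<Rightarrow> bool" where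
  "left_invariant G A g \<longleftrightarrow>
     (\<forall>a p v w. g (a \<otimes>\<^bsub>G\<^esub> p) (mdiff A (\<lambda>x. a \<otimes>\<^bsub>G\<^esub> x) p v) (mdiff A (\<lambda>x. a \<otimes>\<^bsub>G\<^esub> x) p w) = g p v w)"

text \<open>Affine connections on the tangent bundle, as operators on smooth vector fields;
  their values on non-smooth fields are irrelevant.\<close>

definition connection :: "('m, complex^'n) chart set \<Rightarrow> ('m, 'n::finite) conn \<Rightarrow> bool" where
  "connection A N \<longleftrightarrow>
     (\<forall>X Y. smooth_vf A X \<longrightarrow> smooth_vf A Y \<longrightarrow> smooth_vf A (N X Y)) \<and>
     (\<forall>X X' Y p. smooth_vf A X \<longrightarrow> smooth_vf A X' \<longrightarrow> smooth_vf A Y \<longrightarrow>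
        N (\<lambda>q. X q + X' q) Y p = N X Y p + N X' Y p) \<and>
     (\<forall>f X Y p. smooth_fun A f \<longrightarrow> smooth_vf A X \<longrightarrow> smooth_vf A Y \<longrightarrow>
        N (\<lambda>q. f q *\<^sub>R X q) Y p = f p *\<^sub>R N X Y p) \<and>
     (\<forall>X Y Y' p. smooth_vf A X \<longrightarrow> smooth_vf A Y \<longrightarrow> smooth_vf A Y' \<longrightarrow>
        N X (\<lambda>q. Y q + Y' q) p = N X Y p + N X Y' p) \<and>
     (\<forall>f X Y p. smooth_fun A f \<longrightarrow> smooth_vf A X \<longrightarrow> smooth_vf A Y \<longrightarrow>
        N X (\<lambda>q. f q *\<^sub>R Y q) p = f p *\<^sub>R N X Y p + dfun A f p (X p) *\<^sub>R Y p)"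

definition torsion :: "('m, complex^'n) chart set \<Rightarrow> ('m, 'n::finite) conn
    \<Rightarrow> ('m \<Rightarrow> complex^'n) \<Rightarrow> ('m \<Rightarrow> complex^'n) \<Rightarrow> 'm \<Rightarrow> complex^'n" where
  "torsion A N X Y p = N X Y p - N Y X p - vf_bracket A X Y p"

definition curvature :: "('m, complex^'n) chart set \<Rightarrow> ('m, 'n::finite) conn
    \<Rightarrow> ('m \<Rightarrow> complex^'n) \<Rightarrow> ('m \<Rightarrow> complex^'n) \<Rightarrow> ('m \<Rightarrow> complex^'n) \<Rightarrow> 'm \<Rightarrow> complex^'n" where
  "curvature A N X Y Z p = N X (N Y Z) p - N Y (N X Z) p - N (vf_bracket A X Y) Z p"

definition metric_connection :: "('m, complex^'n) chart set \<Rightarrow> ('m, 'n::finite) metric \<Rightarrow> ('m, 'n) conn \<Rightarrow> bool" where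
  "metric_connection A g N \<longleftrightarrow> connection A N \<and>
     (\<forall>X Y Z p. smooth_vf A X \<longrightarrow> smooth_vf A Y \<longrightarrow> smooth_vf A Z \<longrightarrow>
        dfun A (\<lambda>q. g q (Y q) (Z q)) p (X p) = g p (N X Y p) (Z p) + g p (Y p) (N X Z p))"

definition levi_civita :: "('m, complex^'n) chart set \<Rightarrow> ('m, 'n::finite) metric \<Rightarrow> ('m, 'n) conn \<Rightarrow> bool" where
  "levi_civita A g N \<longleftrightarrow> metric_connection A g N \<and>
     (\<forall>X Y p. smooth_vf A X \<longrightarrow> smooth_vf A Y \<longrightarrow> torsion A N X Y p = 0)"

text \<open>The last clause says that the (1,1)-part
  \<open>(X, Y) \<mapsto> (T(X, Y) + T(JX, JY)) / 2\<close> of the torsion vanishes.\<close>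

definition chern_connection :: "('m, complex^'n) chart set \<Rightarrow> ('m, 'n::finite) metric \<Rightarrow> ('m, 'n) conn \<Rightarrow> bool" where
  "chern_connection A g N \<longleftrightarrow> metric_connection A g N \<and>
     (\<forall>X Y p. smooth_vf A X \<longrightarrow> smooth_vf A Y \<longrightarrow> N X (\<lambda>q. cJ (Y q)) p = cJ (N X Y p)) \<and>
     (\<forall>X Y p. smooth_vf A X \<longrightarrow> smooth_vf A Y \<longrightarrow>
        torsion A N X Y p + torsion A N (\<lambda>q. cJ (X q)) (\<lambda>q. cJ (Y q)) p = 0)"


section \<open>Torsion, curvature and Ricci tensors at a point\<close>

text \<open>Torsion and curvature are tensorial, so they can be evaluated on the tangent
  vectors at \<open>p\<close> by means of the left-invariant extensions.\<close>

definition torsion_at :: "'g monoid \<Rightarrow> ('g, complex^'n) chart set \<Rightarrow> ('g, 'n::finite) conn \<Rightarrow> 'g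
    \<Rightarrow> complex^'n \<Rightarrow> complex^'n \<Rightarrow> complex^'n" where
  "torsion_at G A N p u v = torsion A N (linv G A p u) (linv G A p v) p"

definition curvature_at :: "'g monoid \<Rightarrow> ('g, complex^'n) chart set \<Rightarrow> ('g, 'n::finite) conn \<Rightarrow> 'g
    \<Rightarrow> complex^'n \<Rightarrow> complex^'n \<Rightarrow> complex^'n \<Rightarrow> complex^'n" where
  "curvature_at G A N p u v w = curvature A N (linv G A p u) (linv G A p v) (linv G A p w) p"

text \<open>\<open>Ric(v, w)\<close> is the trace of the real endomorphism \<open>u \<mapsto> R(u, v)w\<close>, here taken
  in the standard real basis of the model space.\<close>

definition Ric :: "'g monoid \<Rightarrow> ('g, complex^'n) chart set \<Rightarrow> ('g, 'n::finite) conn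
    \<Rightarrow> 'g \<Rightarrow> complex^'n \<Rightarrow> complex^'n \<Rightarrow> real" where
  "Ric G A N p v w = (\<Sum>b\<in>Basis. curvature_at G A N p b v w \<bullet> b)"

definition Ric11 :: "'g monoid \<Rightarrow> ('g, complex^'n) chart set \<Rightarrow> ('g, 'n::finite) conn
    \<Rightarrow> 'g \<Rightarrow> complex^'n \<Rightarrow> complex^'n \<Rightarrow> real" where
  "Ric11 G A N p v w = 1/2 * (Ric G A N p v w + Ric G A N p (cJ v) (cJ w))"


section \<open>Complexified tangent vectors\<close>

text \<open>The pair \<open>(a, b)\<close> stands for the complexified tangent vector \<open>a + \<i> b\<close>, where \<open>\<i>\<close> is
  the scalar of the complexification, not \<open>cJ\<close>. \<open>cext f\<close> extends \<open>f\<close> complex linearly, and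
  \<open>Zf i\<close> is the coordinate vector \<open>\<partial>/\<partial>z\<^sub>i = (\<partial>/\<partial>x\<^sub>i - \<i> J \<partial>/\<partial>x\<^sub>i) / 2\<close>, a frame of (1,0)-vectors.\<close>

definition cext :: "('e \<Rightarrow> complex) \<Rightarrow> 'e \<times> 'e \<Rightarrow> complex" where
  "cext f z = f (fst z) + \<i> * f (snd z)"

definition Zf :: "'n::finite \<Rightarrow> (complex^'n) \<times> (complex^'n)" where
  "Zf i = ((1/2) *\<^sub>R axis i 1, - (1/2) *\<^sub>R cJ (axis i 1))"

definition Zbar :: "'n::finite \<Rightarrow> (complex^'n) \<times> (complex^'n)" where
  "Zbar i = (fst (Zf i), - snd (Zf i))"

definition cext2 :: "('e \<Rightarrow> 'e \<Rightarrow> real) \<Rightarrow> 'e \<times> 'e \<Rightarrow> 'e \<times> 'e \<Rightarrow> complex" where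
  "cext2 h y z = cext (\<lambda>u. cext (\<lambda>v. of_real (h u v)) z) y"

definition cext3 :: "('e \<Rightarrow> 'e \<Rightarrow> 'e \<Rightarrow> real) \<Rightarrow> 'e \<times> 'e \<Rightarrow> 'e \<times> 'e \<Rightarrow> 'e \<times> 'e \<Rightarrow> complex" where
  "cext3 h x y z = cext (\<lambda>u. cext2 (h u) y z) x"

definition cext4 :: "('e \<Rightarrow> 'e \<Rightarrow> 'e \<Rightarrow> 'e \<Rightarrow> real)
    \<Rightarrow> 'e \<times> 'e \<Rightarrow> 'e \<times> 'e \<Rightarrow> 'e \<times> 'e \<Rightarrow> 'e \<times> 'e \<Rightarrow> complex" where
  "cext4 h w x y z = cext (\<lambda>u. cext3 (h u) x y z) w"

text \<open>The inverse metric \<open>gup g p k l\<close> with \<open>k\<close> unbarred and \<open>l\<close> barred, normalised by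
  \<open>(\<Sum>l. gup g p k l * g(Z\<^sub>m, \<bar>Z\<^sub>l))\<close> being \<open>1\<close> if \<open>k = m\<close> and \<open>0\<close> otherwise.\<close>

definition gup :: "('m, 'n::finite) metric \<Rightarrow> 'm \<Rightarrow> 'n \<Rightarrow> 'n \<Rightarrow> complex" where
  "gup g p k l = matrix_inv (\<chi> i j. cext2 (g p) (Zf i) (Zbar j)) $ l $ k"

definition tr_g :: "('m, 'n::finite) metric \<Rightarrow> ('m \<Rightarrow> complex^'n \<Rightarrow> complex^'n \<Rightarrow> real) \<Rightarrow> 'm \<Rightarrow> complex" where
  "tr_g g h p = (\<Sum>i\<in>UNIV. \<Sum>j\<in>UNIV. gup g p i j * cext2 (h p) (Zf i) (Zbar j))"


section \<open>The tensor K\<close>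

text \<open>In the following, \<open>D\<close> is the Chern connection of \<open>g\<close>.\<close>

definition Tc :: "'g monoid \<Rightarrow> ('g, complex^'n) chart set \<Rightarrow> ('g, 'n::finite) metric \<Rightarrow> ('g, 'n) conn \<Rightarrow> 'g
    \<Rightarrow> (complex^'n) \<times> (complex^'n) \<Rightarrow> (complex^'n) \<times> (complex^'n) \<Rightarrow> (complex^'n) \<times> (complex^'n) \<Rightarrow> complex" where
  "Tc G A g D p = cext3 (\<lambda>u v w. g p (torsion_at G A D p u v) w)"

definition Omc :: "'g monoid \<Rightarrow> ('g, complex^'n) chart set \<Rightarrow> ('g, 'n::finite) metric \<Rightarrow> ('g, 'n) conn \<Rightarrow> 'g
    \<Rightarrow> (complex^'n) \<times> (complex^'n) \<Rightarrow> (complex^'n) \<times> (complex^'n)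
    \<Rightarrow> (complex^'n) \<times> (complex^'n) \<Rightarrow> (complex^'n) \<times> (complex^'n) \<Rightarrow> complex" where
  "Omc G A g D p = cext4 (\<lambda>u v w x. g p (curvature_at G A D p u v w) x)"

definition Sten :: "'g monoid \<Rightarrow> ('g, complex^'n) chart set \<Rightarrow> ('g, 'n::finite) metric \<Rightarrow> ('g, 'n) conn
    \<Rightarrow> 'g \<Rightarrow> 'n \<Rightarrow> 'n \<Rightarrow> complex" where
  "Sten G A g D p i j = (\<Sum>k\<in>UNIV. \<Sum>l\<in>UNIV.
     gup g p k l * Omc G A g D p (Zf k) (Zbar l) (Zf i) (Zbar j))"

definition Q1 :: "'g monoid \<Rightarrow> ('g, complex^'n) chart set \<Rightarrow> ('g, 'n::finite) metric \<Rightarrow> ('g, 'n) conn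
    \<Rightarrow> 'g \<Rightarrow> 'n \<Rightarrow> 'n \<Rightarrow> complex" where
  "Q1 G A g D p i j = (\<Sum>k\<in>UNIV. \<Sum>l\<in>UNIV. \<Sum>m\<in>UNIV. \<Sum>n\<in>UNIV. gup g p k l * gup g p m n *
     Tc G A g D p (Zf i) (Zf k) (Zbar n) * Tc G A g D p (Zbar j) (Zbar l) (Zf m))"

definition Q2 :: "'g monoid \<Rightarrow> ('g, complex^'n) chart set \<Rightarrow> ('g, 'n::finite) metric \<Rightarrow> ('g, 'n) conn
    \<Rightarrow> 'g \<Rightarrow> 'n \<Rightarrow> 'n \<Rightarrow> complex" where
  "Q2 G A g D p i j = (\<Sum>k\<in>UNIV. \<Sum>l\<in>UNIV. \<Sum>m\<in>UNIV. \<Sum>n\<in>UNIV. gup g p k l * gup g p m n *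
     Tc G A g D p (Zbar l) (Zbar n) (Zf i) * Tc G A g D p (Zf k) (Zf m) (Zbar j))"

definition Q3 :: "'g monoid \<Rightarrow> ('g, complex^'n) chart set \<Rightarrow> ('g, 'n::finite) metric \<Rightarrow> ('g, 'n) conn
    \<Rightarrow> 'g \<Rightarrow> 'n \<Rightarrow> 'n \<Rightarrow> complex" where
  "Q3 G A g D p i j = (\<Sum>k\<in>UNIV. \<Sum>l\<in>UNIV. \<Sum>m\<in>UNIV. \<Sum>n\<in>UNIV. gup g p k l * gup g p m n *
     Tc G A g D p (Zf i) (Zf k) (Zbar l) * Tc G A g D p (Zbar j) (Zbar n) (Zf m))"

definition Q4 :: "'g monoid \<Rightarrow> ('g, complex^'n) chart set \<Rightarrow> ('g, 'n::finite) metric \<Rightarrow> ('g, 'n) conn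
    \<Rightarrow> 'g \<Rightarrow> 'n \<Rightarrow> 'n \<Rightarrow> complex" where
  "Q4 G A g D p i j = 1/2 * (\<Sum>k\<in>UNIV. \<Sum>l\<in>UNIV. \<Sum>m\<in>UNIV. \<Sum>n\<in>UNIV. gup g p k l * gup g p m n *
     (Tc G A g D p (Zf m) (Zf k) (Zbar l) * Tc G A g D p (Zbar n) (Zbar j) (Zf i) +
      Tc G A g D p (Zbar n) (Zbar l) (Zf k) * Tc G A g D p (Zf m) (Zf i) (Zbar j)))"

definition Kc :: "'g monoid \<Rightarrow> ('g, complex^'n) chart set \<Rightarrow> ('g, 'n::finite) metric \<Rightarrow> ('g, 'n) conn
    \<Rightarrow> 'g \<Rightarrow> 'n \<Rightarrow> 'n \<Rightarrow> complex" where
  "Kc G A g D p i j = Sten G A g D p i j -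
     (1/2 * Q1 G A g D p i j - 1/4 * Q2 G A g D p i j - 1/2 * Q3 G A g D p i j + Q4 G A g D p i j)"

text \<open>The \<open>J\<close>-invariant symmetric 2-tensor with components \<open>K(Z\<^sub>i, \<bar>Z\<^sub>j) = Kc i j\<close>. A real vector \<open>v\<close> is
  \<open>\<Sum>i. v\<^sub>i Z\<^sub>i + cnj v\<^sub>i \<bar>Z\<^sub>i\<close>, so \<open>K(v, w) = \<Sum>i j. Kc i j * (v\<^sub>i * cnj w\<^sub>j + w\<^sub>i * cnj v\<^sub>j)\<close>, which is the
  formula below because \<open>Kc\<close> is Hermitian, i.e. \<open>Kc j i = cnj (Kc i j)\<close>.\<close>

definition Kten :: "'g monoid \<Rightarrow> ('g, complex^'n) chart set \<Rightarrow> ('g, 'n::finite) metric \<Rightarrow> ('g, 'n) conn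
    \<Rightarrow> 'g \<Rightarrow> complex^'n \<Rightarrow> complex^'n \<Rightarrow> real" where
  "Kten G A g D p v w = 2 * Re (\<Sum>i\<in>UNIV. \<Sum>j\<in>UNIV. Kc G A g D p i j * v $ i * cnj (w $ j))"

end

theory Submission
  imports Defs
begin

text \<open>Write \<open>J\<close> for the complex structure. Because multiplication is holomorphic, the bracket of the Lie
algebra is complex bilinear (\<open>lie_ad_bilinear\<close>), and this makes all the tensors computable.

The Chern connection \<open>D\<close> annihilates left-invariant fields (\<open>chern_field\<close>): the vanishing of the
\<open>(1,1)\<close>-torsion gives \<open>D\<^bsub>JX\<^esub> = J D\<^bsub>X\<^esub>\<close> on them, but \<open>D\<^bsub>X\<^esub>\<close> and \<open>D\<^bsub>JX\<^esub>\<close> are both skew, whereas \<open>J\<close> times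
a skew map commuting with \<open>J\<close> is symmetric. So the Chern curvature vanishes, the Chern torsion
is minus the bracket, and \<open>K = - Q\<close> is quadratic in the structure constants. The Levi-Civita
connection is given on left-invariant fields by the Koszul formula, so the Ricci tensor is an
algebraic expression in the bracket too, and everything is linear algebra in one tangent space.

Let \<open>E\<close> be a unitary frame, \<open>\<tau>(z)\<close> the complex trace of \<open>ad z\<close>, \<open>B\<close> the Killing form and \<open>H\<close> the Hermitian
inner product with real part \<open>g\<close>. Then (\<open>ric_frame\<close>)

\<open>Ric(v, w) = F(v, w) - Re B(v, w) - 2 Re \<tau>(\<nabla>\<^sub>v w)\<close>, where

\<open>F(v, w) = - \<Sum>\<^sub>a g([v, E\<^sub>a], [w, E\<^sub>a]) + 1/2 \<Sum>\<^sub>a\<^sub>b Re (cnj (H([E\<^sub>a, E\<^sub>b], v)) H([E\<^sub>a, E\<^sub>b], w))\<close>,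

while \<open>K\<close> is the sum of the same \<open>F\<close> and of terms that are quadratic in the bracket and contain a
factor \<open>\<tau>\<close>. With \<open>N = \<Sum>\<^sub>a\<^sub>b |[E\<^sub>a, E\<^sub>b]|\<^sup>2\<close> and \<open>t = \<Sum>\<^sub>a |\<tau>(E\<^sub>a)|\<^sup>2\<close> the traces are \<open>k = - N/2 - t\<close>
(\<open>tr_g_kappa\<close>) and \<open>r = - N/2 - 2t\<close> (\<open>tr_g_ric\<close>). Hence \<open>r = k\<close> exactly if \<open>t = 0\<close>, that is, if \<open>G\<close>
is unimodular. In that case \<open>K = F = Ric + Re B\<close>. Since \<open>B\<close> is complex bilinear, \<open>B(Jv, Jw) = - B(v, w)\<close>,
so the Killing term disappears from the \<open>J\<close>-invariant part and \<open>K = Ric\<^sup>1\<^sup>,\<^sup>1\<close>; and \<open>K = Ric\<close> holds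
exactly if \<open>Re B = 0\<close>, which for a complex bilinear form means \<open>B = 0\<close>. Conversely \<open>K = Ric\<^sup>1\<^sup>,\<^sup>1\<close>
implies \<open>k = r\<close> because \<open>Ric\<close> and \<open>Ric\<^sup>1\<^sup>,\<^sup>1\<close> have the same trace.

If \<open>G\<close> is nilpotent, then all iterated commutators of some length are trivial. Differentiating such
a commutator in its innermost entry at \<open>\<one>\<close>, and then in the other entries at \<open>\<one>\<close> one after another,
turns each commutator with \<open>x\<close> into \<open>ad u\<close> (\<open>diff_commut_tendsto_lie_ad\<close>). So all products of a fixed
number of maps \<open>ad u\<close> vanish, \<open>ad u\<close> and \<open>ad u \<circ> ad v\<close> are nilpotent, hence traceless, and \<open>G\<close> is unimodular
with vanishing Killing form.\<close>

section \<open>Second derivatives\<close>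

lemma frechet_derivative_cong_open:
  assumes "open S" "x \<in> S" "\<And>y. y \<in> S \<Longrightarrow> f y = g y"
  shows "frechet_derivative f (at x) = frechet_derivative g (at x)"
proof -
  have "(f has_derivative D) (at x) \<longleftrightarrow> (g has_derivative D) (at x)" for D
    using assms by (metis has_derivative_transform_within_open)
  then show ?thesis by (simp add: frechet_derivative_def)
qed

lemma Ck_on_cong_open:
  assumes "open S" "\<And>y. y \<in> S \<Longrightarrow> f y = g y" "Ck_on k f S"
  shows "Ck_on k g S"
  using assms(2,3)
proof (induction k arbitrary: f g)
  case 0
  then show ?case using continuous_on_cong[of S S f g] by simp
next
  case (Suc k)
  have "g differentiable_on S"
    using Suc.prems unfolding differentiable_on_def
    by (metis Ck_on.simps(2) differentiable_on_def differentiable_transform_within zero_less_one)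
  moreover have "Ck_on k (\<lambda>x. frechet_derivative g (at x) v) S" for v
  proof (rule Suc.IH)
    show "Ck_on k (\<lambda>x. frechet_derivative f (at x) v) S" using Suc.prems by simp
    show "frechet_derivative f (at y) v = frechet_derivative g (at y) v" if "y \<in> S" for y
      using frechet_derivative_cong_open[OF \<open>open S\<close> that] Suc.prems(1) by metis
  qed
  ultimately show ?case by simp
qed

lemma smooth_on_cong_open:
  assumes "open S" "\<And>y. y \<in> S \<Longrightarrow> f y = g y" "smooth_on f S"
  shows "smooth_on g S"
  using assms Ck_on_cong_open unfolding smooth_on_def by blast

lemma smooth_on_has_derivative:
  assumes "smooth_on f S" "open S" "x \<in> S"
  shows "(f has_derivative frechet_derivative f (at x)) (at x)"
proof -
  have "f differentiable_on S" using assms(1) unfolding smooth_on_def by (metis Ck_on.simps(2))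
  then show ?thesis using assms
    by (metis differentiable_on_eq_differentiable_at frechet_derivative_works)
qed

lemma smooth_on_frechet:
  assumes "smooth_on f S"
  shows "smooth_on (\<lambda>x. frechet_derivative f (at x) v) S"
  using assms unfolding smooth_on_def by (metis Ck_on.simps(2))

lemma smooth_on_const: "smooth_on (\<lambda>x. c) S"
proof -
  have "Ck_on k (\<lambda>x::'a. c) S" for k and c :: 'b
    by (induction k arbitrary: c) (auto simp: differentiable_on_def)
  then show ?thesis by (simp add: smooth_on_def)
qed

text \<open>The affine maps of interest are \<open>x \<mapsto> (x, b)\<close> and \<open>y \<mapsto> (a, y)\<close>, which freeze one argument of a map of two.\<close>

lemma smooth_on_compose_affine:
  fixes f :: "'a::real_normed_vector \<Rightarrow> 'c::real_normed_vector"
    and L :: "'b::real_normed_vector \<Rightarrow> 'a"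
  assumes "smooth_on f S" "open S" "open T" and L: "bounded_linear L"
    and into: "\<And>x. x \<in> T \<Longrightarrow> a + L x \<in> S"
  shows "smooth_on (\<lambda>x. f (a + L x)) T"
proof -
  have "Ck_on k (\<lambda>x. f (a + L x)) T" if "Ck_on k f S" for k
    using that
  proof (induction k arbitrary: f)
    case 0
    have "continuous_on T (f \<circ> (\<lambda>x. a + L x))"
      using 0 into by (intro continuous_on_compose continuous_intros bounded_linear.continuous_on[OF L])
        (auto elim!: continuous_on_subset)
    then show ?case by (simp add: o_def)
  next
    case (Suc k)
    have d: "((\<lambda>x. f (a + L x)) has_derivative (\<lambda>v. frechet_derivative f (at (a + L x)) (L v))) (at x)"
      if "x \<in> T" for x
    proof -
      have "(f has_derivative frechet_derivative f (at (a + L x))) (at (a + L x))"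
        using Suc.prems assms(2) into[OF that]
        by (metis Ck_on.simps(2) differentiable_on_eq_differentiable_at frechet_derivative_works)
      moreover have "((\<lambda>x. a + L x) has_derivative L) (at x)"
        using bounded_linear_imp_has_derivative[OF L, of "at x"] by (auto intro!: derivative_eq_intros)
      ultimately have "(f \<circ> (\<lambda>x. a + L x) has_derivative frechet_derivative f (at (a + L x)) \<circ> L) (at x)"
        by (intro diff_chain_at)
      then show ?thesis by (simp add: o_def)
    qed
    have "Ck_on k (\<lambda>x. frechet_derivative (\<lambda>x. f (a + L x)) (at x) v) T" for v
    proof (rule Ck_on_cong_open[OF \<open>open T\<close>])
      show "Ck_on k (\<lambda>x. frechet_derivative f (at (a + L x)) (L v)) T"
        using Suc.IH[of "\<lambda>z. frechet_derivative f (at z) (L v)"] Suc.prems by simp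
      show "frechet_derivative f (at (a + L y)) (L v) = frechet_derivative (\<lambda>x. f (a + L x)) (at y) v"
        if "y \<in> T" for y
        using frechet_derivative_at[OF d[OF that]] by metis
    qed
    moreover have "(\<lambda>x. f (a + L x)) differentiable_on T"
      using d assms(3) by (meson differentiableI differentiable_at_imp_differentiable_on)
    ultimately show ?case by simp
  qed
  then show ?thesis using assms(1) by (simp add: smooth_on_def)
qed

lemma smooth_on_pair_right:
  fixes f :: "'a::real_normed_vector \<times> 'b::real_normed_vector \<Rightarrow> 'c::real_normed_vector"
  assumes "smooth_on f S" "open S" "open T" "\<And>x. x \<in> T \<Longrightarrow> (x, b) \<in> S"
  shows "smooth_on (\<lambda>x. f (x, b)) T"
proof -
  have "bounded_linear (\<lambda>x. (x, 0) :: 'a \<times> 'b)"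
    by (intro bounded_linear_Pair bounded_linear_ident bounded_linear_zero)
  from smooth_on_compose_affine[OF assms(1-3) this, of "(0, b)"] assms(4) show ?thesis by simp
qed

lemma smooth_on_pair_left:
  fixes f :: "'a::real_normed_vector \<times> 'b::real_normed_vector \<Rightarrow> 'c::real_normed_vector"
  assumes "smooth_on f S" "open S" "open T" "\<And>y. y \<in> T \<Longrightarrow> (a, y) \<in> S"
  shows "smooth_on (\<lambda>y. f (a, y)) T"
proof -
  have "bounded_linear (\<lambda>y. (0, y) :: 'a \<times> 'b)"
    by (intro bounded_linear_Pair bounded_linear_ident bounded_linear_zero)
  from smooth_on_compose_affine[OF assms(1-3) this, of "(a, 0)"] assms(4) show ?thesis by simp
qed

text \<open>The mean value theorem is applied first in the direction \<open>v\<close>, to the increment of \<open>f\<close> along \<open>w\<close>, and then to the derivative so obtained, in the direction \<open>w\<close>.\<close>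

lemma second_difference_eq_mixed_derivative:
  fixes f :: "'a::real_normed_vector \<Rightarrow> real"
  assumes U: "\<And>s r. 0 \<le> s \<Longrightarrow> s \<le> t \<Longrightarrow> 0 \<le> r \<Longrightarrow> r \<le> t \<Longrightarrow> x + s *\<^sub>R v + r *\<^sub>R w \<in> S"
    and S: "open S" and t: "0 < t" and f: "Ck_on 2 f S"
  obtains \<xi> \<eta> where "0 \<le> \<xi>" "\<xi> \<le> t" "0 \<le> \<eta>" "\<eta> \<le> t"
    "f (x + t *\<^sub>R v + t *\<^sub>R w) - f (x + t *\<^sub>R v) - f (x + t *\<^sub>R w) + f x =
      t * t * frechet_derivative (\<lambda>y. frechet_derivative f (at y) v) (at (x + \<xi> *\<^sub>R v + \<eta> *\<^sub>R w)) w"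
proof -
  define fv where "fv y = frechet_derivative f (at y) v" for y
  have f2: "f differentiable_on S" "fv differentiable_on S"
    using f by (auto simp: numeral_2_eq_2 fv_def[abs_def])
  have df: "(f has_derivative frechet_derivative f (at y)) (at y)" if "y \<in> S" for y
    using f2(1) S that by (metis differentiable_on_eq_differentiable_at frechet_derivative_works)
  have dfv: "(fv has_derivative frechet_derivative fv (at y)) (at y)" if "y \<in> S" for y
    using f2(2) S that by (metis differentiable_on_eq_differentiable_at frechet_derivative_works)
  have line: "((\<lambda>s. h (z + s *\<^sub>R u)) has_real_derivative frechet_derivative h (at (z + s *\<^sub>R u)) u) (at s)"
    if "(h has_derivative frechet_derivative h (at (z + s *\<^sub>R u))) (at (z + s *\<^sub>R u))"
    for h :: "'a \<Rightarrow> real" and z u s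
  proof -
    have "((\<lambda>s. z + s *\<^sub>R u) has_derivative (\<lambda>s. s *\<^sub>R u)) (at s)"
      by (auto intro!: derivative_eq_intros)
    from diff_chain_at[OF this that]
    have "((\<lambda>s. h (z + s *\<^sub>R u)) has_derivative (\<lambda>r. frechet_derivative h (at (z + s *\<^sub>R u)) (r *\<^sub>R u))) (at s)"
      by (simp add: o_def)
    moreover have "frechet_derivative h (at (z + s *\<^sub>R u)) (r *\<^sub>R u) = frechet_derivative h (at (z + s *\<^sub>R u)) u * r" for r
      using has_derivative_linear[OF that] by (simp add: linear_cmul)
    ultimately show ?thesis by (simp add: has_field_derivative_def)
  qed
  define \<psi> where "\<psi> s = f ((x + t *\<^sub>R w) + s *\<^sub>R v) - f (x + s *\<^sub>R v)" for s
  have d\<psi>: "(\<psi> has_real_derivative fv ((x + t *\<^sub>R w) + s *\<^sub>R v) - fv (x + s *\<^sub>R v)) (at s)"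
    if "0 \<le> s" "s \<le> t" for s
    unfolding \<psi>_def fv_def
    using U[of s t] U[of s 0] that t
    by (intro DERIV_diff line df) (auto simp: add_ac)
  from MVT2[OF t d\<psi>] obtain \<xi> where \<xi>: "0 < \<xi>" "\<xi> < t"
    "\<psi> t - \<psi> 0 = (t - 0) * (fv ((x + t *\<^sub>R w) + \<xi> *\<^sub>R v) - fv (x + \<xi> *\<^sub>R v))"
    by blast
  have "((\<lambda>s. fv ((x + \<xi> *\<^sub>R v) + s *\<^sub>R w)) has_real_derivative
      frechet_derivative fv (at ((x + \<xi> *\<^sub>R v) + s *\<^sub>R w)) w) (at s)" if "0 \<le> s" "s \<le> t" for s
    using U[of \<xi> s] that \<xi> by (intro line dfv) auto
  from MVT2[OF t this] obtain \<eta> where \<eta>: "0 < \<eta>" "\<eta> < t"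
    "fv ((x + \<xi> *\<^sub>R v) + t *\<^sub>R w) - fv ((x + \<xi> *\<^sub>R v) + 0 *\<^sub>R w) =
      (t - 0) * frechet_derivative fv (at ((x + \<xi> *\<^sub>R v) + \<eta> *\<^sub>R w)) w"
    by blast
  have "f (x + t *\<^sub>R v + t *\<^sub>R w) - f (x + t *\<^sub>R v) - f (x + t *\<^sub>R w) + f x = \<psi> t - \<psi> 0"
    by (simp add: \<psi>_def add_ac)
  also have "\<dots> = t * t * frechet_derivative fv (at (x + \<xi> *\<^sub>R v + \<eta> *\<^sub>R w)) w"
    using \<xi> \<eta> by (simp add: add_ac)
  finally show ?thesis using that[of \<xi> \<eta>] \<xi> \<eta> unfolding fv_def[abs_def] by simp
qed

text \<open>The difference quotient is symmetric in \<open>v\<close> and \<open>w\<close>, so its limit, the mixed derivative, is symmetric as well.\<close>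

lemma mixed_derivative_limit:
  fixes f :: "'a::real_normed_vector \<Rightarrow> real"
  assumes S: "open S" "x \<in> S" and f: "Ck_on 2 f S"
  shows "((\<lambda>t. (f (x + t *\<^sub>R v + t *\<^sub>R w) - f (x + t *\<^sub>R v) - f (x + t *\<^sub>R w) + f x) / (t * t))
     \<longlongrightarrow> frechet_derivative (\<lambda>y. frechet_derivative f (at y) v) (at x) w) (at_right 0)"
    (is "(?q \<longlongrightarrow> ?d x) _")
proof (rule tendstoI)
  fix e :: real assume e: "0 < e"
  have "continuous_on S ?d"
    using f by (auto simp: numeral_2_eq_2)
  then have "(?d \<longlongrightarrow> ?d x) (at x)" using S continuous_on_eq_continuous_at[of S ?d] by (simp add: isCont_def)
  then have "eventually (\<lambda>y. dist (?d y) (?d x) < e) (at x)" using e by (rule tendstoD)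
  then obtain \<delta> where d0: "\<delta> > 0" "\<forall>y. y \<noteq> x \<and> dist y x < \<delta> \<longrightarrow> dist (?d y) (?d x) < e"
    by (auto simp: eventually_at)
  have \<delta>: "dist (?d y) (?d x) < e" if "dist y x < \<delta>" for y
    using d0 e that by (cases "y = x") auto
  obtain \<rho> where \<rho>: "\<rho> > 0" "ball x \<rho> \<subseteq> S" using S open_contains_ball by blast
  define M where "M = norm v + norm w + 1"
  have M: "M > 0" by (simp add: M_def add_nonneg_pos)
  \<comment> \<open>for \<open>s\<close>, \<open>r\<close> in \<open>[0, t]\<close> with \<open>t < T\<close>, the points \<open>x + s v + r w\<close> stay in \<open>S\<close> and within \<open>\<delta>\<close> of \<open>x\<close>\<close>
  define T where "T = min \<delta> \<rho> / M"
  have T: "T > 0" using d0 \<rho> M by (simp add: T_def)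
  have near: "dist (x + s *\<^sub>R v + r *\<^sub>R w) x < min \<delta> \<rho>"
    if "0 \<le> s" "s \<le> t" "0 \<le> r" "r \<le> t" "0 < t" "t < T" for s r t
  proof -
    have "dist (x + s *\<^sub>R v + r *\<^sub>R w) x = norm (s *\<^sub>R v + r *\<^sub>R w)" by (simp add: dist_norm)
    also have "\<dots> \<le> s * norm v + r * norm w" using that norm_triangle_ineq[of "s *\<^sub>R v" "r *\<^sub>R w"] by simp
    also have "\<dots> \<le> t * norm v + t * norm w" using that by (intro add_mono mult_right_mono) auto
    also have "\<dots> \<le> t * M" using that by (simp add: M_def algebra_simps)
    also have "\<dots> < T * M" using that M by simp
    also have "\<dots> = min \<delta> \<rho>" using M by (simp add: T_def)
    finally show ?thesis .
  qed
  have "dist (?q t) (?d x) < e" if t: "0 < t" "t < T" for t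
  proof -
    have "x + s *\<^sub>R v + r *\<^sub>R w \<in> S" if "0 \<le> s" "s \<le> t" "0 \<le> r" "r \<le> t" for s r
    proof -
      have "dist (x + s *\<^sub>R v + r *\<^sub>R w) x < \<rho>" using near[OF that t] by simp
      then show ?thesis using \<rho>(2) by (auto simp: dist_commute)
    qed
    from second_difference_eq_mixed_derivative[OF this S(1) t(1) f]
    obtain \<xi> \<eta> where *: "0 \<le> \<xi>" "\<xi> \<le> t" "0 \<le> \<eta>" "\<eta> \<le> t"
      "f (x + t *\<^sub>R v + t *\<^sub>R w) - f (x + t *\<^sub>R v) - f (x + t *\<^sub>R w) + f x
        = t * t * ?d (x + \<xi> *\<^sub>R v + \<eta> *\<^sub>R w)"
      by blast
    then have "?q t = ?d (x + \<xi> *\<^sub>R v + \<eta> *\<^sub>R w)" using t by simp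
    then show ?thesis using \<delta> near[OF *(1-4) t] by auto
  qed
  then show "\<forall>\<^sub>F t in at_right 0. dist (?q t) (?d x) < e"
    using T by (auto simp: eventually_at_right_field)
qed

lemma mixed_derivative_symmetric_real:
  fixes f :: "'a::real_normed_vector \<Rightarrow> real"
  assumes "open S" "x \<in> S" and "Ck_on 2 f S"
  shows "frechet_derivative (\<lambda>y. frechet_derivative f (at y) v) (at x) w =
         frechet_derivative (\<lambda>y. frechet_derivative f (at y) w) (at x) v"
proof -
  have "((\<lambda>t. (f (x + t *\<^sub>R v + t *\<^sub>R w) - f (x + t *\<^sub>R v) - f (x + t *\<^sub>R w) + f x) / (t * t))
     \<longlongrightarrow> frechet_derivative (\<lambda>y. frechet_derivative f (at y) w) (at x) v) (at_right 0)"
    using mixed_derivative_limit[OF assms, of w v] by (simp add: algebra_simps)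
  then show ?thesis
    using mixed_derivative_limit[OF assms, of v w] tendsto_unique trivial_limit_at_right_real by blast
qed

lemma frechet_derivative_inner:
  fixes f :: "'a::real_normed_vector \<Rightarrow> 'b::real_inner"
  assumes "f differentiable at x"
  shows "frechet_derivative (\<lambda>y. f y \<bullet> b) (at x) v = frechet_derivative f (at x) v \<bullet> b"
proof -
  have "((\<lambda>y. f y \<bullet> b) has_derivative (\<lambda>v. frechet_derivative f (at x) v \<bullet> b)) (at x)"
    using assms by (intro has_derivative_inner_left) (simp add: frechet_derivative_works)
  from frechet_derivative_at[OF this] show ?thesis by (metis)
qed

lemma Ck_on_inner:
  fixes f :: "'a::real_normed_vector \<Rightarrow> 'b::real_inner"
  assumes "open S" "Ck_on k f S"
  shows "Ck_on k (\<lambda>y. f y \<bullet> b) S"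
  using assms(2)
proof (induction k arbitrary: f)
  case 0
  then show ?case by (auto intro: continuous_intros)
next
  case (Suc k)
  have d: "f differentiable at x" if "x \<in> S" for x
    using Suc.prems that assms(1) by (simp add: differentiable_on_eq_differentiable_at)
  have "Ck_on k (\<lambda>x. frechet_derivative (\<lambda>y. f y \<bullet> b) (at x) v) S" for v
    by (rule Ck_on_cong_open[OF assms(1), of "\<lambda>x. frechet_derivative f (at x) v \<bullet> b"])
      (use Suc frechet_derivative_inner[OF d] in auto)
  moreover have "(\<lambda>y. f y \<bullet> b) differentiable_on S"
  proof (rule differentiable_at_imp_differentiable_on)
    show "(\<lambda>y. f y \<bullet> b) differentiable at x" if "x \<in> S" for x
      using d[OF that] has_derivative_inner_left unfolding differentiable_def by blast
  qed
  ultimately show ?case by simp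
qed

lemma mixed_derivative_symmetric:
  fixes f :: "'a::real_normed_vector \<Rightarrow> 'b::euclidean_space"
  assumes S: "open S" "x \<in> S" and f: "smooth_on f S"
  shows "frechet_derivative (\<lambda>y. frechet_derivative f (at y) v) (at x) w =
         frechet_derivative (\<lambda>y. frechet_derivative f (at y) w) (at x) v"
proof (rule euclidean_eqI)
  fix b :: 'b assume "b \<in> Basis"
  have d: "f differentiable at y" if "y \<in> S" for y
    using smooth_on_has_derivative[OF f S(1) that] by (rule differentiableI)
  have d2: "(\<lambda>y. frechet_derivative f (at y) u) differentiable at x" for u
    using smooth_on_has_derivative[OF smooth_on_frechet[OF f] S] by (rule differentiableI)
  have *: "frechet_derivative (\<lambda>y. frechet_derivative f (at y) u) (at x) z \<bullet> b =
    frechet_derivative (\<lambda>y. frechet_derivative (\<lambda>y. f y \<bullet> b) (at y) u) (at x) z" for u z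
  proof -
    have "frechet_derivative (\<lambda>y. frechet_derivative f (at y) u) (at x) z \<bullet> b =
       frechet_derivative (\<lambda>y. frechet_derivative f (at y) u \<bullet> b) (at x) z"
      by (simp add: frechet_derivative_inner[OF d2])
    also have "frechet_derivative (\<lambda>y. frechet_derivative f (at y) u \<bullet> b) (at x) =
       frechet_derivative (\<lambda>y. frechet_derivative (\<lambda>y. f y \<bullet> b) (at y) u) (at x)"
      by (rule frechet_derivative_cong_open[OF S]) (simp add: frechet_derivative_inner[OF d])
    finally show ?thesis .
  qed
  have "Ck_on 2 (\<lambda>y. f y \<bullet> b) S" using f S(1) Ck_on_inner unfolding smooth_on_def by blast
  from mixed_derivative_symmetric_real[OF S this, of v w]
  show "frechet_derivative (\<lambda>y. frechet_derivative f (at y) v) (at x) w \<bullet> b =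
         frechet_derivative (\<lambda>y. frechet_derivative f (at y) w) (at x) v \<bullet> b"
    by (simp add: *)
qed

text \<open>A product rule for evaluating the differential of \<open>f\<close> along a vector field. Smoothness controls the
differential only through its values on fixed vectors, hence the expansion in a basis.\<close>

lemma smooth_on_frechet_apply_has_derivative:
  fixes f :: "'a::euclidean_space \<Rightarrow> 'b::real_normed_vector"
  assumes f: "smooth_on f S" and S: "open S" "x \<in> S"
    and Y: "(Y has_derivative Y') (at x)"
  shows "((\<lambda>y. frechet_derivative f (at y) (Y y)) has_derivative
     (\<lambda>h. frechet_derivative f (at x) (Y' h) +
          frechet_derivative (\<lambda>y. frechet_derivative f (at y) (Y x)) (at x) h)) (at x)"
proof -
  let ?D = "\<lambda>b y. frechet_derivative f (at y) b"
  have lin: "linear (frechet_derivative f (at y))" if "y \<in> S" for y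
    using smooth_on_has_derivative[OF f S(1) that] has_derivative_linear by blast
  have expand: "frechet_derivative f (at y) w = (\<Sum>b\<in>Basis. (w \<bullet> b) *\<^sub>R ?D b y)" if "y \<in> S" for y w
  proof -
    have "frechet_derivative f (at y) w = frechet_derivative f (at y) (\<Sum>b\<in>Basis. (w \<bullet> b) *\<^sub>R b)"
      by (simp add: euclidean_representation)
    also have "\<dots> = (\<Sum>b\<in>Basis. (w \<bullet> b) *\<^sub>R ?D b y)"
      using lin[OF that] by (simp add: linear_sum linear_cmul o_def)
    finally show ?thesis .
  qed
  have dD: "(?D b has_derivative frechet_derivative (?D b) (at x)) (at x)" for b
    by (rule smooth_on_has_derivative[OF smooth_on_frechet[OF f] S])
  have const: "frechet_derivative (?D w) (at x) h = (\<Sum>b\<in>Basis. (w \<bullet> b) *\<^sub>R frechet_derivative (?D b) (at x) h)" for w h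
  proof -
    have "((\<lambda>y. \<Sum>b\<in>Basis. (w \<bullet> b) *\<^sub>R ?D b y) has_derivative
        (\<lambda>h. \<Sum>b\<in>Basis. (w \<bullet> b) *\<^sub>R frechet_derivative (?D b) (at x) h)) (at x)"
      by (intro has_derivative_sum has_derivative_scaleR_right dD)
    then have "(?D w has_derivative
        (\<lambda>h. \<Sum>b\<in>Basis. (w \<bullet> b) *\<^sub>R frechet_derivative (?D b) (at x) h)) (at x)"
      by (rule has_derivative_transform_within_open[OF _ S]) (rule expand[symmetric])
    from frechet_derivative_at[OF this] show ?thesis by (simp only: fun_eq_iff)
  qed
  have "((\<lambda>y. \<Sum>b\<in>Basis. (Y y \<bullet> b) *\<^sub>R ?D b y) has_derivative
     (\<lambda>h. \<Sum>b\<in>Basis. (Y x \<bullet> b) *\<^sub>R frechet_derivative (?D b) (at x) h + (Y' h \<bullet> b) *\<^sub>R ?D b x)) (at x)"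
    by (intro has_derivative_sum has_derivative_scaleR dD has_derivative_inner_left Y)
  then have "((\<lambda>y. frechet_derivative f (at y) (Y y)) has_derivative
     (\<lambda>h. \<Sum>b\<in>Basis. (Y x \<bullet> b) *\<^sub>R frechet_derivative (?D b) (at x) h + (Y' h \<bullet> b) *\<^sub>R ?D b x)) (at x)"
    by (rule has_derivative_transform_within_open[OF _ S]) (rule expand[symmetric])
  moreover have "(\<lambda>h. \<Sum>b\<in>Basis. (Y x \<bullet> b) *\<^sub>R frechet_derivative (?D b) (at x) h + (Y' h \<bullet> b) *\<^sub>R ?D b x) =
     (\<lambda>h. frechet_derivative f (at x) (Y' h) +
          frechet_derivative (\<lambda>y. frechet_derivative f (at y) (Y x)) (at x) h)"
    by (rule ext) (simp only: expand[OF S(2), of "Y' _"] const[of "Y x"] sum.distrib add.commute)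
  ultimately show ?thesis by simp
qed

text \<open>Differentiating the relation between \<open>X1\<close> and \<open>X2\<close> along \<open>Y1\<close> produces, besides the terms of the
bracket, a second derivative of \<open>f\<close> in the directions \<open>X1\<close>, \<open>Y1\<close>. It is symmetric, so it cancels.\<close>

lemma bracket_of_related_fields:
  fixes f :: "'a::euclidean_space \<Rightarrow> 'b::euclidean_space"
  assumes f: "smooth_on f S" and S: "open S" "x \<in> S"
    and X1: "(X1 has_derivative X1') (at x)" and Y1: "(Y1 has_derivative Y1') (at x)"
    and X2: "(X2 has_derivative X2') (at (f x))" and Y2: "(Y2 has_derivative Y2') (at (f x))"
    and X: "\<And>y. y \<in> S \<Longrightarrow> frechet_derivative f (at y) (X1 y) = X2 (f y)"
    and Y: "\<And>y. y \<in> S \<Longrightarrow> frechet_derivative f (at y) (Y1 y) = Y2 (f y)"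
  shows "Y2' (X2 (f x)) - X2' (Y2 (f x)) = frechet_derivative f (at x) (Y1' (X1 x) - X1' (Y1 x))"
proof -
  have df: "(f has_derivative frechet_derivative f (at x)) (at x)"
    by (rule smooth_on_has_derivative[OF f S])
  have key: "Z2' (frechet_derivative f (at x) h) = frechet_derivative f (at x) (Z1' h) +
          frechet_derivative (\<lambda>y. frechet_derivative f (at y) (Z1 x)) (at x) h"
    if Z: "\<And>y. y \<in> S \<Longrightarrow> frechet_derivative f (at y) (Z1 y) = Z2 (f y)"
      and Z1: "(Z1 has_derivative Z1') (at x)" and Z2: "(Z2 has_derivative Z2') (at (f x))"
    for Z1 Z2 Z1' Z2' h
  proof -
    have "(Z2 \<circ> f has_derivative Z2' \<circ> frechet_derivative f (at x)) (at x)"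
      by (rule diff_chain_at[OF df Z2])
    then have "((\<lambda>y. frechet_derivative f (at y) (Z1 y)) has_derivative Z2' \<circ> frechet_derivative f (at x)) (at x)"
      by (rule has_derivative_transform_within_open[OF _ S]) (simp add: Z)
    from has_derivative_unique[OF this smooth_on_frechet_apply_has_derivative[OF f S Z1]]
    show ?thesis by (metis comp_apply)
  qed
  have "Y2' (X2 (f x)) - X2' (Y2 (f x)) =
      frechet_derivative f (at x) (Y1' (X1 x)) - frechet_derivative f (at x) (X1' (Y1 x))"
    using key[OF Y Y1 Y2, of "X1 x"] key[OF X X1 X2, of "Y1 x"] X[OF S(2)] Y[OF S(2)]
      mixed_derivative_symmetric[OF S f, of "X1 x" "Y1 x"]
    by simp
  then show ?thesis using has_derivative_linear[OF df] by (simp add: linear_diff)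
qed

section \<open>Derivatives in charts\<close>

text \<open>Continuity at \<open>p\<close> is included because the coordinate expression has junk values wherever \<open>F\<close> leaves
the domain of \<open>d\<close>; without it the chain rule would fail.\<close>

definition has_chart_derivative ::
    "('m::t2_space, 'e::real_normed_vector) chart \<Rightarrow> ('k::topological_space, 'f::real_normed_vector) chart
      \<Rightarrow> ('m \<Rightarrow> 'k) \<Rightarrow> 'm \<Rightarrow> ('e \<Rightarrow> 'f) \<Rightarrow> bool" where
  "has_chart_derivative c d F p D \<longleftrightarrow>
     isCont F p \<and> ((snd d \<circ> F \<circ> chart_inv c) has_derivative D) (at (snd c p))"

lemma has_chart_derivative_unique:
  "has_chart_derivative c d F p D \<Longrightarrow> has_chart_derivative c d F p D' \<Longrightarrow> D = D'"
  unfolding has_chart_derivative_def using has_derivative_unique by blast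

lemma has_chart_derivative_linear: "has_chart_derivative c d F p D \<Longrightarrow> linear D"
  unfolding has_chart_derivative_def using has_derivative_linear by blast

locale complex_atlas_on =
  fixes A :: "('m::t2_space, complex^'n::finite) chart set"
  assumes atlas: "complex_atlas A"
begin

lemma open_chart: "c \<in> A \<Longrightarrow> open (fst c)" "c \<in> A \<Longrightarrow> open (snd c ` fst c)"
  using atlas unfolding complex_atlas_def by blast+

lemma chart_homeo: "c \<in> A \<Longrightarrow> homeomorphism (fst c) (snd c ` fst c) (snd c) (chart_inv c)"
  using atlas unfolding complex_atlas_def by blast

lemma chart_inv_chart [simp]: "c \<in> A \<Longrightarrow> p \<in> fst c \<Longrightarrow> chart_inv c (snd c p) = p"
  using chart_homeo unfolding homeomorphism_def by blast

lemma chart_chart_inv [simp]: "c \<in> A \<Longrightarrow> x \<in> snd c ` fst c \<Longrightarrow> snd c (chart_inv c x) = x"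
  using chart_homeo unfolding homeomorphism_def by blast

lemma chart_inv_in: "c \<in> A \<Longrightarrow> x \<in> snd c ` fst c \<Longrightarrow> chart_inv c x \<in> fst c"
  by auto

lemma chart_at: "chart_at A p \<in> A" "p \<in> fst (chart_at A p)"
proof -
  have "\<exists>c. c \<in> A \<and> p \<in> fst c" using atlas unfolding complex_atlas_def by blast
  from someI_ex[OF this] show "chart_at A p \<in> A" "p \<in> fst (chart_at A p)"
    unfolding chart_at_def by auto
qed

lemma isCont_chart_inv: "c \<in> A \<Longrightarrow> p \<in> fst c \<Longrightarrow> isCont (chart_inv c) (snd c p)"
  using chart_homeo[of c] open_chart(2)[of c] unfolding homeomorphism_def
  by (simp add: continuous_on_eq_continuous_at)

lemma eventually_in_chart:
  assumes "c \<in> A" "d \<in> A" "p \<in> fst c" "F p \<in> fst d" "isCont F p"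
  shows "eventually (\<lambda>x. F (chart_inv c x) \<in> fst d) (at (snd c p))"
proof -
  have "isCont (F \<circ> chart_inv c) (snd c p)"
    by (rule continuous_at_compose[OF isCont_chart_inv]) (use assms in simp_all)
  then have "((F \<circ> chart_inv c) \<longlongrightarrow> F p) (at (snd c p))" using assms by (simp add: isCont_def)
  then show ?thesis using open_chart(1)[OF assms(2)] assms(4) by (auto simp: tendsto_def)
qed

text \<open>By continuity of \<open>F\<close>, the coordinate expression of the composite is the composite of the coordinate
expressions near \<open>p\<close>.\<close>

lemma has_chart_derivative_compose:
  assumes cde: "c \<in> A" "d \<in> A" and p: "p \<in> fst c" "F p \<in> fst d"
    and F: "has_chart_derivative c d F p D" and F': "has_chart_derivative d e F' (F p) D'"
  shows "has_chart_derivative c e (F' \<circ> F) p (D' \<circ> D)"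
  unfolding has_chart_derivative_def
proof
  show "isCont (F' \<circ> F) p" using F F' unfolding has_chart_derivative_def by (blast intro: continuous_at_compose)
  let ?f = "snd d \<circ> F \<circ> chart_inv c" and ?f' = "snd e \<circ> F' \<circ> chart_inv d"
  have "(?f' \<circ> ?f has_derivative D' \<circ> D) (at (snd c p))"
    by (rule diff_chain_at) (use F F' p cde in \<open>auto simp: has_chart_derivative_def\<close>)
  then show "((snd e \<circ> (F' \<circ> F) \<circ> chart_inv c) has_derivative D' \<circ> D) (at (snd c p))"
  proof (rule has_derivative_transform_eventually)
    show "\<forall>\<^sub>F x in at (snd c p). (?f' \<circ> ?f) x = (snd e \<circ> (F' \<circ> F) \<circ> chart_inv c) x"
      using eventually_in_chart[of c d p F, OF cde p] F unfolding has_chart_derivative_def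
      by (auto elim!: eventually_mono simp: cde)
  qed (use p cde in auto)
qed

lemma has_chart_derivative_const:
  "has_chart_derivative c d (\<lambda>_. a) p (\<lambda>_. 0)"
  by (simp add: has_chart_derivative_def o_def)

lemma has_chart_derivative_id:
  assumes "c \<in> A" "p \<in> fst c"
  shows "has_chart_derivative c c (\<lambda>x. x) p (\<lambda>v. v)"
  unfolding has_chart_derivative_def
proof
  show "((snd c \<circ> (\<lambda>x. x) \<circ> chart_inv c) has_derivative (\<lambda>v. v)) (at (snd c p))"
    by (rule has_derivative_transform_within_open[OF has_derivative_ident open_chart(2)[OF assms(1)]])
      (use assms in auto)
qed simp

lemma open_chart_image_Int:
  assumes "c \<in> A" "open U"
  shows "open (snd c ` (fst c \<inter> U))"
proof -
  have "snd c ` (fst c \<inter> U) = snd c ` fst c \<inter> chart_inv c -` U"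
    using assms(1) by (auto simp: image_iff)
  moreover have "continuous_on (snd c ` fst c) (chart_inv c)"
    using chart_homeo[OF assms(1)] by (simp add: homeomorphism_def)
  ultimately show ?thesis
    using open_chart(2)[OF assms(1)] assms(2) by (simp add: continuous_on_open_vimage Int_commute)
qed

lemma holomorphic_map_has_chart_derivative:
  assumes h: "holomorphic_map cJ cJ A A F" and cd: "c \<in> A" "d \<in> A" "p \<in> fst c" "F p \<in> fst d"
  obtains D where "has_chart_derivative c d F p D"
proof -
  have cont: "continuous_on UNIV F" using h by (simp add: holomorphic_map_def)
  have "open (F -` fst d)" using cont open_chart(1)[OF cd(2)] by (simp add: continuous_on_open_vimage)
  then have o: "open (snd c ` (fst c \<inter> F -` fst d))" by (rule open_chart_image_Int[OF cd(1)])
  have "smooth_on (snd d \<circ> F \<circ> chart_inv c) (snd c ` (fst c \<inter> F -` fst d))"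
    using h cd by (simp add: holomorphic_map_def holo_on_def)
  from smooth_on_has_derivative[OF this o, of "snd c p"] cd
  have "((snd d \<circ> F \<circ> chart_inv c) has_derivative
    frechet_derivative (snd d \<circ> F \<circ> chart_inv c) (at (snd c p))) (at (snd c p))"
    by blast
  moreover have "isCont F p" using cont by (simp add: continuous_on_eq_continuous_at)
  ultimately show ?thesis using that unfolding has_chart_derivative_def by blast
qed

lemma transition_has_chart_derivative:
  assumes cd: "c \<in> A" "d \<in> A" "p \<in> fst c" "p \<in> fst d"
  shows "has_chart_derivative c d (\<lambda>x. x) p (frechet_derivative (snd d \<circ> chart_inv c) (at (snd c p)))"
proof -
  have o: "open (snd c ` (fst c \<inter> fst d))" by (rule open_chart_image_Int) (use cd open_chart in auto)
  have "smooth_on (snd d \<circ> chart_inv c) (snd c ` (fst c \<inter> fst d))"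
    using atlas cd by (auto simp: complex_atlas_def holo_on_def)
  from smooth_on_has_derivative[OF this o, of "snd c p"] cd
  show ?thesis unfolding has_chart_derivative_def by (auto simp: o_def)
qed

lemma mdiff_eq:
  assumes "has_chart_derivative (chart_at A p) (chart_at A (F p)) F p D"
  shows "mdiff A F p = D"
  using assms frechet_derivative_at unfolding mdiff_def has_chart_derivative_def crd_def crd_inv_def
  by metis

end

lemma map_prod_chart_inv:
  assumes "x \<in> snd c ` fst c" "y \<in> snd d ` fst d"
    and "inj_on (snd c) (fst c)" "inj_on (snd d) (fst d)"
  shows "chart_inv (fst c \<times> fst d, map_prod (snd c) (snd d)) (x, y) = (chart_inv c x, chart_inv d y)"
proof -
  obtain p q where pq: "p \<in> fst c" "q \<in> fst d" "x = snd c p" "y = snd d q" using assms by auto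
  have "inj_on (map_prod (snd c) (snd d)) (fst c \<times> fst d)" using assms by (rule_tac map_prod_inj_on)
  from inv_into_f_f[OF this, of "(p, q)"] pq assms show ?thesis
    by (simp add: chart_inv_def inv_into_f_f)
qed

section \<open>Multiplication in charts\<close>

definition mult_in_charts :: "'g monoid \<Rightarrow> ('g, 'e) chart \<Rightarrow> ('g, 'e) chart \<Rightarrow> ('g, 'e) chart \<Rightarrow> 'e \<times> 'e \<Rightarrow> 'e" where
  "mult_in_charts G c d e = (\<lambda>(x, y). snd e (chart_inv c x \<otimes>\<^bsub>G\<^esub> chart_inv d y))"

definition mult_dom :: "'g monoid \<Rightarrow> ('g, 'e) chart \<Rightarrow> ('g, 'e) chart \<Rightarrow> ('g, 'e) chart \<Rightarrow> ('e \<times> 'e) set" where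
  "mult_dom G c d e =
     {(x, y). x \<in> snd c ` fst c \<and> y \<in> snd d ` fst d \<and> chart_inv c x \<otimes>\<^bsub>G\<^esub> chart_inv d y \<in> fst e}"

locale cx_lie_group =
  fixes G :: "'g::{t2_space, second_countable_topology} monoid" (structure)
    and A :: "('g, complex^'n::finite) chart set"
  assumes lie: "complex_lie_group G A"
begin

sublocale complex_atlas_on A
  using lie by unfold_locales (simp add: complex_lie_group_def)

sublocale group G
  using lie by (simp add: complex_lie_group_def)

lemma in_carrier [simp]: "x \<in> carrier G"
  using lie by (simp add: complex_lie_group_def)

lemma continuous_mult: "continuous_on UNIV (\<lambda>(x, y). x \<otimes> y)"
  using lie by (simp add: complex_lie_group_def holomorphic_map_def)

lemma isCont_mult: "isCont f p \<Longrightarrow> isCont h p \<Longrightarrow> isCont (\<lambda>x. f x \<otimes> h x) p"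
proof -
  assume "isCont f p" "isCont h p"
  then have "isCont (\<lambda>x. (f x, h x)) p" by (intro continuous_intros)
  moreover have "isCont (\<lambda>(x, y). x \<otimes> y) (f p, h p)"
    using continuous_mult by (simp add: continuous_on_eq_continuous_at)
  ultimately show ?thesis using continuous_at_compose[of p "\<lambda>x. (f x, h x)" "\<lambda>(x, y). x \<otimes> y"] by (simp add: o_def)
qed

lemma mult_dom_image:
  assumes "c \<in> A" "d \<in> A"
  shows "mult_dom G c d e = map_prod (snd c) (snd d) ` ((fst c \<times> fst d) \<inter> (\<lambda>(x, y). x \<otimes> y) -` fst e)"
  using assms by (force simp: mult_dom_def image_iff)

lemma open_mult_dom:
  assumes "c \<in> A" "d \<in> A" "e \<in> A"
  shows "open (mult_dom G c d e)"
proof -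
  let ?V = "snd c ` fst c \<times> snd d ` fst d" and ?h = "\<lambda>z. chart_inv c (fst z) \<otimes> chart_inv d (snd z)"
  have "isCont ?h z" if "z \<in> ?V" for z
  proof -
    have "isCont (chart_inv c) (fst z)" "isCont (chart_inv d) (snd z)"
      using that isCont_chart_inv[OF assms(1)] isCont_chart_inv[OF assms(2)] by auto
    then have "isCont (\<lambda>z. chart_inv c (fst z)) z" "isCont (\<lambda>z. chart_inv d (snd z)) z"
      using continuous_at_compose[of z fst "chart_inv c"] continuous_at_compose[of z snd "chart_inv d"]
      by (auto simp: o_def)
    then show ?thesis by (rule isCont_mult)
  qed
  then have "continuous_on ?V ?h" by (simp add: continuous_at_imp_continuous_on)
  moreover have "open ?V" using assms open_chart by (simp add: open_Times)
  ultimately have "open (?h -` fst e \<inter> ?V)" using open_chart(1)[OF assms(3)]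
    by (simp add: continuous_on_open_vimage)
  moreover have "?h -` fst e \<inter> ?V = mult_dom G c d e" by (auto simp: mult_dom_def)
  ultimately show ?thesis by simp
qed

lemma chart_inj: "c \<in> A \<Longrightarrow> inj_on (snd c) (fst c)"
  by (metis chart_inv_chart inj_on_inverseI)

lemma mult_in_charts_holo:
  assumes "c \<in> A" "d \<in> A" "e \<in> A"
  shows mult_in_charts_smooth: "smooth_on (mult_in_charts G c d e) (mult_dom G c d e)"
    and mult_in_charts_complex_linear: "z \<in> mult_dom G c d e \<Longrightarrow>
      frechet_derivative (mult_in_charts G c d e) (at z) (cJ u, cJ v) =
      cJ (frechet_derivative (mult_in_charts G c d e) (at z) (u, v))"
proof -
  let ?cd = "(fst c \<times> fst d, map_prod (snd c) (snd d))"
  have "?cd \<in> prod_atlas A A" unfolding prod_atlas_def using assms by blast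
  then have "holo_on (map_prod cJ cJ) cJ (snd e \<circ> (\<lambda>(x, y). x \<otimes> y) \<circ> chart_inv ?cd) (mult_dom G c d e)"
    using lie assms unfolding complex_lie_group_def holomorphic_map_def
    by (fastforce simp: mult_dom_image)
  moreover have eq: "(snd e \<circ> (\<lambda>(x, y). x \<otimes> y) \<circ> chart_inv ?cd) z = mult_in_charts G c d e z"
    if "z \<in> mult_dom G c d e" for z
    using that map_prod_chart_inv[of _ c _ d] chart_inj assms
    by (auto simp: mult_dom_def mult_in_charts_def)
  ultimately show "smooth_on (mult_in_charts G c d e) (mult_dom G c d e)"
    using smooth_on_cong_open[OF open_mult_dom[OF assms]] unfolding holo_on_def by blast
  assume z: "z \<in> mult_dom G c d e"
  have "frechet_derivative (snd e \<circ> (\<lambda>(x, y). x \<otimes> y) \<circ> chart_inv ?cd) (at z) =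
    frechet_derivative (mult_in_charts G c d e) (at z)"
    by (rule frechet_derivative_cong_open[OF open_mult_dom[OF assms] z eq])
  then show "frechet_derivative (mult_in_charts G c d e) (at z) (cJ u, cJ v) =
      cJ (frechet_derivative (mult_in_charts G c d e) (at z) (u, v))"
    using \<open>holo_on _ _ _ _\<close> z unfolding holo_on_def by (metis map_prod_simp)
qed

lemma mult_in_charts_has_derivative:
  assumes "c \<in> A" "d \<in> A" "e \<in> A" "z \<in> mult_dom G c d e"
  shows "(mult_in_charts G c d e has_derivative frechet_derivative (mult_in_charts G c d e) (at z)) (at z)"
  using smooth_on_has_derivative mult_in_charts_smooth open_mult_dom assms by blast

lemma has_chart_derivative_mult:
  assumes c: "c \<in> A" "p \<in> fst c" and d: "d \<in> A" "f p \<in> fst d" and d': "d' \<in> A" "h p \<in> fst d'"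
    and e: "e \<in> A" "f p \<otimes> h p \<in> fst e"
    and f: "has_chart_derivative c d f p D" and h: "has_chart_derivative c d' h p D'"
  shows "has_chart_derivative c e (\<lambda>x. f x \<otimes> h x) p
     (\<lambda>v. frechet_derivative (mult_in_charts G d d' e) (at (snd d (f p), snd d' (h p))) (D v, D' v))"
  unfolding has_chart_derivative_def
proof
  have cont: "isCont f p" "isCont h p" using f h by (auto simp: has_chart_derivative_def)
  then show "isCont (\<lambda>x. f x \<otimes> h x) p" by (rule isCont_mult)
  let ?fh = "\<lambda>x. ((snd d \<circ> f \<circ> chart_inv c) x, (snd d' \<circ> h \<circ> chart_inv c) x)"
  let ?z = "(snd d (f p), snd d' (h p))" and ?M = "mult_in_charts G d d' e"
  have fh: "(?fh has_derivative (\<lambda>v. (D v, D' v))) (at (snd c p))"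
    using f h unfolding has_chart_derivative_def by (intro has_derivative_Pair) blast+
  have z: "?z \<in> mult_dom G d d' e" using d d' e by (simp add: mult_dom_def)
  have "(?M has_derivative frechet_derivative ?M (at ?z)) (at (?fh (snd c p)))"
    using mult_in_charts_has_derivative[OF d(1) d'(1) e(1) z] c by simp
  from diff_chain_at[OF fh this]
  have "(?M \<circ> ?fh has_derivative frechet_derivative ?M (at ?z) \<circ> (\<lambda>v. (D v, D' v))) (at (snd c p))" .
  then show "(snd e \<circ> (\<lambda>x. f x \<otimes> h x) \<circ> chart_inv c has_derivative
      (\<lambda>v. frechet_derivative ?M (at ?z) (D v, D' v))) (at (snd c p))"
    unfolding o_def[of "frechet_derivative ?M (at ?z)"]
  proof (rule has_derivative_transform_eventually)
    have "\<forall>\<^sub>F x in at (snd c p). f (chart_inv c x) \<in> fst d \<and> h (chart_inv c x) \<in> fst d'"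
      by (intro eventually_conj eventually_in_chart) (use c d d' cont in auto)
    then show "\<forall>\<^sub>F x in at (snd c p). (?M \<circ> ?fh) x = (snd e \<circ> (\<lambda>x. f x \<otimes> h x) \<circ> chart_inv c) x"
      by (rule eventually_mono) (use d d' in \<open>auto simp: mult_in_charts_def\<close>)
  qed (use c d d' in \<open>auto simp: mult_in_charts_def\<close>)
qed

end

section \<open>Left-invariant vector fields\<close>

context cx_lie_group
begin

abbreviation field :: "complex^'n \<Rightarrow> 'g \<Rightarrow> complex^'n" where
  "field v \<equiv> linv G A \<one> v"

abbreviation chart1 :: "('g, complex^'n) chart" where
  "chart1 \<equiv> chart_at A \<one>"

lemma left_mult_has_chart_derivative:
  assumes "c \<in> A" "p \<in> fst c" "d \<in> A" "a \<in> fst d" "e \<in> A" "a \<otimes> p \<in> fst e"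
  shows "has_chart_derivative c e (\<lambda>x. a \<otimes> x) p
    (\<lambda>v. frechet_derivative (mult_in_charts G d c e) (at (snd d a, snd c p)) (0, v))"
  using has_chart_derivative_mult[OF assms(1,2,3) _ assms(1) _ assms(5) _
      has_chart_derivative_const has_chart_derivative_id] assms by simp

lemma right_mult_has_chart_derivative:
  assumes "c \<in> A" "p \<in> fst c" "d \<in> A" "a \<in> fst d" "e \<in> A" "p \<otimes> a \<in> fst e"
  shows "has_chart_derivative c e (\<lambda>x. x \<otimes> a) p
    (\<lambda>v. frechet_derivative (mult_in_charts G c d e) (at (snd c p, snd d a)) (v, 0))"
  using has_chart_derivative_mult[OF assms(1,2,1) _ assms(3) _ assms(5) _
      has_chart_derivative_id has_chart_derivative_const] assms by simp

lemma mdiff_left_mult: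
  "has_chart_derivative (chart_at A p) (chart_at A (a \<otimes> p)) (\<lambda>x. a \<otimes> x) p (mdiff A (\<lambda>x. a \<otimes> x) p)"
  using mdiff_eq left_mult_has_chart_derivative chart_at by (metis (no_types, lifting))

lemma field_eq_mdiff: "field v q = mdiff A (\<lambda>x. q \<otimes> x) \<one> v"
  by (simp add: linv_def)

lemma field_has_chart_derivative:
  "has_chart_derivative chart1 (chart_at A q) (\<lambda>x. q \<otimes> x) \<one> (\<lambda>v. field v q)"
  using mdiff_left_mult[of \<one> q] by (simp add: field_eq_mdiff)

text \<open>\<open>linv\<close> is defined by the selected chart at each point and \<open>vf_in_chart\<close> changes to the chart \<open>c\<close>; by the
chain rule the result is the derivative of left translation with respect to \<open>c\<close> itself.\<close>

lemma field_in_chart_has_chart_derivative: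
  assumes c: "c \<in> A" and x: "x \<in> snd c ` fst c"
  shows "has_chart_derivative chart1 c (\<lambda>y. chart_inv c x \<otimes> y) \<one> (\<lambda>v. vf_in_chart A c (field v) x)"
proof -
  let ?q = "chart_inv c x"
  have q: "?q \<in> fst c" using chart_inv_in[OF c x] .
  have t: "has_chart_derivative (chart_at A ?q) c (\<lambda>x. x) ?q
     (frechet_derivative (snd c \<circ> chart_inv (chart_at A ?q)) (at (snd (chart_at A ?q) ?q)))"
    by (rule transition_has_chart_derivative) (use chart_at c q in auto)
  have "has_chart_derivative chart1 c ((\<lambda>x. x) \<circ> (\<lambda>y. ?q \<otimes> y)) \<one>
     (frechet_derivative (snd c \<circ> chart_inv (chart_at A ?q)) (at (snd (chart_at A ?q) ?q)) \<circ> (\<lambda>v. field v ?q))"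
    by (rule has_chart_derivative_compose[OF _ _ _ _ field_has_chart_derivative]) (use chart_at t in auto)
  then show ?thesis by (simp add: o_def vf_in_chart_def Let_def crd_def crd_inv_def)
qed

lemma mult_dom_one: "c \<in> A \<Longrightarrow> x \<in> snd c ` fst c \<Longrightarrow> (x, snd chart1 \<one>) \<in> mult_dom G c chart1 c"
  using chart_at[of \<one>] by (auto simp: mult_dom_def)

text \<open>A left-invariant field is a partial derivative of the multiplication, a formula that is uniform in the
base point. Smoothness of the field and complex linearity in \<open>v\<close> can be read off from it.\<close>

lemma field_in_chart:
  assumes c: "c \<in> A" and x: "x \<in> snd c ` fst c"
  shows "vf_in_chart A c (field v) x =
    frechet_derivative (mult_in_charts G c chart1 c) (at (x, snd chart1 \<one>)) (0, v)"
proof -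
  have "has_chart_derivative chart1 c (\<lambda>y. chart_inv c x \<otimes> y) \<one>
    (\<lambda>v. frechet_derivative (mult_in_charts G c chart1 c) (at (snd c (chart_inv c x), snd chart1 \<one>)) (0, v))"
    by (rule left_mult_has_chart_derivative) (use chart_at c chart_inv_in[OF c x] in auto)
  from has_chart_derivative_unique[OF this field_in_chart_has_chart_derivative[OF c x]] show ?thesis
    using c x by (simp add: fun_eq_iff)
qed

lemma smooth_vf_field: "smooth_vf A (field v)"
  unfolding smooth_vf_def
proof
  fix c assume c: "c \<in> A"
  let ?M = "mult_in_charts G c chart1 c"
  have o: "open (mult_dom G c chart1 c)" using open_mult_dom c chart_at by blast
  have "smooth_on (\<lambda>z. frechet_derivative ?M (at z) (0, v)) (mult_dom G c chart1 c)"
    using smooth_on_frechet mult_in_charts_smooth c chart_at by blast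
  then have "smooth_on (\<lambda>x. frechet_derivative ?M (at (x, snd chart1 \<one>)) (0, v)) (snd c ` fst c)"
    using smooth_on_pair_right[OF _ o open_chart(2)[OF c], of "\<lambda>z. frechet_derivative ?M (at z) (0, v)"]
      mult_dom_one[OF c] by blast
  then show "smooth_on (vf_in_chart A c (field v)) (snd c ` fst c)"
    by (rule smooth_on_cong_open[OF open_chart(2)[OF c], rotated]) (rule field_in_chart[OF c, symmetric])
qed

lemma field_in_chart_at: "vf_in_chart A (chart_at A p) (field v) (crd A p p) = field v p"
proof -
  have "has_chart_derivative chart1 (chart_at A p)
      (\<lambda>y. chart_inv (chart_at A p) (snd (chart_at A p) p) \<otimes> y) \<one>
      (\<lambda>v. vf_in_chart A (chart_at A p) (field v) (snd (chart_at A p) p))"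
    by (rule field_in_chart_has_chart_derivative) (use chart_at in auto)
  then have "has_chart_derivative chart1 (chart_at A p) (\<lambda>y. p \<otimes> y) \<one>
      (\<lambda>v. vf_in_chart A (chart_at A p) (field v) (snd (chart_at A p) p))"
    using chart_at by simp
  from has_chart_derivative_unique[OF this field_has_chart_derivative]
  show ?thesis by (simp add: crd_def fun_eq_iff)
qed

lemma linear_field: "linear (\<lambda>v. field v q)"
  using has_chart_derivative_linear field_has_chart_derivative by blast

lemma field_one: "field v \<one> = v"
proof -
  have "has_chart_derivative chart1 chart1 (\<lambda>x. \<one> \<otimes> x) \<one> (\<lambda>v. v)"
    using has_chart_derivative_id chart_at by simp
  from has_chart_derivative_unique[OF this] field_has_chart_derivative[of \<one>]
  show ?thesis by (simp add: fun_eq_iff) metis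
qed

lemma field_cJ: "field (cJ v) q = cJ (field v q)"
proof -
  let ?c = "chart_at A q"
  have x: "crd A q q \<in> snd ?c ` fst ?c" using chart_at by (simp add: crd_def)
  have "frechet_derivative (mult_in_charts G ?c chart1 ?c) (at (crd A q q, snd chart1 \<one>)) (cJ 0, cJ v) =
    cJ (frechet_derivative (mult_in_charts G ?c chart1 ?c) (at (crd A q q, snd chart1 \<one>)) (0, v))"
    by (rule mult_in_charts_complex_linear) (use chart_at mult_dom_one x in auto)
  then show ?thesis
    using field_in_chart[OF chart_at(1) x] field_in_chart_at by (simp add: cJ_def)
qed

text \<open>Since \<open>L\<^bsub>q p\<^sup>-\<^sup>1\<^esub> = L\<^bsub>q\<^esub> \<circ> L\<^bsub>p\<^sup>-\<^sup>1\<^esub>\<close>, the left-invariant extension of a vector at \<open>p\<close> is that of its image at \<open>\<one>\<close>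
under this map. It identifies the tangent space at \<open>p\<close> with the Lie algebra.\<close>

definition to_one :: "'g \<Rightarrow> complex^'n \<Rightarrow> complex^'n" where
  "to_one p = mdiff A (\<lambda>x. inv p \<otimes> x) p"

lemma to_one_has_chart_derivative:
  "has_chart_derivative (chart_at A p) chart1 (\<lambda>x. inv p \<otimes> x) p (to_one p)"
  using mdiff_left_mult[of p "inv p"] by (simp add: to_one_def)

lemma linv_eq_field: "linv G A p v = field (to_one p v)"
proof
  fix q
  have "has_chart_derivative (chart_at A p) (chart_at A q) ((\<lambda>x. q \<otimes> x) \<circ> (\<lambda>x. inv p \<otimes> x)) p
     ((\<lambda>v. field v q) \<circ> to_one p)"
    by (rule has_chart_derivative_compose[OF _ _ _ _ to_one_has_chart_derivative])
      (use chart_at field_has_chart_derivative in auto)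
  then have "has_chart_derivative (chart_at A p) (chart_at A ((q \<otimes> inv p) \<otimes> p)) (\<lambda>x. (q \<otimes> inv p) \<otimes> x) p
     ((\<lambda>v. field v q) \<circ> to_one p)"
    by (simp add: o_def m_assoc)
  from mdiff_eq[OF this] show "linv G A p v q = field (to_one p v) q" by (simp add: linv_def)
qed

lemma field_to_one: "field (to_one p v) p = v"
proof -
  have "has_chart_derivative (chart_at A p) (chart_at A p) ((\<lambda>x. p \<otimes> x) \<circ> (\<lambda>x. inv p \<otimes> x)) p
     ((\<lambda>v. field v p) \<circ> to_one p)"
    by (rule has_chart_derivative_compose[OF _ _ _ _ to_one_has_chart_derivative])
      (use chart_at field_has_chart_derivative in auto)
  moreover have "(\<lambda>x. p \<otimes> x) \<circ> (\<lambda>x. inv p \<otimes> x) = (\<lambda>x. x)"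
    by (simp add: fun_eq_iff m_assoc[symmetric])
  ultimately have "has_chart_derivative (chart_at A p) (chart_at A p) (\<lambda>x. x) p ((\<lambda>v. field v p) \<circ> to_one p)"
    by simp
  from has_chart_derivative_unique[OF this has_chart_derivative_id] chart_at[of p]
  show ?thesis by (metis comp_apply)
qed

lemma to_one_field: "to_one p (field v p) = v"
proof -
  have "inj (\<lambda>v. field v p)"
    using linear_field field_to_one by (metis linear_surjective_imp_injective surjI)
  then show ?thesis using field_to_one[of p "field v p"] by (simp add: inj_def)
qed

lemma linear_to_one: "linear (to_one p)"
  using to_one_has_chart_derivative has_chart_derivative_linear by blast

section \<open>The bracket\<close>

lemma field_in_chart_has_derivative:
  assumes c: "c \<in> A" and x: "x \<in> snd c ` fst c"
  shows "(vf_in_chart A c (field v) has_derivative frechet_derivative (vf_in_chart A c (field v)) (at x)) (at x)"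
  using smooth_on_has_derivative open_chart(2)[OF c] x smooth_vf_field c unfolding smooth_vf_def by blast

text \<open>Left translation by \<open>p\<close> relates a left-invariant field to itself, by the chain rule for
\<open>L\<^bsub>pq\<^esub> = L\<^bsub>p\<^esub> \<circ> L\<^bsub>q\<^esub>\<close>.\<close>

lemma translate_fields:
  assumes c: "c \<in> A" and d: "d \<in> A" and y: "y \<in> snd c ` fst c" "p \<otimes> chart_inv c y \<in> fst d"
  shows "frechet_derivative (snd d \<circ> (\<lambda>x. p \<otimes> x) \<circ> chart_inv c) (at y) (vf_in_chart A c (field v) y)
    = vf_in_chart A d (field v) ((snd d \<circ> (\<lambda>x. p \<otimes> x) \<circ> chart_inv c) y)"
proof -
  let ?q = "chart_inv c y" and ?f = "snd d \<circ> (\<lambda>x. p \<otimes> x) \<circ> chart_inv c"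
  have q: "?q \<in> fst c" "snd c ?q = y" using chart_inv_in c y by auto
  obtain D where D: "has_chart_derivative c d (\<lambda>x. p \<otimes> x) ?q D"
    using left_mult_has_chart_derivative[of c ?q "chart_at A p" p d] chart_at c d q y by blast
  then have fD: "frechet_derivative ?f (at y) = D"
    using frechet_derivative_at unfolding has_chart_derivative_def q by metis
  have "has_chart_derivative chart1 d ((\<lambda>x. p \<otimes> x) \<circ> (\<lambda>x. ?q \<otimes> x)) \<one> (D \<circ> (\<lambda>v. vf_in_chart A c (field v) y))"
    by (rule has_chart_derivative_compose[OF _ _ _ _ field_in_chart_has_chart_derivative])
      (use chart_at c y q D in auto)
  then have "has_chart_derivative chart1 d (\<lambda>x. (p \<otimes> ?q) \<otimes> x) \<one> (D \<circ> (\<lambda>v. vf_in_chart A c (field v) y))"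
    by (simp add: o_def m_assoc)
  moreover have "has_chart_derivative chart1 d (\<lambda>x. chart_inv d (?f y) \<otimes> x) \<one> (\<lambda>v. vf_in_chart A d (field v) (?f y))"
    by (rule field_in_chart_has_chart_derivative) (use d y in auto)
  moreover have "chart_inv d (?f y) = p \<otimes> ?q" using d y by simp
  ultimately have "D \<circ> (\<lambda>v. vf_in_chart A c (field v) y) = (\<lambda>v. vf_in_chart A d (field v) (?f y))"
    using has_chart_derivative_unique by simp
  then show ?thesis unfolding fD by (simp only: fun_eq_iff comp_apply)
qed

lemma smooth_left_mult_in_charts:
  assumes c: "c \<in> A" and d: "d \<in> A"
  shows "smooth_on (snd d \<circ> (\<lambda>x. p \<otimes> x) \<circ> chart_inv c) {y \<in> snd c ` fst c. p \<otimes> chart_inv c y \<in> fst d}"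
    and "open {y \<in> snd c ` fst c. p \<otimes> chart_inv c y \<in> fst d}"
proof -
  let ?T = "{y \<in> snd c ` fst c. p \<otimes> chart_inv c y \<in> fst d}" and ?a = "chart_at A p"
  let ?M = "mult_in_charts G ?a c d" and ?S = "mult_dom G ?a c d"
  have S: "open ?S" using open_mult_dom chart_at c d by blast
  have T: "?T = {y. (snd ?a p, y) \<in> ?S}" using chart_at[of p] by (auto simp: mult_dom_def)
  have "continuous_on UNIV (\<lambda>y. (snd ?a p, y))" by (intro continuous_intros)
  then have "open ((\<lambda>y. (snd ?a p, y)) -` ?S)" using S by (rule open_vimage[rotated])
  moreover have "(\<lambda>y. (snd ?a p, y)) -` ?S = ?T" unfolding T by auto
  ultimately show oT: "open ?T" by simp
  have "smooth_on (\<lambda>y. ?M (snd ?a p, y)) ?T"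
    by (rule smooth_on_pair_left[OF _ S oT]) (use mult_in_charts_smooth chart_at c d T in auto)
  then show "smooth_on (snd d \<circ> (\<lambda>x. p \<otimes> x) \<circ> chart_inv c) ?T"
    by (rule smooth_on_cong_open[OF oT, rotated]) (use chart_at in \<open>auto simp: mult_in_charts_def\<close>)
qed

text \<open>Left translation by \<open>p\<close> relates both fields to themselves, so it carries their bracket at \<open>\<one>\<close> to their
bracket at \<open>p\<close>.\<close>

lemma bracket_field: "vf_bracket A (field u) (field v) = field (lie_ad G A u v)"
proof
  fix p
  let ?d = "chart_at A p"
  let ?f = "snd ?d \<circ> (\<lambda>x. p \<otimes> x) \<circ> chart_inv chart1"
  let ?S = "{y \<in> snd chart1 ` fst chart1. p \<otimes> chart_inv chart1 y \<in> fst ?d}"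
  let ?x = "snd chart1 \<one>"
  have c1: "chart1 \<in> A" "\<one> \<in> fst chart1" and d: "?d \<in> A" "p \<in> fst ?d" using chart_at by auto
  have x: "?x \<in> ?S" using c1 d by auto
  have fx: "?f ?x = crd A p p" using c1 by (simp add: crd_def)
  have fx_in: "?f ?x \<in> snd ?d ` fst ?d" using c1 d by simp
  have D1: "(vf_in_chart A chart1 (field w) has_derivative
      frechet_derivative (vf_in_chart A chart1 (field w)) (at ?x)) (at ?x)" for w
    by (rule field_in_chart_has_derivative[OF c1(1)]) (use c1 in simp)
  have D2: "(vf_in_chart A ?d (field w) has_derivative
      frechet_derivative (vf_in_chart A ?d (field w)) (at (?f ?x))) (at (?f ?x))" for w
    by (rule field_in_chart_has_derivative[OF d(1) fx_in])
  have R: "frechet_derivative ?f (at y) (vf_in_chart A chart1 (field w) y) = vf_in_chart A ?d (field w) (?f y)"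
    if "y \<in> ?S" for y w
    by (rule translate_fields[OF c1(1) d(1)]) (use that in auto)
  have "frechet_derivative (vf_in_chart A ?d (field v)) (at (?f ?x)) (vf_in_chart A ?d (field u) (?f ?x)) -
      frechet_derivative (vf_in_chart A ?d (field u)) (at (?f ?x)) (vf_in_chart A ?d (field v) (?f ?x)) =
    frechet_derivative ?f (at ?x)
     (frechet_derivative (vf_in_chart A chart1 (field v)) (at ?x) (vf_in_chart A chart1 (field u) ?x) -
      frechet_derivative (vf_in_chart A chart1 (field u)) (at ?x) (vf_in_chart A chart1 (field v) ?x))"
    by (rule bracket_of_related_fields[OF smooth_left_mult_in_charts[OF c1(1) d(1)] x D1 D1 D2 D2 R R])
  then have "vf_bracket A (field u) (field v) p = frechet_derivative ?f (at ?x) (lie_ad G A u v)"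
    unfolding fx field_in_chart_at vf_bracket_def lie_ad_def
    using field_in_chart_at[of \<one>] by (simp add: crd_def)
  also have "\<dots> = field (lie_ad G A u v) p"
    using field_has_chart_derivative[of p] frechet_derivative_at unfolding has_chart_derivative_def
    by metis
  finally show "vf_bracket A (field u) (field v) p = field (lie_ad G A u v) p" .
qed

end

section \<open>Complex bilinearity of the bracket\<close>

lemma cJ_simps [simp]:
  "cJ (cJ v) = - v" "cJ (u + v) = cJ u + cJ v" "cJ (- v) = - cJ v" "cJ (u - v) = cJ u - cJ v"
  "cJ (r *\<^sub>R v) = r *\<^sub>R cJ v" "cJ 0 = 0"
  by (simp_all add: cJ_def vec_eq_iff algebra_simps)

lemma bounded_linear_cJ: "bounded_linear cJ"
  by (rule linear_conv_bounded_linear[THEN iffD1]) (simp add: linear_iff)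

lemma frechet_derivative_bounded_linear_comp:
  assumes "bounded_linear L" "f differentiable at x"
  shows "frechet_derivative (\<lambda>y. L (f y)) (at x) v = L (frechet_derivative f (at x) v)"
proof -
  have "((\<lambda>y. L (f y)) has_derivative (\<lambda>v. L (frechet_derivative f (at x) v))) (at x)"
    using bounded_linear.has_derivative[OF assms(1)] assms(2) by (simp add: frechet_derivative_works)
  from frechet_derivative_at[OF this] show ?thesis by (simp only: fun_eq_iff)
qed

context cx_lie_group
begin

abbreviation mult1 :: "(complex^'n) \<times> (complex^'n) \<Rightarrow> complex^'n" where
  "mult1 \<equiv> mult_in_charts G chart1 chart1 chart1"

abbreviation dom1 :: "((complex^'n) \<times> (complex^'n)) set" where
  "dom1 \<equiv> mult_dom G chart1 chart1 chart1"

abbreviation x1 :: "complex^'n" where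
  "x1 \<equiv> snd chart1 \<one>"

text \<open>The mixed second derivative at \<open>(\<one>, \<one>)\<close> of the multiplication, in the direction \<open>u\<close> of the first and \<open>v\<close> of
the second factor. The bracket is its antisymmetrization.\<close>

definition mixed :: "complex^'n \<Rightarrow> complex^'n \<Rightarrow> complex^'n" where
  "mixed u v = frechet_derivative (vf_in_chart A chart1 (field v)) (at x1) u"

lemma dom1: "open dom1" "(x1, x1) \<in> dom1" "smooth_on mult1 dom1"
  using open_mult_dom mult_in_charts_smooth mult_dom_one[of chart1 x1] chart_at[of \<one>] by auto

lemma mult1_second_differentiable: "(\<lambda>z. frechet_derivative mult1 (at z) a) differentiable at (x1, x1)"
  using smooth_on_has_derivative[OF smooth_on_frechet[OF dom1(3)] dom1(1,2)] by (rule differentiableI)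

lemma x1_in: "x1 \<in> snd chart1 ` fst chart1"
  using chart_at[of \<one>] by blast

lemma mixed_eq:
  "mixed u v = frechet_derivative (\<lambda>z. frechet_derivative mult1 (at z) (0, v)) (at (x1, x1)) (u, 0)"
proof -
  let ?F = "\<lambda>z. frechet_derivative mult1 (at z) (0, v)"
  have "((\<lambda>x. (x, x1)) has_derivative (\<lambda>u. (u, 0))) (at x1)"
    by (auto intro!: derivative_eq_intros)
  moreover have "(?F has_derivative frechet_derivative ?F (at (x1, x1))) (at (x1, x1))"
    using mult1_second_differentiable by (simp add: frechet_derivative_works)
  ultimately have "(?F \<circ> (\<lambda>x. (x, x1)) has_derivative frechet_derivative ?F (at (x1, x1)) \<circ> (\<lambda>u. (u, 0))) (at x1)"
    by (rule diff_chain_at)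
  then have "(vf_in_chart A chart1 (field v) has_derivative frechet_derivative ?F (at (x1, x1)) \<circ> (\<lambda>u. (u, 0))) (at x1)"
    by (rule has_derivative_transform_within_open[OF _ open_chart(2)[OF chart_at(1)] x1_in])
      (simp add: field_in_chart[OF chart_at(1)])
  from frechet_derivative_at[OF this] show ?thesis by (simp add: mixed_def fun_eq_iff)
qed

text \<open>Symmetry of second derivatives puts \<open>u\<close> into the differential of the multiplication, where linearity in \<open>u\<close>
holds over the complex numbers.\<close>

lemma mixed_eq':
  "mixed u v = frechet_derivative (\<lambda>z. frechet_derivative mult1 (at z) (u, 0)) (at (x1, x1)) (0, v)"
  unfolding mixed_eq by (rule mixed_derivative_symmetric[OF dom1(1,2,3)])

lemma linear_mixed: "linear (\<lambda>u. mixed u v)" "linear (\<lambda>v. mixed u v)"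
proof -
  have l: "linear (\<lambda>z. frechet_derivative (\<lambda>z. frechet_derivative mult1 (at z) a) (at (x1, x1)) z)" for a
    using mult1_second_differentiable by (rule linear_frechet_derivative)
  have "linear (frechet_derivative (\<lambda>z. frechet_derivative mult1 (at z) a) (at (x1, x1)) \<circ> (\<lambda>u. (u, 0)))" for a
    by (rule linear_compose[OF _ l]) (simp add: linear_iff)
  then show "linear (\<lambda>u. mixed u v)" by (simp add: mixed_eq o_def)
  have "linear (frechet_derivative (\<lambda>z. frechet_derivative mult1 (at z) a) (at (x1, x1)) \<circ> (\<lambda>u. (0, u)))" for a
    by (rule linear_compose[OF _ l]) (simp add: linear_iff)
  then show "linear (\<lambda>v. mixed u v)" by (simp add: mixed_eq' o_def)
qed

text \<open>The differential of the multiplication is complex linear at all points near \<open>(\<one>, \<one>)\<close>, hence so is its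
derivative as a function of the inner direction, and by \<open>mixed_eq\<close> and \<open>mixed_eq'\<close> either direction can be taken
as the inner one.\<close>

lemma mixed_cJ: "mixed (cJ u) v = cJ (mixed u v)" "mixed u (cJ v) = cJ (mixed u v)"
proof -
  have key: "frechet_derivative (\<lambda>z. frechet_derivative mult1 (at z) (cJ a, cJ b)) (at (x1, x1)) w =
      cJ (frechet_derivative (\<lambda>z. frechet_derivative mult1 (at z) (a, b)) (at (x1, x1)) w)" for a b w
  proof -
    have "frechet_derivative (\<lambda>z. frechet_derivative mult1 (at z) (cJ a, cJ b)) (at (x1, x1)) =
      frechet_derivative (\<lambda>z. cJ (frechet_derivative mult1 (at z) (a, b))) (at (x1, x1))"
      by (rule frechet_derivative_cong_open[OF dom1(1,2)])
        (rule mult_in_charts_complex_linear, use chart_at in auto)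
    then show ?thesis
      using frechet_derivative_bounded_linear_comp[OF bounded_linear_cJ mult1_second_differentiable] by simp
  qed
  show "mixed u (cJ v) = cJ (mixed u v)" using key[of 0 v] by (simp add: mixed_eq)
  show "mixed (cJ u) v = cJ (mixed u v)" using key[of u 0] by (simp add: mixed_eq')
qed

lemma lie_ad_mixed: "lie_ad G A u v = mixed u v - mixed v u"
  by (simp add: lie_ad_def vf_bracket_def field_one mixed_def crd_def)

lemma lie_ad_bilinear:
  "lie_ad G A (u + u') v = lie_ad G A u v + lie_ad G A u' v"
  "lie_ad G A (r *\<^sub>R u) v = r *\<^sub>R lie_ad G A u v"
  "lie_ad G A (cJ u) v = cJ (lie_ad G A u v)"
  by (simp_all add: lie_ad_mixed mixed_cJ linear_add[OF linear_mixed(1)] linear_add[OF linear_mixed(2)]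
      linear_cmul[OF linear_mixed(1)] linear_cmul[OF linear_mixed(2)] algebra_simps)

lemma lie_ad_antisym: "lie_ad G A v u = - lie_ad G A u v"
  by (simp add: lie_ad_mixed)

lemma lie_ad_cJ_right: "lie_ad G A u (cJ v) = cJ (lie_ad G A u v)"
  by (simp add: lie_ad_mixed mixed_cJ)

end

section \<open>Connections on left-invariant fields\<close>

locale hermitian_cx_lie_group = cx_lie_group G A
  for G :: "'g::{t2_space, second_countable_topology} monoid" (structure)
    and A :: "('g, complex^'n::finite) chart set" +
  fixes g :: "('g, 'n) metric"
  assumes herm: "hermitian_metric A g" and linvt: "left_invariant G A g"
begin

abbreviation ad :: "complex^'n \<Rightarrow> complex^'n \<Rightarrow> complex^'n" where
  "ad \<equiv> lie_ad G A"

lemma metric_field: "g q (field v q) (field w q) = g \<one> v w"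
proof -
  have "g (q \<otimes> \<one>) (mdiff A (\<lambda>x. q \<otimes> x) \<one> v) (mdiff A (\<lambda>x. q \<otimes> x) \<one> w) = g \<one> v w"
    using linvt unfolding left_invariant_def by blast
  then show ?thesis by (simp add: field_eq_mdiff)
qed

lemma metric_linear: "linear (g q v)" "linear (\<lambda>v. g q v w)"
  using herm by (auto simp: hermitian_metric_def bilinear_def)

lemma metric_sym: "g q v w = g q w v"
  using herm by (simp add: hermitian_metric_def)

lemma metric_pos: "v \<noteq> 0 \<Longrightarrow> g q v v > 0"
  using herm by (simp add: hermitian_metric_def)

lemma metric_cJ: "g q (cJ v) (cJ w) = g q v w"
  using herm by (simp add: hermitian_metric_def)

lemma eq_if_metric_eq:
  assumes "\<And>w. g q u (field w q) = g q v (field w q)"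
  shows "u = v"
proof -
  have "g q (u - v) (u - v) = 0"
    using assms[of "to_one q (u - v)"] linear_diff[OF metric_linear(2)] by (simp add: field_to_one)
  then show ?thesis using metric_pos[of "u - v" q] by fastforce
qed

text \<open>Inner products of left-invariant fields are constant, so their derivatives drop out.\<close>

lemma metric_connection_field:
  assumes "metric_connection A g N"
  shows "g q (N (field u) (field v) q) (field w q) = - g q (field v q) (N (field u) (field w) q)"
proof -
  have "dfun A (\<lambda>q. g q (field v q) (field w q)) q (field u q) =
    g q (N (field u) (field v) q) (field w q) + g q (field v q) (N (field u) (field w) q)"
    using assms smooth_vf_field unfolding metric_connection_def by blast
  moreover have "dfun A (\<lambda>q. g q (field v q) (field w q)) q (field u q) = 0"
    by (simp add: metric_field dfun_def o_def)
  ultimately show ?thesis by simp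
qed

text \<open>The Koszul formula for left-invariant fields.\<close>

lemma levi_civita_koszul:
  assumes LC: "levi_civita A g LC"
  shows "2 * g q (LC (field u) (field v) q) (field w q) =
    g \<one> (ad u v) w - g \<one> (ad v w) u + g \<one> (ad w u) v"
proof -
  have m: "metric_connection A g LC" using LC by (simp add: levi_civita_def)
  let ?N = "\<lambda>u v. LC (field u) (field v) q"
  have t: "?N a b = ?N b a + field (ad a b) q" for a b
  proof -
    have "torsion A LC (field a) (field b) q = 0"
      using LC smooth_vf_field unfolding levi_civita_def by blast
    then show ?thesis by (simp add: torsion_def bracket_field algebra_simps)
  qed
  have s: "g q (?N a b) (field c q) = - g q (?N a c) (field b q)" for a b c
    using metric_connection_field[OF m] metric_sym by metis
  have st: "g q (?N a b) (field c q) = g q (?N b a) (field c q) + g \<one> (ad a b) c" for a b c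
    by (subst t) (simp add: linear_add[OF metric_linear(2)] metric_field)
  show ?thesis
    using s[of u v w] s[of v w u] s[of w u v] st[of u v w] st[of v w u] st[of w u v] by linarith
qed

text \<open>By the Koszul formula, the inner products of the covariant derivative with left-invariant fields are the
same at all points.\<close>

lemma levi_civita_field:
  assumes LC: "levi_civita A g LC"
  shows "LC (field u) (field v) = field (LC (field u) (field v) \<one>)"
proof
  fix q
  show "LC (field u) (field v) q = field (LC (field u) (field v) \<one>) q"
  proof (rule eq_if_metric_eq[of q])
    fix w
    show "g q (LC (field u) (field v) q) (field w q) = g q (field (LC (field u) (field v) \<one>) q) (field w q)"
      using levi_civita_koszul[OF LC, of q u v w] levi_civita_koszul[OF LC, of \<one> u v w]
      by (simp add: metric_field field_one)
  qed
qed

text \<open>The tensor \<open>S a b\<close> below is twice the \<open>(0,1)\<close>-part of \<open>a \<mapsto> D\<^sub>a b\<close>. The torsion condition makes it symmetric,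
but it is complex linear in \<open>b\<close> and antilinear in \<open>a\<close>, so it vanishes. Then \<open>D\<^bsub>Ja\<^esub> = J D\<^bsub>a\<^esub>\<close> on left-invariant fields,
and skewness of both \<open>D\<^bsub>a\<^esub>\<close> and \<open>D\<^bsub>Ja\<^esub>\<close> forces them to vanish.\<close>

lemma chern_field:
  assumes D: "chern_connection A g D"
  shows "D (field u) (field v) q = 0"
proof -
  have m: "metric_connection A g D" and c: "connection A D"
    using D by (auto simp: chern_connection_def metric_connection_def)
  let ?N = "\<lambda>u v. D (field u) (field v) q"
  have field_J: "(\<lambda>q. cJ (field v q)) = field (cJ v)" for v by (simp add: fun_eq_iff field_cJ)
  have J: "?N a (cJ b) = cJ (?N a b)" for a b
    using D smooth_vf_field[of a] smooth_vf_field[of b] unfolding chern_connection_def field_J[symmetric] by blast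
  \<comment> \<open>the minus sign is treated as a constant function, with respect to which connections are linear\<close>
  have neg: "?N (- a) b = - ?N a b" for a b
  proof -
    have "smooth_fun A (\<lambda>_. - 1)" by (simp add: smooth_fun_def o_def smooth_on_const)
    then have "D (\<lambda>q. (- 1) *\<^sub>R field a q) (field b) q = (- 1) *\<^sub>R ?N a b"
      using c smooth_vf_field[of a] smooth_vf_field[of b] unfolding connection_def by blast
    moreover have "(\<lambda>q. (- 1) *\<^sub>R field a q) = field (- a)"
      by (simp add: fun_eq_iff linear_neg[OF linear_field])
    ultimately show ?thesis by simp
  qed
  define S where "S a b = ?N a b + cJ (?N (cJ a) b)" for a b
  have sym: "S a b = S b a" for a b
  proof -
    have "torsion A D (field a) (field b) q + torsion A D (field (cJ a)) (field (cJ b)) q = 0"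
      using D smooth_vf_field[of a] smooth_vf_field[of b] unfolding chern_connection_def field_J[symmetric] by blast
    then show ?thesis
      by (simp add: torsion_def bracket_field J S_def lie_ad_bilinear(3) lie_ad_cJ_right
          field_cJ linear_neg[OF linear_field] algebra_simps)
  qed
  have S_right: "S a (cJ b) = cJ (S a b)" for a b by (simp add: S_def J)
  have S_left: "S (cJ a) b = - cJ (S a b)" for a b by (simp add: S_def neg)
  have "S a b = 0" for a b
  proof -
    have "cJ (S a b) = - cJ (S a b)" using S_left S_right sym by metis
    then have "2 *\<^sub>R cJ (S a b) = 0" by (simp only: scaleR_2 eq_neg_iff_add_eq_0)
    then have "cJ (S a b) = 0" by simp
    then have "cJ (cJ (S a b)) = cJ 0" by (simp only:)
    then show ?thesis by simp
  qed
  then have hol: "?N (cJ a) b = cJ (?N a b)" for a b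
  proof -
    have "cJ (S a b) = 0" using \<open>S a b = 0\<close> by simp
    then show ?thesis by (simp add: S_def)
  qed
  have s: "g q (?N a b) (field c q) = - g q (field b q) (?N a c)" for a b c
    by (rule metric_connection_field[OF m])
  show ?thesis
  proof (rule eq_if_metric_eq[of q])
    fix w
    have "g q (?N u v) (field w q) = - g q (?N u v) (field w q)"
      using s[of "cJ u" v "cJ w"] s[of u v w]
      by (simp add: hol J field_cJ metric_cJ linear_neg[OF metric_linear(1)])
    then show "g q (?N u v) (field w q) = g q 0 (field w q)"
      by (simp add: linear_0[OF metric_linear(2)])
  qed
qed

end

section \<open>Hermitian forms and unitary frames\<close>

lemma vector_smult_eq: "c *s v = Re c *\<^sub>R v + Im c *\<^sub>R cJ v"
  by (simp add: cJ_def vec_eq_iff complex_eq_iff)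

lemma cJ_smult: "cJ v = \<i> *s v"
  by (simp add: cJ_def)

locale hermitian_form =
  fixes h :: "complex^'n::finite \<Rightarrow> complex^'n \<Rightarrow> real"
  assumes bilin: "bilinear h"
    and sym: "h v w = h w v"
    and pos: "v \<noteq> 0 \<Longrightarrow> h v v > 0"
    and J_inv: "h (cJ v) (cJ w) = h v w"
begin

lemma lin: "linear (h v)" "linear (\<lambda>v. h v w)"
  using bilin by (auto simp: bilinear_def)

lemma h_simps [simp]:
  "h (u + v) w = h u w + h v w" "h w (u + v) = h w u + h w v"
  "h (u - v) w = h u w - h v w" "h w (u - v) = h w u - h w v"
  "h (- v) w = - h v w" "h w (- v) = - h w v"
  "h (r *\<^sub>R v) w = r * h v w" "h w (r *\<^sub>R v) = r * h w v"
  "h 0 w = 0" "h w 0 = 0"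
  by (simp_all add: linear_add[OF lin(1)] linear_add[OF lin(2)] linear_diff[OF lin(1)] linear_diff[OF lin(2)]
      linear_neg[OF lin(1)] linear_neg[OF lin(2)] linear_cmul[OF lin(1)] linear_cmul[OF lin(2)]
      linear_0[OF lin(1)] linear_0[OF lin(2)])

lemma h_sum: "h (\<Sum>i\<in>I. f i) w = (\<Sum>i\<in>I. h (f i) w)" "h w (\<Sum>i\<in>I. f i) = (\<Sum>i\<in>I. h w (f i))"
  by (simp_all add: linear_sum[OF lin(1)] linear_sum[OF lin(2)] o_def)

lemma h_cJ_left: "h (cJ v) w = - h v (cJ w)"
  using J_inv[of v "cJ w"] by simp

lemma h_cJ_self [simp]: "h v (cJ v) = 0"
  using h_cJ_left[of v v] sym[of "cJ v" v] by simp

lemma h_eq_0: "h v v = 0 \<longleftrightarrow> v = 0"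
  using pos by force

text \<open>The Hermitian inner product with real part \<open>h\<close>.\<close>

definition H :: "complex^'n \<Rightarrow> complex^'n \<Rightarrow> complex" where
  "H v w = Complex (h v w) (h v (cJ w))"

lemma Re_H [simp]: "Re (H v w) = h v w" and Im_H: "Im (H v w) = h v (cJ w)"
  by (simp_all add: H_def)

lemma H_add [simp]: "H (u + v) w = H u w + H v w" "H w (u + v) = H w u + H w v"
  by (simp_all add: H_def complex_eq_iff)

lemma H_0 [simp]: "H 0 w = 0" "H w 0 = 0"
  by (simp_all add: H_def complex_eq_iff)

lemma H_minus [simp]: "H (- v) w = - H v w" "H w (- v) = - H w v"
  by (simp_all add: H_def complex_eq_iff)

lemma H_diff [simp]: "H (u - v) w = H u w - H v w" "H w (u - v) = H w u - H w v"
  by (simp_all add: H_def complex_eq_iff)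

lemma H_smult [simp]: "H (c *s v) w = c * H v w" "H w (c *s v) = cnj c * H w v"
  by (simp_all add: H_def complex_eq_iff vector_smult_eq h_cJ_left algebra_simps)

lemma H_cJ [simp]: "H (cJ v) w = \<i> * H v w" "H w (cJ v) = - \<i> * H w v"
  by (simp_all add: cJ_smult)

lemma H_scaleR [simp]: "H (r *\<^sub>R v) w = of_real r * H v w" "H w (r *\<^sub>R v) = of_real r * H w v"
  by (simp_all add: H_def complex_eq_iff)

lemma H_sum: "H (\<Sum>i\<in>I. f i) w = (\<Sum>i\<in>I. H (f i) w)" "H w (\<Sum>i\<in>I. f i) = (\<Sum>i\<in>I. H w (f i))"
  by (induction I rule: infinite_finite_induct) simp_all

lemma cnj_H: "cnj (H v w) = H w v"
  by (simp add: H_def complex_eq_iff h_cJ_left[of w v] sym sym[of "cJ v" w] flip: h_cJ_left[of v w])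

lemma H_self: "H v v = of_real (h v v)"
  by (simp add: H_def complex_eq_iff)

text \<open>Gram-Schmidt: fewer than \<open>CARD('n)\<close> vectors do not span, and a vector outside their span can be made
orthogonal to them and normalized.\<close>

lemma orthonormal_family:
  assumes "m \<le> CARD('n)"
  shows "\<exists>f::nat \<Rightarrow> complex^'n. \<forall>a<m. \<forall>b<m. H (f a) (f b) = (if a = b then 1 else 0)"
  using assms
proof (induction m)
  case 0
  show ?case by simp
next
  case (Suc m)
  then obtain f :: "nat \<Rightarrow> complex^'n" where
    f: "\<And>a b. a < m \<Longrightarrow> b < m \<Longrightarrow> H (f a) (f b) = (if a = b then 1 else 0)" by auto
  let ?W = "f ` {..<m}"
  have "vec.dim (vec.span ?W) \<le> card ?W" by (simp add: vec.dim_le_card')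
  also have "\<dots> \<le> m" by (metis card_image_le card_lessThan finite_lessThan)
  also have "m < vec.dim (UNIV :: (complex^'n) set)" using Suc.prems by (simp add: card_cart_basis)
  finally have "vec.dim (vec.span ?W) \<noteq> vec.dim (UNIV :: (complex^'n) set)" by (rule less_imp_neq)
  then have "vec.span ?W \<noteq> UNIV" by metis
  then obtain v where v: "v \<notin> vec.span ?W" by blast
  define z where "z = v - (\<Sum>a<m. H v (f a) *s f a)"
  have "(\<Sum>a<m. H v (f a) *s f a) \<in> vec.span ?W"
    by (intro vec.span_sum vec.span_scale vec.span_base) auto
  then have z0: "z \<noteq> 0" using v by (auto simp: z_def)
  have zf: "H z (f b) = 0" if "b < m" for b
  proof -
    have "(\<Sum>a<m. H v (f a) * H (f a) (f b)) = (\<Sum>a<m. if a = b then H v (f b) else 0)"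
      by (rule sum.cong) (use f that in auto)
    then show ?thesis using that by (simp add: z_def H_sum)
  qed
  define u where "u = (1 / sqrt (h z z)) *\<^sub>R z"
  have "H u u = 1" using pos[OF z0] by (simp add: u_def H_self)
  moreover have "H u (f b) = 0" "H (f b) u = 0" if "b < m" for b
    using zf[OF that] cnj_H[of z "f b"] by (simp_all add: u_def)
  ultimately have "\<forall>a<Suc m. \<forall>b<Suc m. H ((f(m := u)) a) ((f(m := u)) b) = (if a = b then 1 else 0)"
    using f by (auto simp: less_Suc_eq)
  then show ?case by blast
qed

definition unitary_frame :: "('n \<Rightarrow> complex^'n) \<Rightarrow> bool" where
  "unitary_frame E \<longleftrightarrow> (\<forall>a b. H (E a) (E b) = (if a = b then 1 else 0))"

lemma ex_unitary_frame: "\<exists>E. unitary_frame E"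
proof -
  obtain f :: "nat \<Rightarrow> complex^'n" where
    f: "\<forall>a<CARD('n). \<forall>b<CARD('n). H (f a) (f b) = (if a = b then 1 else 0)"
    using orthonormal_family[OF order_refl] by blast
  obtain j :: "'n \<Rightarrow> nat" where j: "bij_betw j UNIV {0..<CARD('n)}"
    using ex_bij_betw_finite_nat[OF finite[of UNIV]] by blast
  have "j a < CARD('n)" for a using j by (auto simp: bij_betw_def)
  moreover have "j a = j b \<longleftrightarrow> a = b" for a b using j by (auto simp: bij_betw_def inj_on_def)
  ultimately have "unitary_frame (\<lambda>a. f (j a))" using f by (simp add: unitary_frame_def)
  then show ?thesis by blast
qed

text \<open>Orthonormality says that one of two square matrices is a left inverse of the other, and the claim says that
it is a right inverse.\<close>

lemma frame_dual:
  assumes E: "unitary_frame E"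
  shows "(\<Sum>a\<in>UNIV. H (axis i 1) (E a) * E a $ k) = (if i = k then 1 else 0)"
proof -
  define P where "P = (\<chi> a i. E a $ i)"
  define R where "R = (\<chi> i a. H (axis i 1) (E a))"
  have "P ** R = mat 1"
  proof -
    have "(\<Sum>i\<in>UNIV. E a $ i * H (axis i 1) (E b)) = H (E a) (E b)" for a b
    proof -
      have "H (E a) (E b) = H (\<Sum>i\<in>UNIV. E a $ i *s axis i 1) (E b)" by (simp only: basis_expansion)
      then show ?thesis by (simp add: H_sum)
    qed
    then show ?thesis using E
      by (simp add: P_def R_def matrix_matrix_mult_def mat_def vec_eq_iff unitary_frame_def)
  qed
  then have "R ** P = mat 1" by (simp add: matrix_left_right_inverse)
  then show ?thesis by (simp add: P_def R_def matrix_matrix_mult_def mat_def vec_eq_iff)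
qed

lemma frame_expansion:
  assumes E: "unitary_frame E"
  shows "(\<Sum>a\<in>UNIV. H v (E a) *s E a) = v"
proof -
  have e: "(\<Sum>a\<in>UNIV. H (axis i 1) (E a) *s E a) = axis i 1" for i
    using frame_dual[OF E, of i] by (simp add: vec_eq_iff axis_def)
  have v: "v = (\<Sum>i\<in>UNIV. v $ i *s axis i 1)" by (simp only: basis_expansion)
  have "(\<Sum>a\<in>UNIV. H v (E a) *s E a) = (\<Sum>a\<in>UNIV. (\<Sum>i\<in>UNIV. v $ i * H (axis i 1) (E a)) *s E a)"
    by (subst v) (simp add: H_sum)
  also have "\<dots> = (\<Sum>a\<in>UNIV. \<Sum>i\<in>UNIV. v $ i *s (H (axis i 1) (E a) *s E a))"
    by (simp add: vec.scale_sum_left mult.assoc)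
  also have "\<dots> = (\<Sum>i\<in>UNIV. v $ i *s (\<Sum>a\<in>UNIV. H (axis i 1) (E a) *s E a))"
    by (subst sum.swap) (simp add: vec.scale_sum_right)
  also have "\<dots> = v" by (simp only: e basis_expansion)
  finally show ?thesis .
qed

lemma frame_parseval:
  assumes E: "unitary_frame E"
  shows "(\<Sum>a\<in>UNIV. H v (E a) * cnj (H w (E a))) = H v w"
proof -
  have "H v w = H (\<Sum>a\<in>UNIV. H v (E a) *s E a) w" by (simp only: frame_expansion[OF E])
  then show ?thesis by (simp add: H_sum cnj_H)
qed

text \<open>The trace may be computed in any frame, here by expanding the standard basis in \<open>E\<close>.\<close>

lemma matrix_trace_frame:
  assumes E: "unitary_frame E"
    and f: "\<And>u v. f (u + v) = f u + f v" "\<And>c v. f (c *s v) = c *s f v"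
  shows "trace (matrix f) = (\<Sum>a\<in>UNIV. H (f (E a)) (E a))"
proof -
  have f0: "f 0 = 0" using f(2)[of 0 0] by simp
  have fsum: "f (\<Sum>a\<in>I. y a) = (\<Sum>a\<in>I. f (y a))" for I and y :: "'n \<Rightarrow> _"
    by (induction I rule: infinite_finite_induct) (simp_all add: f f0)
  have "trace (matrix f) = (\<Sum>i\<in>UNIV. f (axis i 1) $ i)" by (simp add: trace_def matrix_def)
  also have "\<dots> = (\<Sum>i\<in>UNIV. f (\<Sum>a\<in>UNIV. H (axis i 1) (E a) *s E a) $ i)"
    by (simp only: frame_expansion[OF E])
  also have "\<dots> = (\<Sum>i\<in>UNIV. \<Sum>a\<in>UNIV. H (axis i 1) (E a) * f (E a) $ i)" by (simp add: fsum f)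
  also have "\<dots> = (\<Sum>a\<in>UNIV. \<Sum>i\<in>UNIV. f (E a) $ i * H (axis i 1) (E a))"
    by (subst sum.swap) (simp add: mult.commute)
  also have "\<dots> = (\<Sum>a\<in>UNIV. H (f (E a)) (E a))"
  proof (rule sum.cong[OF refl])
    fix a
    have "H (f (E a)) (E a) = H (\<Sum>i\<in>UNIV. f (E a) $ i *s axis i 1) (E a)" by (simp only: basis_expansion)
    then show "(\<Sum>i\<in>UNIV. f (E a) $ i * H (axis i 1) (E a)) = H (f (E a)) (E a)" by (simp add: H_sum)
  qed
  finally show ?thesis .
qed

text \<open>The real orthonormal frame formed by \<open>E\<close> and \<open>J E\<close>.\<close>

definition rframe :: "('n \<Rightarrow> complex^'n) \<Rightarrow> 'n \<times> bool \<Rightarrow> complex^'n" where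
  "rframe E i = (if snd i then cJ (E (fst i)) else E (fst i))"

lemma sum_rframe:
  "(\<Sum>i\<in>UNIV. F (rframe E i)) = (\<Sum>a\<in>UNIV. F (E a) + F (cJ (E a)))"
proof -
  have "(\<Sum>i\<in>UNIV. F (rframe E i)) = (\<Sum>a\<in>UNIV. \<Sum>b\<in>UNIV. F (rframe E (a, b)))"
    by (simp add: UNIV_Times_UNIV[symmetric] sum.cartesian_product del: UNIV_Times_UNIV)
  then show ?thesis by (simp add: UNIV_bool rframe_def add.commute)
qed

lemma rframe_expansion:
  assumes E: "unitary_frame E"
  shows "(\<Sum>i\<in>UNIV. h v (rframe E i) *\<^sub>R rframe E i) = v"
  unfolding sum_rframe[of "\<lambda>x. h v x *\<^sub>R x"]
  using frame_expansion[OF E, of v] by (simp add: vector_smult_eq Im_H)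

lemma rframe_parseval:
  assumes E: "unitary_frame E"
  shows "(\<Sum>i\<in>UNIV. h v (rframe E i) * h w (rframe E i)) = h v w"
proof -
  have "h v w = h (\<Sum>i\<in>UNIV. h v (rframe E i) *\<^sub>R rframe E i) w" by (simp only: rframe_expansion[OF E])
  then show ?thesis by (simp add: h_sum sym[of _ w])
qed

lemma real_trace_rframe:
  assumes E: "unitary_frame E" and F: "linear F"
  shows "(\<Sum>b\<in>Basis. F b \<bullet> b) = (\<Sum>i\<in>UNIV. h (F (rframe E i)) (rframe E i))"
proof -
  let ?e = "rframe E"
  have "(\<Sum>b\<in>Basis. F b \<bullet> b) = (\<Sum>b\<in>Basis. F (\<Sum>i\<in>UNIV. h b (?e i) *\<^sub>R ?e i) \<bullet> b)"
    by (simp only: rframe_expansion[OF E])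
  also have "\<dots> = (\<Sum>b\<in>Basis. \<Sum>i\<in>UNIV. h b (?e i) * (F (?e i) \<bullet> b))"
    by (simp add: linear_sum[OF F] linear_cmul[OF F] o_def inner_sum_left)
  also have "\<dots> = (\<Sum>i\<in>UNIV. h (\<Sum>b\<in>Basis. (F (?e i) \<bullet> b) *\<^sub>R b) (?e i))"
    by (subst sum.swap) (simp add: h_sum mult.commute)
  finally show ?thesis by (simp add: euclidean_representation)
qed

lemma trace_product_rframe:
  assumes E: "unitary_frame E" and F: "linear F"
  shows "(\<Sum>i\<in>UNIV. h (F (K (rframe E i))) (rframe E i)) =
    (\<Sum>i\<in>UNIV. \<Sum>j\<in>UNIV. h (K (rframe E i)) (rframe E j) * h (F (rframe E j)) (rframe E i))"
proof (rule sum.cong[OF refl])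
  fix i
  have "h (F (K (rframe E i))) (rframe E i) =
     h (F (\<Sum>j\<in>UNIV. h (K (rframe E i)) (rframe E j) *\<^sub>R rframe E j)) (rframe E i)"
    by (simp only: rframe_expansion[OF E])
  then show "h (F (K (rframe E i))) (rframe E i) =
    (\<Sum>j\<in>UNIV. h (K (rframe E i)) (rframe E j) * h (F (rframe E j)) (rframe E i))"
    by (simp add: linear_sum[OF F] linear_cmul[OF F] o_def h_sum)
qed

lemma trace_product_commute:
  assumes E: "unitary_frame E" and F: "linear F" and K: "linear K"
  shows "(\<Sum>i\<in>UNIV. h (F (K (rframe E i))) (rframe E i)) = (\<Sum>i\<in>UNIV. h (K (F (rframe E i))) (rframe E i))"
  unfolding trace_product_rframe[OF E F] trace_product_rframe[OF E K]
  by (subst sum.swap) (simp add: mult.commute)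

end

section \<open>The Ricci tensor of a complex Lie algebra with a Hermitian inner product\<close>

lemma sum_sym_antisym:
  fixes S C :: "'i::finite \<Rightarrow> 'i \<Rightarrow> real"
  assumes "\<And>i j. S i j = S j i" "\<And>i j. C i j = - C j i"
  shows "(\<Sum>i\<in>UNIV. \<Sum>j\<in>UNIV. S i j * C i j) = 0"
proof -
  have "(\<Sum>i\<in>UNIV. \<Sum>j\<in>UNIV. S i j * C i j) = (\<Sum>i\<in>UNIV. \<Sum>j\<in>UNIV. S j i * C j i)"
    by (rule sum.swap)
  also have "\<dots> = (\<Sum>i\<in>UNIV. \<Sum>j\<in>UNIV. - (S i j * C i j))"
  proof (intro sum.cong refl)
    fix i j show "S j i * C j i = - (S i j * C i j)" using assms(1)[of i j] assms(2)[of j i] by simp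
  qed
  finally show ?thesis by (simp add: sum_negf)
qed

text \<open>The tangent space at a point of the group: \<open>br\<close> is the bracket and \<open>nab\<close> the Levi-Civita connection, on
left-invariant fields.\<close>

locale hermitian_lie_algebra = hermitian_form h
  for h :: "complex^'n::finite \<Rightarrow> complex^'n \<Rightarrow> real" +
  fixes br nab :: "complex^'n \<Rightarrow> complex^'n \<Rightarrow> complex^'n"
  assumes br_add: "br (u + u') v = br u v + br u' v"
    and br_scaleR: "br (r *\<^sub>R u) v = r *\<^sub>R br u v"
    and br_cJ: "br (cJ u) v = cJ (br u v)"
    and br_antisym: "br v u = - br u v"
    and koszul: "2 * h (nab u v) w = h (br u v) w - h (br v w) u + h (br w u) v"
begin

lemma br_simps [simp]:
  "br (u + u') v = br u v + br u' v" "br v (u + u') = br v u + br v u'"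
  "br (r *\<^sub>R u) v = r *\<^sub>R br u v" "br v (r *\<^sub>R u) = r *\<^sub>R br v u"
  "br (cJ u) v = cJ (br u v)" "br v (cJ u) = cJ (br v u)"
  "br 0 v = 0" "br v 0 = 0"
  "br (- u) v = - br u v" "br v (- u) = - br v u"
  "br (u - u') v = br u v - br u' v" "br v (u - u') = br v u - br v u'"
  "br v v = 0"
proof -
  show *: "br (u + u') v = br u v + br u' v" "br (r *\<^sub>R u) v = r *\<^sub>R br u v"
      "br (cJ u) v = cJ (br u v)" for u u' v r
    by (rule br_add br_scaleR br_cJ)+
  show **: "br v (u + u') = br v u + br v u'" "br v (r *\<^sub>R u) = r *\<^sub>R br v u" "br v (cJ u) = cJ (br v u)"
    for u u' v r
  proof -
    have "br v (u + u') = - br u v + - br u' v" by (subst br_antisym) (simp add: *)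
    then show "br v (u + u') = br v u + br v u'" using br_antisym[of u v] br_antisym[of u' v] by simp
    have "br v (r *\<^sub>R u) = r *\<^sub>R (- br u v)" by (subst br_antisym) (simp add: *)
    then show "br v (r *\<^sub>R u) = r *\<^sub>R br v u" using br_antisym[of u v] by simp
    have "br v (cJ u) = cJ (- br u v)" by (subst br_antisym) (simp add: *)
    then show "br v (cJ u) = cJ (br v u)" using br_antisym[of u v] by simp
  qed
  show neg: "br (- u) v = - br u v" "br v (- u) = - br v u" for u v
    using *(2)[of "-1"] **(2)[of _ "-1"] by simp_all
  show "br 0 v = 0" "br v 0 = 0" using *(2)[of 0] **(2)[of _ 0] by simp_all
  show "br (u - u') v = br u v - br u' v" "br v (u - u') = br v u - br v u'"
    using *(1)[of u "- u'"] **(1)[of v u "- u'"] by (simp_all add: neg)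
  have "2 *\<^sub>R br v v = 0" using br_antisym[of v v] by (simp only: scaleR_2 eq_neg_iff_add_eq_0)
  then show "br v v = 0" by simp
qed

lemma br_smult [simp]: "br (c *s u) v = c *s br u v" "br v (c *s u) = c *s br v u"
  by (simp_all add: vector_smult_eq)

lemma h_ext:
  assumes "\<And>w. h u w = h v w"
  shows "u = v"
  using assms[of "u - v"] h_eq_0[of "u - v"] by simp

lemma nab_simps [simp]:
  "nab (u + u') v = nab u v + nab u' v" "nab v (u + u') = nab v u + nab v u'"
  "nab (r *\<^sub>R u) v = r *\<^sub>R nab u v" "nab v (r *\<^sub>R u) = r *\<^sub>R nab v u"
proof -
  have *: "h (nab u v) w = (h (br u v) w - h (br v w) u + h (br w u) v) / 2" for u v w
    using koszul[of u v w] by simp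
  show "nab (u + u') v = nab u v + nab u' v" "nab v (u + u') = nab v u + nab v u'"
    "nab (r *\<^sub>R u) v = r *\<^sub>R nab u v" "nab v (r *\<^sub>R u) = r *\<^sub>R nab v u"
    by (rule h_ext; simp add: * field_simps)+
qed

lemma nab_torsion_free: "nab v u = nab u v + br v u"
proof (rule h_ext)
  fix w
  show "h (nab v u) w = h (nab u v + br v u) w"
    using koszul[of v u w] koszul[of u v w] br_antisym[of u v] br_antisym[of w v] br_antisym[of w u] by simp
qed

text \<open>The trace of \<open>b \<mapsto> R(b, v) w\<close> with the curvature \<open>R\<close> of \<open>nab\<close>.\<close>

definition ric :: "complex^'n \<Rightarrow> complex^'n \<Rightarrow> real" where
  "ric v w = (\<Sum>b\<in>Basis. (nab b (nab v w) - nab v (nab b w) - nab (br b v) w) \<bullet> b)"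

lemma ric_bilinear: "bilinear ric"
  unfolding bilinear_def linear_iff ric_def
  by (simp add: inner_add_left inner_diff_left sum.distrib sum_subtractf sum_distrib_left algebra_simps)

definition tau :: "complex^'n \<Rightarrow> complex" where
  "tau z = trace (matrix (br z))"

definition killing :: "complex^'n \<Rightarrow> complex^'n \<Rightarrow> complex" where
  "killing v w = trace (matrix (br v \<circ> br w))"

lemma tau_frame: "unitary_frame E \<Longrightarrow> tau z = (\<Sum>a\<in>UNIV. H (br z (E a)) (E a))"
  unfolding tau_def by (rule matrix_trace_frame) simp_all

lemma killing_frame: "unitary_frame E \<Longrightarrow> killing v w = (\<Sum>a\<in>UNIV. H (br v (br w (E a))) (E a))"
  unfolding killing_def by (subst matrix_trace_frame) simp_all

lemma tau_simps [simp]: "tau (u + v) = tau u + tau v" "tau (c *s v) = c * tau v" "tau (cJ v) = \<i> * tau v"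
    "tau 0 = 0"
proof -
  obtain E where E: "unitary_frame E" using ex_unitary_frame by blast
  show "tau (u + v) = tau u + tau v" "tau (c *s v) = c * tau v" "tau (cJ v) = \<i> * tau v" "tau 0 = 0"
    by (simp_all add: tau_frame[OF E] sum.distrib sum_distrib_left)
qed

lemma killing_cJ: "killing (cJ v) w = \<i> * killing v w" "killing v (cJ w) = \<i> * killing v w"
proof -
  obtain E where E: "unitary_frame E" using ex_unitary_frame by blast
  show "killing (cJ v) w = \<i> * killing v w" "killing v (cJ w) = \<i> * killing v w"
    by (simp_all add: killing_frame[OF E] sum_distrib_left)
qed

lemma linear_br: "linear (br v)"
  by (simp add: linear_iff)

lemma real_tau:
  assumes E: "unitary_frame E"
  shows "(\<Sum>i\<in>UNIV. h (br z (rframe E i)) (rframe E i)) = 2 * Re (tau z)"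
  unfolding sum_rframe[of "\<lambda>x. h (br z x) x"] tau_frame[OF E] by (simp add: J_inv sum_distrib_left)

lemma real_killing:
  assumes E: "unitary_frame E"
  shows "(\<Sum>i\<in>UNIV. h (br v (br w (rframe E i))) (rframe E i)) = 2 * Re (killing v w)"
  unfolding sum_rframe[of "\<lambda>x. h (br v (br w x)) x"] killing_frame[OF E] by (simp add: J_inv sum_distrib_left)

lemma Re_killing_sym: "Re (killing v w) = Re (killing w v)"
proof -
  obtain E where E: "unitary_frame E" using ex_unitary_frame by blast
  show ?thesis using real_killing[OF E, of v w] real_killing[OF E, of w v]
      trace_product_commute[OF E linear_br linear_br, of v w] by simp
qed

text \<open>Put \<open>A\<^sub>w x = nab x w\<close>. Absence of torsion gives \<open>nab v = A\<^sub>v + ad v\<close>, so the trace of \<open>b \<mapsto> R(b, v) w\<close> is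
\<open>tr A\<^bsub>nab v w\<^esub> - tr ((A\<^sub>v + ad v) A\<^sub>w) + tr (A\<^sub>w ad v)\<close>. The terms with \<open>ad v\<close> cancel by cyclicity of the trace,
and the Koszul formula gives \<open>tr A\<^sub>z = - tr (ad z)\<close>.\<close>

lemma ric_trace_form:
  assumes E: "unitary_frame E"
  shows "ric v w = - 2 * Re (tau (nab v w)) -
    (\<Sum>i\<in>UNIV. h (nab (nab (rframe E i) w) v) (rframe E i))"
proof -
  let ?e = "rframe E"
  have lin: "linear (\<lambda>b. nab b (nab v w) - nab v (nab b w) - nab (br b v) w)"
    by (simp add: linear_iff algebra_simps)
  have "ric v w = (\<Sum>i\<in>UNIV. h (nab (?e i) (nab v w) - nab v (nab (?e i) w) - nab (br (?e i) v) w) (?e i))"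
    unfolding ric_def by (rule real_trace_rframe[OF E lin])
  also have "\<dots> = (\<Sum>i\<in>UNIV. h (nab (?e i) (nab v w)) (?e i)) - (\<Sum>i\<in>UNIV. h (nab v (nab (?e i) w)) (?e i))
     - (\<Sum>i\<in>UNIV. h (nab (br (?e i) v) w) (?e i))"
    by (simp add: sum_subtractf)
  also have "(\<Sum>i\<in>UNIV. h (nab (?e i) (nab v w)) (?e i)) = - 2 * Re (tau (nab v w))"
  proof -
    have "h (nab x z) x = - h (br z x) x" for x z
      using koszul[of x z x] br_antisym[of z x] by simp
    then show ?thesis using real_tau[OF E, of "nab v w"] by (simp add: sum_negf)
  qed
  also have "(\<Sum>i\<in>UNIV. h (nab v (nab (?e i) w)) (?e i)) =
      (\<Sum>i\<in>UNIV. h (nab (nab (?e i) w) v) (?e i)) + (\<Sum>i\<in>UNIV. h (br v (nab (?e i) w)) (?e i))"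
    by (subst nab_torsion_free) (simp add: sum.distrib)
  also have "(\<Sum>i\<in>UNIV. h (br v (nab (?e i) w)) (?e i)) = (\<Sum>i\<in>UNIV. h (nab (br v (?e i)) w) (?e i))"
    by (rule trace_product_commute[OF E]) (simp_all add: linear_iff)
  also have "\<dots> = - (\<Sum>i\<in>UNIV. h (nab (br (?e i) v) w) (?e i))"
  proof -
    have "nab (br v x) w = - nab (br x v) w" for x
      using nab_simps(3)[of "-1" "br x v" w] br_antisym[of v x] by simp
    then show ?thesis by (simp add: sum_negf)
  qed
  finally show ?thesis by simp
qed

text \<open>By the Koszul formula the matrix of \<open>A\<^sub>w\<close> is \<open>- (S w + C w) / 2\<close> with \<open>S w\<close> symmetric and \<open>C w\<close>
antisymmetric. In the trace of \<open>A\<^sub>v A\<^sub>w\<close> the mixed products vanish, the product of the symmetric parts gives the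
single sum and the Killing form, and that of the antisymmetric parts gives the double sum.\<close>

lemma ric_real_frame:
  assumes E: "unitary_frame E"
  shows "ric v w = - 2 * Re (tau (nab v w))
    - 1/2 * (\<Sum>i\<in>UNIV. h (br w (rframe E i)) (br v (rframe E i))) - Re (killing v w)
    + 1/4 * (\<Sum>i\<in>UNIV. \<Sum>j\<in>UNIV. h (br (rframe E i) (rframe E j)) w * h (br (rframe E i) (rframe E j)) v)"
proof -
  let ?e = "rframe E"
  define S where "S w i j = h (br w (?e i)) (?e j) + h (br w (?e j)) (?e i)" for w i j
  define C where "C w i j = h (br (?e i) (?e j)) w" for w i j
  have S_sym: "S w i j = S w j i" for w i j by (simp add: S_def)
  have C_anti: "C w i j = - C w j i" for w i j
    using br_antisym[of "?e i" "?e j"] by (simp add: C_def)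
  have nab: "h (nab (?e i) w) (?e j) = - 1/2 * (S w i j + C w i j)" for w i j
  proof -
    have "2 * h (nab (?e i) w) (?e j) = - (S w i j + C w i j)"
      using koszul[of "?e i" w "?e j"] br_antisym[of "?e i" w] br_antisym[of "?e j" "?e i"]
      by (simp add: S_def C_def)
    then show ?thesis by (simp add: field_simps)
  qed
  have "(\<Sum>i\<in>UNIV. h (nab (nab (?e i) w) v) (?e i)) =
     (\<Sum>i\<in>UNIV. \<Sum>j\<in>UNIV. h (nab (?e i) w) (?e j) * h (nab (?e j) v) (?e i))"
    by (rule trace_product_rframe[OF E, of "\<lambda>x. nab x v" "\<lambda>x. nab x w"]) (simp add: linear_iff)
  also have "\<dots> = (\<Sum>i\<in>UNIV. \<Sum>j\<in>UNIV. 1/4 * (S w i j * S v i j) - 1/4 * (C w i j * C v i j)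
      + 1/4 * (S v i j * C w i j) - 1/4 * (S w i j * C v i j))"
  proof (intro sum.cong refl)
    fix i j
    have s: "S v j i = S v i j" "C v j i = - C v i j" by (rule S_sym, rule C_anti)
    show "h (nab (?e i) w) (?e j) * h (nab (?e j) v) (?e i) = 1/4 * (S w i j * S v i j)
        - 1/4 * (C w i j * C v i j) + 1/4 * (S v i j * C w i j) - 1/4 * (S w i j * C v i j)"
      unfolding nab s by (simp add: algebra_simps)
  qed
  also have "\<dots> = 1/4 * (\<Sum>i\<in>UNIV. \<Sum>j\<in>UNIV. S w i j * S v i j) - 1/4 * (\<Sum>i\<in>UNIV. \<Sum>j\<in>UNIV. C w i j * C v i j)
      + 1/4 * (\<Sum>i\<in>UNIV. \<Sum>j\<in>UNIV. S v i j * C w i j) - 1/4 * (\<Sum>i\<in>UNIV. \<Sum>j\<in>UNIV. S w i j * C v i j)"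
    by (simp only: sum_subtractf sum.distrib sum_distrib_left)
  also have "\<dots> = 1/4 * (\<Sum>i\<in>UNIV. \<Sum>j\<in>UNIV. S w i j * S v i j) - 1/4 * (\<Sum>i\<in>UNIV. \<Sum>j\<in>UNIV. C w i j * C v i j)"
    using sum_sym_antisym[of "S v" "C w", OF S_sym C_anti] sum_sym_antisym[of "S w" "C v", OF S_sym C_anti] by simp
  also have "(\<Sum>i\<in>UNIV. \<Sum>j\<in>UNIV. S w i j * S v i j) =
     2 * (\<Sum>i\<in>UNIV. h (br w (?e i)) (br v (?e i))) + 4 * Re (killing v w)"
  proof -
    have "(\<Sum>i\<in>UNIV. \<Sum>j\<in>UNIV. S w i j * S v i j) =
       (\<Sum>i\<in>UNIV. \<Sum>j\<in>UNIV. h (br w (?e i)) (?e j) * h (br v (?e i)) (?e j))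
     + (\<Sum>i\<in>UNIV. \<Sum>j\<in>UNIV. h (br w (?e j)) (?e i) * h (br v (?e j)) (?e i))
     + (\<Sum>i\<in>UNIV. \<Sum>j\<in>UNIV. h (br w (?e i)) (?e j) * h (br v (?e j)) (?e i))
     + (\<Sum>i\<in>UNIV. \<Sum>j\<in>UNIV. h (br w (?e j)) (?e i) * h (br v (?e i)) (?e j))"
      unfolding S_def by (simp add: sum.distrib algebra_simps)
    also have "(\<Sum>i\<in>UNIV. \<Sum>j\<in>UNIV. h (br w (?e j)) (?e i) * h (br v (?e j)) (?e i)) =
       (\<Sum>i\<in>UNIV. \<Sum>j\<in>UNIV. h (br w (?e i)) (?e j) * h (br v (?e i)) (?e j))"
      by (rule sum.swap)
    also have "(\<Sum>i\<in>UNIV. \<Sum>j\<in>UNIV. h (br w (?e j)) (?e i) * h (br v (?e i)) (?e j)) =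
       (\<Sum>i\<in>UNIV. \<Sum>j\<in>UNIV. h (br w (?e i)) (?e j) * h (br v (?e j)) (?e i))"
      by (rule sum.swap)
    also have "(\<Sum>i\<in>UNIV. \<Sum>j\<in>UNIV. h (br w (?e i)) (?e j) * h (br v (?e j)) (?e i)) = 2 * Re (killing v w)"
      using trace_product_rframe[OF E linear_br, of v "br w"] real_killing[OF E, of v w] by simp
    finally show ?thesis by (simp add: rframe_parseval[OF E])
  qed
  finally show ?thesis unfolding ric_trace_form[OF E] C_def by (simp add: mult.commute algebra_simps)
qed

text \<open>Each summand over the real frame is unchanged when \<open>E a\<close> is replaced by \<open>J (E a)\<close>, or pairs with it to a
Hermitian expression, because the bracket is complex bilinear.\<close>

lemma ric_frame:
  assumes E: "unitary_frame E"
  shows "ric v w = - 2 * Re (tau (nab v w))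
    - (\<Sum>a\<in>UNIV. h (br v (E a)) (br w (E a))) - Re (killing v w)
    + 1/2 * (\<Sum>a\<in>UNIV. \<Sum>b\<in>UNIV. Re (cnj (H (br (E a) (E b)) v) * H (br (E a) (E b)) w))"
proof -
  have 1: "(\<Sum>i\<in>UNIV. h (br w (rframe E i)) (br v (rframe E i))) = 2 * (\<Sum>a\<in>UNIV. h (br v (E a)) (br w (E a)))"
    unfolding sum_rframe[of "\<lambda>x. h (br w x) (br v x)"]
    by (simp add: J_inv sum_distrib_left sym[of "br w _"])
  have 2: "(\<Sum>j\<in>UNIV. h (br x (rframe E j)) w * h (br x (rframe E j)) v) =
    (\<Sum>b\<in>UNIV. Re (cnj (H (br x (E b)) v) * H (br x (E b)) w))" for x
    unfolding sum_rframe[of "\<lambda>y. h (br x y) w * h (br x y) v"]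
    by (simp add: h_cJ_left Im_H mult.commute)
  have 3: "(\<Sum>i\<in>UNIV. \<Sum>j\<in>UNIV. h (br (rframe E i) (rframe E j)) w * h (br (rframe E i) (rframe E j)) v) =
    2 * (\<Sum>a\<in>UNIV. \<Sum>b\<in>UNIV. Re (cnj (H (br (E a) (E b)) v) * H (br (E a) (E b)) w))"
    unfolding 2 sum_rframe[of "\<lambda>x. \<Sum>b\<in>UNIV. Re (cnj (H (br x (E b)) v) * H (br x (E b)) w)"]
    by (simp add: sum_distrib_left algebra_simps)
  show ?thesis unfolding ric_real_frame[OF E] 1 3 by simp
qed

section \<open>The tensor K of a complex Lie algebra\<close>

text \<open>\<open>q1\<close> to \<open>q4\<close> are \<open>Q\<^sup>1\<close> to \<open>Q\<^sup>4\<close> in the frame \<open>E\<close>, for the torsion \<open>- br\<close>. With \<open>Z\<^sub>x = (x - \<i> J x) / 2\<close> one has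
\<open>g(Z\<^sub>x, cnj Z\<^sub>y) = H x y / 2\<close>: each of the two torsion factors contributes a factor \<open>1/2\<close>, and each of the two inverse
metrics a factor \<open>2\<close>, so no constant remains.\<close>

definition q1 :: "('n \<Rightarrow> complex^'n) \<Rightarrow> complex^'n \<Rightarrow> complex^'n \<Rightarrow> complex" where
  "q1 E x y = (\<Sum>a\<in>UNIV. \<Sum>b\<in>UNIV. H (br x (E a)) (E b) * cnj (H (br y (E a)) (E b)))"

definition q2 :: "('n \<Rightarrow> complex^'n) \<Rightarrow> complex^'n \<Rightarrow> complex^'n \<Rightarrow> complex" where
  "q2 E x y = (\<Sum>a\<in>UNIV. \<Sum>b\<in>UNIV. cnj (H (br (E a) (E b)) x) * H (br (E a) (E b)) y)"

definition q3 :: "('n \<Rightarrow> complex^'n) \<Rightarrow> complex^'n \<Rightarrow> complex^'n \<Rightarrow> complex" where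
  "q3 E x y = (\<Sum>a\<in>UNIV. \<Sum>b\<in>UNIV. H (br x (E a)) (E a) * cnj (H (br y (E b)) (E b)))"

definition q4 :: "('n \<Rightarrow> complex^'n) \<Rightarrow> complex^'n \<Rightarrow> complex^'n \<Rightarrow> complex" where
  "q4 E x y = 1/2 * (\<Sum>a\<in>UNIV. \<Sum>b\<in>UNIV. H (br (E b) (E a)) (E a) * cnj (H (br (E b) y) x) +
     cnj (H (br (E b) (E a)) (E a)) * H (br (E b) x) y)"

text \<open>The sesquilinear form whose components are those of \<open>K\<close>, which is \<open>- Q\<close> as the Chern connection is flat.\<close>

definition kappa :: "('n \<Rightarrow> complex^'n) \<Rightarrow> complex^'n \<Rightarrow> complex^'n \<Rightarrow> complex" where
  "kappa E x y = - (1/2 * q1 E x y - 1/4 * q2 E x y - 1/2 * q3 E x y + q4 E x y)"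

lemma q1_eq: "unitary_frame E \<Longrightarrow> q1 E x y = (\<Sum>a\<in>UNIV. H (br x (E a)) (br y (E a)))"
  by (simp add: q1_def frame_parseval)

lemma q3_eq: "unitary_frame E \<Longrightarrow> q3 E x y = tau x * cnj (tau y)"
  by (simp add: q3_def tau_frame sum_product)

lemma q4_eq:
  assumes E: "unitary_frame E"
  shows "q4 E x y = 1/2 * (\<Sum>b\<in>UNIV. tau (E b) * cnj (H (br (E b) y) x) + cnj (tau (E b)) * H (br (E b) x) y)"
  unfolding q4_def
  by (subst sum.swap) (simp add: tau_frame[OF E] sum.distrib sum_distrib_right)

lemma kappa_unimodular:
  assumes E: "unitary_frame E" and u: "\<And>z. tau z = 0"
  shows "2 * Re (kappa E v w) = ric v w + Re (killing v w)"
  unfolding kappa_def q1_eq[OF E] q3_eq[OF E] q4_eq[OF E] q2_def ric_frame[OF E]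
  by (simp add: u)

text \<open>Replacing \<open>v\<close>, \<open>w\<close> by \<open>J v\<close>, \<open>J w\<close> changes the sign of the Killing form, which is complex bilinear, and preserves
the rest of \<open>ric\<close>.\<close>

lemma kappa_eq_ric11:
  assumes E: "unitary_frame E" and u: "\<And>z. tau z = 0"
  shows "2 * Re (kappa E v w) = 1/2 * (ric v w + ric (cJ v) (cJ w))"
proof -
  have "ric (cJ v) (cJ w) = ric v w + 2 * Re (killing v w)"
    unfolding ric_frame[OF E] by (simp add: u killing_cJ J_inv)
  then show ?thesis using kappa_unimodular[OF E u, of v w] by simp
qed

definition br_norm :: "('n \<Rightarrow> complex^'n) \<Rightarrow> real" where
  "br_norm E = (\<Sum>a\<in>UNIV. \<Sum>b\<in>UNIV. h (br (E a) (E b)) (br (E a) (E b)))"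

definition tau_norm :: "('n \<Rightarrow> complex^'n) \<Rightarrow> real" where
  "tau_norm E = (\<Sum>a\<in>UNIV. (cmod (tau (E a)))\<^sup>2)"

lemma sum_frame_H:
  assumes E: "unitary_frame E"
  shows "(\<Sum>c\<in>UNIV. \<Sum>a\<in>UNIV. \<Sum>b\<in>UNIV. cnj (H (br (E a) (E b)) (E c)) * H (br (E a) (E b)) (E c)) =
    of_real (br_norm E)"
proof -
  have "(\<Sum>c\<in>UNIV. \<Sum>a\<in>UNIV. \<Sum>b\<in>UNIV. cnj (H (br (E a) (E b)) (E c)) * H (br (E a) (E b)) (E c)) =
    (\<Sum>a\<in>UNIV. \<Sum>b\<in>UNIV. \<Sum>c\<in>UNIV. H (br (E a) (E b)) (E c) * cnj (H (br (E a) (E b)) (E c)))"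
    by (subst sum.swap) (rule sum.cong[OF refl], subst sum.swap, simp add: mult.commute)
  then show ?thesis by (simp add: frame_parseval[OF E] H_self br_norm_def)
qed

text \<open>The traces of \<open>q1\<close> and \<open>q2\<close> are \<open>br_norm\<close>, those of \<open>q3\<close> and \<open>q4\<close> are \<open>tau_norm\<close>.\<close>

lemma trace_kappa:
  assumes E: "unitary_frame E"
  shows "2 * (\<Sum>c\<in>UNIV. kappa E (E c) (E c)) = - of_real (br_norm E / 2 + tau_norm E)"
proof -
  have 1: "(\<Sum>c\<in>UNIV. q1 E (E c) (E c)) = of_real (br_norm E)"
    by (simp add: q1_eq[OF E] H_self br_norm_def)
  have 2: "(\<Sum>c\<in>UNIV. q2 E (E c) (E c)) = of_real (br_norm E)"
    unfolding q2_def by (rule sum_frame_H[OF E])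
  have 3: "(\<Sum>c\<in>UNIV. q3 E (E c) (E c)) = of_real (tau_norm E)"
    by (simp add: q3_eq[OF E] tau_norm_def complex_norm_square[symmetric])
  have 4: "(\<Sum>c\<in>UNIV. q4 E (E c) (E c)) = of_real (tau_norm E)"
  proof -
    have "(\<Sum>c\<in>UNIV. q4 E (E c) (E c)) = 1/2 * (\<Sum>b\<in>UNIV. \<Sum>c\<in>UNIV.
       tau (E b) * cnj (H (br (E b) (E c)) (E c)) + cnj (tau (E b)) * H (br (E b) (E c)) (E c))"
      unfolding q4_eq[OF E] sum_distrib_left[symmetric] by (subst sum.swap) simp
    also have "\<dots> = 1/2 * (\<Sum>b\<in>UNIV. tau (E b) * cnj (tau (E b)) + cnj (tau (E b)) * tau (E b))"
      by (simp add: sum.distrib tau_frame[OF E] flip: sum_distrib_left)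
    finally show ?thesis by (simp add: tau_norm_def complex_norm_square[symmetric] mult.commute[of "cnj _"]
          flip: sum_distrib_left)
  qed
  show ?thesis
    unfolding kappa_def sum_negf sum.distrib sum_subtractf sum_distrib_left[symmetric] 1 2 3 4
    by simp
qed

text \<open>In \<open>ric_frame\<close> only the term with \<open>nab v w\<close> is not symmetric.\<close>

lemma ric_diff: "ric v w - ric w v = - 2 * Re (tau (br v w))"
proof -
  obtain E where E: "unitary_frame E" using ex_unitary_frame by blast
  have "tau (nab v w) = tau (nab w v) + tau (br v w)"
    by (subst nab_torsion_free) simp
  then show ?thesis
    unfolding ric_frame[OF E] using Re_killing_sym[of v w]
    by (simp add: sym[of "br w _" "br v _"] mult.commute)
qed

text \<open>The trace \<open>Y\<close> of \<open>nab\<close> is the vector dual to the real trace of \<open>ad\<close>, so \<open>2 Re (tau Y)\<close> is its squared length,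
which is \<open>4 * tau_norm E\<close>. The Killing form contributes nothing, as its values at \<open>E c\<close> and \<open>J (E c)\<close> cancel.\<close>

lemma trace_ric:
  assumes E: "unitary_frame E"
  shows "(\<Sum>c\<in>UNIV. ric (E c) (E c) + ric (cJ (E c)) (cJ (E c))) = - br_norm E - 4 * tau_norm E"
proof -
  let ?e = "rframe E"
  define Y where "Y = (\<Sum>i\<in>UNIV. nab (?e i) (?e i))"
  have hY: "h Y z = 2 * Re (tau z)" for z
  proof -
    have "h (nab x x) z = h (br z x) x" for x
      using koszul[of x x z] br_antisym[of x z] by simp
    then show ?thesis using real_tau[OF E, of z] by (simp add: Y_def h_sum)
  qed
  have tau_sum: "tau (\<Sum>i\<in>I. f i) = (\<Sum>i\<in>I. tau (f i))" for I and f :: "'n \<times> bool \<Rightarrow> _"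
    by (induction I rule: infinite_finite_induct) simp_all
  have "2 * Re (tau Y) = h Y Y" by (simp add: hY)
  also have "\<dots> = (\<Sum>i\<in>UNIV. h Y (?e i) * h Y (?e i))" by (simp add: rframe_parseval[OF E])
  also have "\<dots> = 4 * tau_norm E"
    unfolding sum_rframe[of "\<lambda>x. h Y x * h Y x"]
    unfolding hY
    by (simp add: tau_norm_def sum_distrib_left cmod_def power2_eq_square algebra_simps)
  finally have tauY: "2 * Re (tau Y) = 4 * tau_norm E" .
  have "(\<Sum>c\<in>UNIV. ric (E c) (E c) + ric (cJ (E c)) (cJ (E c))) =
     (\<Sum>c\<in>UNIV. - 2 * Re (tau (nab (E c) (E c))) - 2 * Re (tau (nab (cJ (E c)) (cJ (E c))))
      - 2 * (\<Sum>a\<in>UNIV. h (br (E c) (E a)) (br (E c) (E a)))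
      + (\<Sum>a\<in>UNIV. \<Sum>b\<in>UNIV. Re (cnj (H (br (E a) (E b)) (E c)) * H (br (E a) (E b)) (E c))))"
    unfolding ric_frame[OF E] by (intro sum.cong refl) (simp add: killing_cJ J_inv)
  also have "\<dots> = - 2 * (\<Sum>c\<in>UNIV. Re (tau (nab (E c) (E c))) + Re (tau (nab (cJ (E c)) (cJ (E c)))))
     - 2 * br_norm E + Re (\<Sum>c\<in>UNIV. \<Sum>a\<in>UNIV. \<Sum>b\<in>UNIV. cnj (H (br (E a) (E b)) (E c)) * H (br (E a) (E b)) (E c))"
    by (simp add: sum.distrib sum_subtractf sum_negf br_norm_def sum_distrib_left algebra_simps)
  also have "(\<Sum>c\<in>UNIV. Re (tau (nab (E c) (E c))) + Re (tau (nab (cJ (E c)) (cJ (E c))))) = Re (tau Y)"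
    unfolding sum_rframe[of "\<lambda>x. Re (tau (nab x x))", symmetric] by (simp add: Y_def tau_sum)
  finally show ?thesis unfolding sum_frame_H[OF E] using tauY by simp
qed

lemma tau_norm_eq_0_iff:
  assumes E: "unitary_frame E"
  shows "tau_norm E = 0 \<longleftrightarrow> (\<forall>z. tau z = 0)"
proof
  assume "tau_norm E = 0"
  then have z: "tau (E a) = 0" for a by (simp add: tau_norm_def sum_nonneg_eq_0_iff)
  show "\<forall>z. tau z = 0"
  proof
    fix z
    have tau_sum: "tau (\<Sum>i\<in>I. f i) = (\<Sum>i\<in>I. tau (f i))" for I and f :: "'n \<Rightarrow> _"
      by (induction I rule: infinite_finite_induct) simp_all
    have "tau z = tau (\<Sum>a\<in>UNIV. H z (E a) *s E a)" by (simp only: frame_expansion[OF E])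
    then show "tau z = 0" by (simp add: tau_sum z)
  qed
qed (simp add: tau_norm_def)

end

section \<open>Nilpotent maps are traceless\<close>

lemma inner_cJ: "cJ v \<bullet> cJ w = v \<bullet> (w :: complex^'n::finite)"
  by (simp add: inner_vec_def cJ_def inner_complex_def algebra_simps)

lemma (in hermitian_form) cmod_H_frame_le:
  assumes E: "unitary_frame E"
  shows "(cmod (H v (E a)))\<^sup>2 \<le> h v v"
proof -
  have "complex_of_real (\<Sum>b\<in>UNIV. (cmod (H v (E b)))\<^sup>2) = of_real (h v v)"
    using frame_parseval[OF E, of v v] by (simp only: H_self of_real_sum complex_norm_square)
  then have "(\<Sum>b\<in>UNIV. (cmod (H v (E b)))\<^sup>2) = h v v" by (simp only: of_real_eq_iff)
  then show ?thesis using member_le_sum[of a UNIV "\<lambda>b. (cmod (H v (E b)))\<^sup>2"] by simp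
qed

text \<open>In the form \<open>\<Sum>j. s^j \<langle>f^j v, f^j w\<rangle>\<close>, applying \<open>f\<close> shifts the sum by one place, which costs a factor \<open>s\<close>.\<close>

lemma nilpotent_contracting_form:
  fixes f :: "complex^'n::finite \<Rightarrow> complex^'n"
  assumes f: "\<And>u v. f (u + v) = f u + f v" "\<And>c v. f (c *s v) = c *s f v"
    and nil: "\<And>v. (f ^^ k) v = 0" and s: "s > 0"
  shows "\<exists>h. hermitian_form h \<and> (\<forall>v. h (f v) (f v) \<le> h v v / s)"
proof -
  define h where "h v w = (\<Sum>j\<le>k. s ^ j * ((f ^^ j) v \<bullet> (f ^^ j) w))" for v w
  have fa: "(f ^^ j) (u + v) = (f ^^ j) u + (f ^^ j) v" for j u v by (induction j) (simp_all add: f)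
  have fc: "(f ^^ j) (c *s v) = c *s (f ^^ j) v" for j c v by (induction j) (simp_all add: f)
  have fr: "(f ^^ j) (r *\<^sub>R v) = r *\<^sub>R (f ^^ j) v" for j r v
  proof -
    have *: "r *\<^sub>R w = complex_of_real r *s w" for w :: "complex^'n"
      by (simp add: vector_smult_eq)
    show ?thesis unfolding * fc ..
  qed
  have "hermitian_form h"
  proof
    show "bilinear h"
      by (simp add: bilinear_def linear_iff h_def fa fr inner_add_left inner_add_right
          sum.distrib sum_distrib_left algebra_simps)
    show "h v w = h w v" for v w by (simp add: h_def inner_commute)
    show "h (cJ v) (cJ w) = h v w" for v w
      by (simp add: h_def cJ_def fc) (simp add: cJ_def[symmetric] inner_cJ)
    show "h v v > 0" if "v \<noteq> 0" for v
    proof -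
      have "0 < s ^ 0 * ((f ^^ 0) v \<bullet> (f ^^ 0) v)" using that by simp
      also have "\<dots> \<le> h v v"
        unfolding h_def using s by (intro member_le_sum) auto
      finally show ?thesis .
    qed
  qed
  moreover have "h (f v) (f v) \<le> h v v / s" for v
  proof -
    \<comment> \<open>the term that the shift adds at the end of the sum\<close>
    have top: "(f ^^ Suc k) v = 0" using nil[of "f v"] by (simp add: funpow_swap1)
    have "s * h (f v) (f v) = (\<Sum>j\<le>k. s ^ Suc j * ((f ^^ Suc j) v \<bullet> (f ^^ Suc j) v))"
      by (simp add: h_def sum_distrib_left funpow_swap1 mult.assoc)
    also have "\<dots> = (\<Sum>j\<le>k. s ^ j * ((f ^^ j) v \<bullet> (f ^^ j) v)) - v \<bullet> v"
      using sum.atMost_Suc_shift[of "\<lambda>j. s ^ j * ((f ^^ j) v \<bullet> (f ^^ j) v)" k] top by simp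
    also have "\<dots> \<le> h v v" by (simp add: h_def)
    finally show ?thesis using s by (simp add: field_simps)
  qed
  ultimately show ?thesis by blast
qed

text \<open>In a unitary frame the trace is at most \<open>CARD('n)\<close> times the operator norm, and by
\<open>nilpotent_contracting_form\<close> the inner product can be chosen so that the norm is arbitrarily small.\<close>

lemma trace_nilpotent:
  fixes f :: "complex^'n::finite \<Rightarrow> complex^'n"
  assumes f: "\<And>u v. f (u + v) = f u + f v" "\<And>c v. f (c *s v) = c *s f v"
    and nil: "\<And>v. (f ^^ k) v = 0"
  shows "trace (matrix f) = 0"
proof (rule ccontr)
  assume "trace (matrix f) \<noteq> 0"
  define c where "c = cmod (trace (matrix f))"
  have c: "c > 0" using \<open>trace (matrix f) \<noteq> 0\<close> by (simp add: c_def)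
  \<comment> \<open>chosen so that \<open>CARD('n) * e\<close> is below the absolute value \<open>c\<close> of the trace\<close>
  define e where "e = c / (2 * real CARD('n))"
  have e: "e > 0" using c by (simp add: e_def)
  obtain h where "hermitian_form h" and h: "\<And>v. h (f v) (f v) \<le> h v v / (1 / e\<^sup>2)"
    using nilpotent_contracting_form[OF f nil, of "1 / e\<^sup>2"] e by auto
  then interpret hermitian_form h by simp
  obtain E where E: "unitary_frame E" using ex_unitary_frame by blast
  have "cmod (H (f (E a)) (E a)) \<le> e" for a
  proof (rule power2_le_imp_le)
    have "h (E a) (E a) = 1" using E Re_H[of "E a" "E a"] by (simp add: unitary_frame_def del: Re_H)
    then show "(cmod (H (f (E a)) (E a)))\<^sup>2 \<le> e\<^sup>2"
      using order_trans[OF cmod_H_frame_le[OF E] h[of "E a"]] by simp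
  qed (use e in simp)
  then have "c \<le> (\<Sum>a\<in>(UNIV :: 'n set). e)"
    unfolding c_def matrix_trace_frame[OF E f] by (intro order_trans[OF norm_sum] sum_mono)
  also have "\<dots> = c / 2" by (simp add: e_def)
  finally show False using c by simp
qed

lemma has_derivative_along_line:
  fixes f :: "'a::real_normed_vector \<Rightarrow> 'b::real_normed_vector"
  assumes "(f has_derivative f') (at x)"
  shows "((\<lambda>t. (1 / t) *\<^sub>R (f (x + t *\<^sub>R u) - f x)) \<longlongrightarrow> f' u) (at_right 0)"
proof -
  have 0: "((\<lambda>t. x + t *\<^sub>R u) has_derivative (\<lambda>t. t *\<^sub>R u)) (at 0)"
    by (auto intro!: derivative_eq_intros)
  have "(f has_derivative f') (at (x + 0 *\<^sub>R u))" using assms by simp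
  from diff_chain_at[OF 0 this] have "((\<lambda>t. f (x + t *\<^sub>R u)) has_derivative (\<lambda>t. t *\<^sub>R f' u)) (at 0)"
    using linear_cmul[OF has_derivative_linear[OF assms]] by (simp add: o_def)
  then have "((\<lambda>t. norm (f (x + t *\<^sub>R u) - f x - t *\<^sub>R f' u) / norm t) \<longlongrightarrow> 0) (at_right 0)"
    by (simp add: has_derivative_iff_norm filterlim_at_split)
  moreover have "\<forall>\<^sub>F t in at_right 0. norm (f (x + t *\<^sub>R u) - f x - t *\<^sub>R f' u) / norm t =
      norm ((1 / t) *\<^sub>R (f (x + t *\<^sub>R u) - f x) - f' u)"
  proof (rule eventually_at_right_less[THEN eventually_mono])
    fix t :: real assume t: "0 < t"
    have "(1 / t) *\<^sub>R (f (x + t *\<^sub>R u) - f x) - f' u = (1 / t) *\<^sub>R (f (x + t *\<^sub>R u) - f x - t *\<^sub>R f' u)"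
      using t by (simp add: scaleR_diff_right)
    then show "norm (f (x + t *\<^sub>R u) - f x - t *\<^sub>R f' u) / norm t =
      norm ((1 / t) *\<^sub>R (f (x + t *\<^sub>R u) - f x) - f' u)" using t by simp
  qed
  ultimately have "((\<lambda>t. norm ((1 / t) *\<^sub>R (f (x + t *\<^sub>R u) - f x) - f' u)) \<longlongrightarrow> 0) (at_right 0)"
    by (rule Lim_transform_eventually)
  then show ?thesis by (simp add: tendsto_norm_zero_iff LIM_zero_iff)
qed

text \<open>Eventually \<open>R t\<close> differs from the identity by less than \<open>1/2\<close> in norm, so \<open>y t\<close> is bounded by twice \<open>R t (y t)\<close>, and
\<open>y t - R t (y t)\<close> tends to \<open>0\<close>.\<close>

lemma tendsto_if_near_identity:
  fixes R :: "real \<Rightarrow> 'a::euclidean_space \<Rightarrow> 'a"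
  assumes lin: "\<forall>\<^sub>F t in F. linear (R t)"
    and R: "\<And>w. ((\<lambda>t. R t w) \<longlongrightarrow> w) F"
    and y: "((\<lambda>t. R t (y t)) \<longlongrightarrow> l) F"
  shows "(y \<longlongrightarrow> l) F"
proof -
  define \<delta> where "\<delta> t = (\<Sum>b\<in>Basis. norm (R t b - b))" for t
  have "((\<lambda>t. \<Sum>b\<in>Basis. norm (R t b - b)) \<longlongrightarrow> (\<Sum>b\<in>(Basis :: 'a set). norm (b - b))) F"
    by (intro tendsto_intros R)
  then have \<delta>: "(\<delta> \<longlongrightarrow> 0) F" by (simp add: \<delta>_def[abs_def])
  have dist: "norm (R t w - w) \<le> \<delta> t * norm w" if "linear (R t)" for t w
  proof -
    have "R t w - w = R t (\<Sum>b\<in>Basis. (w \<bullet> b) *\<^sub>R b) - (\<Sum>b\<in>Basis. (w \<bullet> b) *\<^sub>R b)"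
      by (simp add: euclidean_representation)
    also have "\<dots> = (\<Sum>b\<in>Basis. (w \<bullet> b) *\<^sub>R (R t b - b))"
      by (simp add: linear_sum[OF that] linear_cmul[OF that] sum_subtractf scaleR_diff_right)
    also have "norm \<dots> \<le> (\<Sum>b\<in>Basis. norm w * norm (R t b - b))"
      by (intro sum_norm_le) (simp add: Basis_le_norm mult_right_mono)
    finally show ?thesis by (simp add: \<delta>_def sum_distrib_left mult.commute)
  qed
  have "\<forall>\<^sub>F t in F. \<delta> t < 1 / 2" using \<delta> by (rule order_tendstoD) simp
  with lin have "\<forall>\<^sub>F t in F. norm (y t - R t (y t)) \<le> \<delta> t * (2 * norm (R t (y t)))"
  proof eventually_elim
    case (elim t)
    have nonneg: "0 \<le> \<delta> t" by (simp add: \<delta>_def sum_nonneg)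
    have d: "norm (R t (y t) - y t) \<le> \<delta> t * norm (y t)" using dist elim by blast
    also have "\<dots> \<le> 1 / 2 * norm (y t)" using elim by (intro mult_right_mono) auto
    finally have "norm (y t) \<le> 2 * norm (R t (y t))"
      using norm_triangle_ineq2[of "y t" "R t (y t)"] by (simp add: norm_minus_commute)
    then have "\<delta> t * norm (y t) \<le> \<delta> t * (2 * norm (R t (y t)))" using nonneg by (rule mult_left_mono)
    with d show ?case by (simp add: norm_minus_commute)
  qed
  moreover have "((\<lambda>t. \<delta> t * (2 * norm (R t (y t)))) \<longlongrightarrow> 0 * (2 * norm l)) F"
    by (intro tendsto_intros \<delta> y)
  ultimately have "((\<lambda>t. y t - R t (y t)) \<longlongrightarrow> 0) F"
    by (intro Lim_null_comparison[of "\<lambda>t. y t - R t (y t)" "\<lambda>t. \<delta> t * (2 * norm (R t (y t)))" F])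
      (assumption, simp only: mult_zero_left)
  from tendsto_add[OF this y] show ?thesis by simp
qed

section \<open>Nilpotent Lie groups\<close>

context cx_lie_group
begin

definition commut :: "'g \<Rightarrow> 'g \<Rightarrow> 'g" where
  "commut x y = x \<otimes> y \<otimes> inv x \<otimes> inv y"

lemma commut_one [simp]: "commut x \<one> = \<one>"
  by (simp add: commut_def)

lemma commut_mult: "commut x y \<otimes> (y \<otimes> x) = x \<otimes> y"
proof -
  have "commut x y \<otimes> (y \<otimes> x) = x \<otimes> y \<otimes> (inv x \<otimes> ((inv y \<otimes> y) \<otimes> x))"
    by (simp only: commut_def m_assoc in_carrier)
  then show ?thesis by simp
qed

definition diff_commut :: "'g \<Rightarrow> complex^'n \<Rightarrow> complex^'n" where
  "diff_commut x = mdiff A (commut x) \<one>"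

lemma diff_commut: "has_chart_derivative chart1 chart1 (commut x) \<one> (diff_commut x)"
proof -
  note c1 = chart_at[of \<one>]
  have inv: "holomorphic_map cJ cJ A A (\<lambda>x. inv x)"
    using lie by (simp add: complex_lie_group_def)
  have mult: "\<exists>D. has_chart_derivative chart1 (chart_at A (f \<one> \<otimes> f' \<one>)) (\<lambda>y. f y \<otimes> f' y) \<one> D"
    if "\<exists>D. has_chart_derivative chart1 (chart_at A (f \<one>)) f \<one> D"
      "\<exists>D. has_chart_derivative chart1 (chart_at A (f' \<one>)) f' \<one> D" for f f'
    using that has_chart_derivative_mult[OF c1 chart_at chart_at chart_at] by blast
  have "\<exists>D. has_chart_derivative chart1 (chart_at A (inv \<one>)) (\<lambda>y. inv y) \<one> D"
    by (rule holomorphic_map_has_chart_derivative[OF inv, of chart1 "chart_at A (inv \<one>)" \<one>])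
      (use chart_at in blast)+
  moreover have "\<exists>D. has_chart_derivative chart1 (chart_at A \<one>) (\<lambda>y. y) \<one> D"
    using has_chart_derivative_id[OF c1] by blast
  moreover have "\<exists>D. has_chart_derivative chart1 (chart_at A a) (\<lambda>_. a) \<one> D" for a
    using has_chart_derivative_const by blast
  ultimately have "\<exists>D. has_chart_derivative chart1 (chart_at A (x \<otimes> \<one> \<otimes> inv x \<otimes> inv \<one>))
      (\<lambda>y. x \<otimes> y \<otimes> inv x \<otimes> inv y) \<one> D"
    by (intro mult[of "\<lambda>y. x \<otimes> y \<otimes> inv x" "\<lambda>y. inv y"] mult[of "\<lambda>y. x \<otimes> y" "\<lambda>y. inv x"]
        mult[of "\<lambda>y. x" "\<lambda>y. y"])
  then obtain D where "has_chart_derivative chart1 chart1 (commut x) \<one> D"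
    by (auto simp: commut_def[abs_def])
  then show ?thesis using mdiff_eq[of \<one> "commut x"] by (simp add: diff_commut_def)
qed

lemma linear_diff_commut: "linear (diff_commut x)"
  using diff_commut has_chart_derivative_linear by blast

text \<open>The differential at \<open>\<one>\<close> of right translation by the point with coordinates \<open>\<xi>\<close>.\<close>

definition right_diff :: "complex^'n \<Rightarrow> complex^'n \<Rightarrow> complex^'n" where
  "right_diff \<xi> w = frechet_derivative mult1 (at (x1, \<xi>)) (w, 0)"

text \<open>This is the derivative in \<open>y\<close> at \<open>\<one>\<close> of \<open>(x y x\<^sup>-\<^sup>1 y\<^sup>-\<^sup>1) (y x) = x y\<close>, an identity free
of inverses once the commutator is regarded as a single map.\<close>

lemma diff_commut_eq:
  assumes "\<xi> \<in> snd chart1 ` fst chart1"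
  shows "right_diff \<xi> (diff_commut (chart_inv chart1 \<xi>) w) =
    vf_in_chart A chart1 (field w) \<xi> - right_diff \<xi> w"
proof -
  let ?x = "chart_inv chart1 \<xi>" and ?M = "frechet_derivative mult1 (at (x1, \<xi>))"
  note c1 = chart_at[of \<one>]
  have x: "?x \<in> fst chart1" "snd chart1 ?x = \<xi>" using assms c1 chart_inv_in by auto
  have r: "has_chart_derivative chart1 chart1 (\<lambda>y. y \<otimes> ?x) \<one> (right_diff \<xi>)"
    using right_mult_has_chart_derivative[OF c1 c1(1) x(1) c1(1)] x by (simp add: right_diff_def[abs_def])
  have "has_chart_derivative chart1 chart1 (\<lambda>y. commut ?x y \<otimes> (y \<otimes> ?x)) \<one>
     (\<lambda>v. frechet_derivative mult1 (at (snd chart1 (commut ?x \<one>), snd chart1 (\<one> \<otimes> ?x)))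
        (diff_commut ?x v, right_diff \<xi> v))"
    by (rule has_chart_derivative_mult[OF c1 c1(1) _ c1(1) _ c1(1) _ diff_commut r]) (use c1 x in simp_all)
  then have 1: "has_chart_derivative chart1 chart1 (\<lambda>y. ?x \<otimes> y) \<one>
     (\<lambda>v. ?M (diff_commut ?x v, right_diff \<xi> v))"
    using x by (simp add: commut_mult)
  have 2: "has_chart_derivative chart1 chart1 (\<lambda>y. ?x \<otimes> y) \<one> (\<lambda>v. vf_in_chart A chart1 (field v) \<xi>)"
    by (rule field_in_chart_has_chart_derivative[OF c1(1) assms])
  have e: "vf_in_chart A chart1 (field w) \<xi> = ?M (diff_commut ?x w, right_diff \<xi> w)"
    using has_chart_derivative_unique[OF 2 1] by (simp only: fun_eq_iff)
  have z: "(x1, \<xi>) \<in> dom1" using c1 x assms by (auto simp: mult_dom_def)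
  have lin: "linear ?M"
    using mult_in_charts_has_derivative[OF c1(1) c1(1) c1(1) z] has_derivative_linear by blast
  have "has_chart_derivative chart1 chart1 (\<lambda>y. \<one> \<otimes> y) ?x
     (\<lambda>v. frechet_derivative mult1 (at (snd chart1 \<one>, snd chart1 ?x)) (0, v))"
    by (rule left_mult_has_chart_derivative) (use c1 x in simp_all)
  then have "has_chart_derivative chart1 chart1 (\<lambda>y. y) ?x (\<lambda>v. ?M (0, v))" using x by simp
  from has_chart_derivative_unique[OF this has_chart_derivative_id[OF c1(1) x(1)]]
  \<comment> \<open>left translation by \<open>\<one>\<close>, in the chart around \<open>\<one>\<close>, is the identity\<close>
  have id: "?M (0, v) = v" for v by (simp only: fun_eq_iff)
  have "?M (diff_commut ?x w, right_diff \<xi> w) = ?M (diff_commut ?x w, 0) + ?M (0, right_diff \<xi> w)"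
    by (simp add: linear_add[OF lin, symmetric])
  then show ?thesis unfolding e id by (simp add: right_diff_def)
qed

lemma right_diff_x1: "right_diff x1 w = w"
proof -
  note c1 = chart_at[of \<one>]
  have "has_chart_derivative chart1 chart1 (\<lambda>y. y \<otimes> \<one>) \<one>
    (\<lambda>v. frechet_derivative mult1 (at (snd chart1 \<one>, snd chart1 \<one>)) (v, 0))"
    by (rule right_mult_has_chart_derivative) (use c1 in simp_all)
  then have "has_chart_derivative chart1 chart1 (\<lambda>y. y) \<one> (right_diff x1)"
    by (simp add: right_diff_def[abs_def])
  from has_chart_derivative_unique[OF this has_chart_derivative_id[OF c1]]
  show ?thesis by (simp only: fun_eq_iff)
qed

lemma right_diff_has_derivative: "((\<lambda>\<xi>. right_diff \<xi> w) has_derivative mixed w) (at x1)"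
proof -
  let ?F = "\<lambda>z. frechet_derivative mult1 (at z) (w, 0)"
  have "((\<lambda>\<xi>. (x1, \<xi>)) has_derivative (\<lambda>u. (0, u))) (at x1)"
    by (auto intro!: derivative_eq_intros)
  moreover have "(?F has_derivative frechet_derivative ?F (at (x1, x1))) (at (x1, x1))"
    using mult1_second_differentiable by (simp add: frechet_derivative_works)
  ultimately have "(?F \<circ> (\<lambda>\<xi>. (x1, \<xi>)) has_derivative frechet_derivative ?F (at (x1, x1)) \<circ> (\<lambda>u. (0, u))) (at x1)"
    by (rule diff_chain_at)
  moreover have "frechet_derivative ?F (at (x1, x1)) \<circ> (\<lambda>u. (0, u)) = mixed w"
    by (simp add: mixed_eq' fun_eq_iff)
  ultimately show ?thesis by (simp add: right_diff_def o_def)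
qed

lemma field_in_chart1_has_derivative:
  "((\<lambda>\<xi>. vf_in_chart A chart1 (field w) \<xi>) has_derivative (\<lambda>u. mixed u w)) (at x1)"
  using field_in_chart_has_derivative[OF chart_at(1) x1_in, of w] unfolding mixed_def .

text \<open>By \<open>diff_commut_eq\<close>, \<open>diff_commut x\<close> is the difference between the differentials of left and right translation by \<open>x\<close>,
up to a factor that tends to the identity as \<open>x\<close> tends to \<open>\<one>\<close>. At \<open>x = \<one>\<close> the difference vanishes, and its
derivative in the direction \<open>u\<close> is \<open>mixed u w - mixed w u\<close>.\<close>

lemma diff_commut_tendsto_lie_ad:
  "((\<lambda>t. (1 / t) *\<^sub>R diff_commut (chart_inv chart1 (x1 + t *\<^sub>R u)) w) \<longlongrightarrow> lie_ad G A u w) (at_right 0)"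
proof -
  let ?x = "\<lambda>t::real. x1 + t *\<^sub>R u"
  have line: "(?x \<longlongrightarrow> x1) (at_right 0)" by (auto intro!: tendsto_eq_intros)
  have near: "\<forall>\<^sub>F t in at_right 0. ?x t \<in> snd chart1 ` fst chart1"
    using topological_tendstoD[OF line open_chart(2)[OF chart_at(1)] x1_in] .
  have cont: "isCont (\<lambda>\<xi>. right_diff \<xi> w) x1" for w
    using right_diff_has_derivative has_derivative_continuous by blast
  show ?thesis
  proof (rule tendsto_if_near_identity[of "\<lambda>t. right_diff (?x t)"])
    have "linear (right_diff \<xi>)" if "\<xi> \<in> snd chart1 ` fst chart1" for \<xi>
    proof -
      have z: "(x1, \<xi>) \<in> dom1" using that chart_at[of \<one>] by (auto simp: mult_dom_def)
      have l: "linear (frechet_derivative mult1 (at (x1, \<xi>)))"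
        using mult_in_charts_has_derivative[OF chart_at(1) chart_at(1) chart_at(1) z] has_derivative_linear by blast
      have "linear (frechet_derivative mult1 (at (x1, \<xi>)) \<circ> (\<lambda>w. (w, 0)))"
        by (rule linear_compose[OF _ l]) (simp add: linear_iff)
      then show ?thesis by (simp add: right_diff_def[abs_def] o_def)
    qed
    with near show "\<forall>\<^sub>F t in at_right 0. linear (right_diff (?x t))" by (auto elim: eventually_mono)
    show "((\<lambda>t. right_diff (?x t) w) \<longlongrightarrow> w) (at_right 0)" for w
      using isCont_tendsto_compose[OF cont line, of w] by (simp add: right_diff_x1)
    have "((\<lambda>\<xi>. vf_in_chart A chart1 (field w) \<xi> - right_diff \<xi> w) has_derivative (\<lambda>u. mixed u w - mixed w u)) (at x1)"
      by (intro has_derivative_diff field_in_chart1_has_derivative right_diff_has_derivative)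
    from has_derivative_along_line[OF this, of u]
    have "((\<lambda>t. (1 / t) *\<^sub>R (vf_in_chart A chart1 (field w) (?x t) - right_diff (?x t) w)) \<longlongrightarrow> lie_ad G A u w) (at_right 0)"
      using field_in_chart_at[of \<one> w] by (simp add: right_diff_x1 lie_ad_mixed field_one crd_def)
    then show "((\<lambda>t. right_diff (?x t) ((1 / t) *\<^sub>R diff_commut (chart_inv chart1 (?x t)) w)) \<longlongrightarrow> lie_ad G A u w) (at_right 0)"
    proof (rule Lim_transform_eventually)
      show "\<forall>\<^sub>F t in at_right 0. (1 / t) *\<^sub>R (vf_in_chart A chart1 (field w) (?x t) - right_diff (?x t) w) =
        right_diff (?x t) ((1 / t) *\<^sub>R diff_commut (chart_inv chart1 (?x t)) w)"
        using near \<open>\<forall>\<^sub>F t in at_right 0. linear (right_diff (?x t))\<close>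
        by eventually_elim (simp add: diff_commut_eq linear_cmul)
    qed
  qed
qed

text \<open>The common kernel of all \<open>j\<close>-fold compositions of maps \<open>diff_commut x\<close>.\<close>

primrec annihilated :: "nat \<Rightarrow> (complex^'n) set" where
  "annihilated 0 = {0}"
| "annihilated (Suc j) = {z. \<forall>x. diff_commut x z \<in> annihilated j}"

lemma subspace_annihilated: "subspace (annihilated j)"
proof (induction j)
  case (Suc j)
  then show ?case
    by (auto simp: subspace_def linear_0[OF linear_diff_commut] linear_add[OF linear_diff_commut]
        linear_cmul[OF linear_diff_commut])
qed (simp add: subspace_0 subspace_def)

text \<open>The bracket is a limit of multiples of \<open>diff_commut x z\<close>, and subspaces are closed.\<close>

lemma lie_ad_annihilated:
  assumes "z \<in> annihilated (Suc j)"
  shows "lie_ad G A u z \<in> annihilated j"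
proof (rule Lim_in_closed_set[OF closed_subspace[OF subspace_annihilated] _ _ diff_commut_tendsto_lie_ad])
  show "\<forall>\<^sub>F t in at_right 0. (1 / t) *\<^sub>R diff_commut (chart_inv chart1 (x1 + t *\<^sub>R u)) z \<in> annihilated j"
    using assms subspace_annihilated by (simp add: subspace_scale)
qed simp

lemma annihilated_mono: "annihilated j \<subseteq> annihilated (Suc j)"
proof (induction j)
  case (Suc j)
  then show ?case by auto
qed (simp add: linear_0[OF linear_diff_commut])

lemma lie_ad_preserves_annihilated: "z \<in> annihilated j \<Longrightarrow> lie_ad G A u z \<in> annihilated j"
  using lie_ad_annihilated[of z j u] annihilated_mono[of j] by blast

text \<open>The map \<open>F\<close> runs through iterated commutators as functions of their innermost entry. The number \<open>j\<close> of
commutators that are still to be applied decreases until \<open>F\<close> lands in the trivial group and has derivative \<open>0\<close>.\<close>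

lemma derivative_in_annihilated:
  assumes "lower_central G k = {\<one>}" "i + j = k" "F \<one> = \<one>" "\<And>y. F y \<in> lower_central G i"
    and "has_chart_derivative chart1 chart1 F \<one> D"
  shows "D z \<in> annihilated j"
  using assms(2-)
proof (induction j arbitrary: i F D)
  case 0
  then have "F = (\<lambda>_. \<one>)" using assms(1) by auto
  then have "D = (\<lambda>_. 0)" using "0.prems"(4) has_chart_derivative_const has_chart_derivative_unique by metis
  then show ?case by simp
next
  case (Suc j)
  have "(diff_commut x \<circ> D) z \<in> annihilated j" for x
  proof (rule Suc.IH[of "Suc i" "commut x \<circ> F"])
    show "Suc i + j = k" using Suc.prems(1) by simp
    show "(commut x \<circ> F) \<one> = \<one>" using Suc.prems(2) by simp
    show "(commut x \<circ> F) y \<in> lower_central G (Suc i)" for y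
      using Suc.prems(3)[of y] by (auto simp: commut_def intro!: generate.incl)
    show "has_chart_derivative chart1 chart1 (commut x \<circ> F) \<one> (diff_commut x \<circ> D)"
      by (rule has_chart_derivative_compose[OF _ _ _ _ Suc.prems(4)])
        (use chart_at Suc.prems(2) diff_commut in auto)
  qed
  then show ?case by simp
qed

lemma nilpotent_annihilated:
  assumes "nilpotent_group G"
  obtains k where "annihilated k = UNIV"
proof -
  obtain k where k: "lower_central G k = {\<one>}" using assms by (auto simp: nilpotent_group_def)
  have "z \<in> annihilated k" for z
    using derivative_in_annihilated[OF k, of 0 k "\<lambda>y. y" "\<lambda>v. v" z] has_chart_derivative_id chart_at by simp
  then show ?thesis using that by blast
qed

text \<open>Such a map lowers the filtration by the subspaces \<open>annihilated j\<close>, so it is nilpotent.\<close>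

lemma nilpotent_traceless:
  assumes G: "nilpotent_group G"
    and f: "\<And>u v. f (u + v) = f u + f v" "\<And>c v. f (c *s v) = c *s f v"
      "\<And>j z. z \<in> annihilated (Suc j) \<Longrightarrow> f z \<in> annihilated j"
  shows "trace (matrix f) = 0"
proof -
  obtain k where k: "annihilated k = UNIV" using nilpotent_annihilated[OF G] by blast
  have "(f ^^ i) z \<in> annihilated j" if "z \<in> annihilated (j + i)" for i j z
    using that
  proof (induction i arbitrary: z)
    case (Suc i)
    then show ?case using f(3)[of z "j + i"] by (simp add: funpow_swap1)
  qed simp
  from this[of _ 0 k] show ?thesis by (intro trace_nilpotent[of f k] f) (simp add: k)
qed

lemma lie_ad_linear:
  "lie_ad G A u (v + w) = lie_ad G A u v + lie_ad G A u w" "lie_ad G A u (c *s v) = c *s lie_ad G A u v"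
proof -
  show add: "lie_ad G A u (v + w) = lie_ad G A u v + lie_ad G A u w" for v w
    by (simp add: lie_ad_mixed linear_add[OF linear_mixed(1)] linear_add[OF linear_mixed(2)])
  have "lie_ad G A u (r *\<^sub>R v) = r *\<^sub>R lie_ad G A u v" for r v
    by (simp add: lie_ad_mixed linear_cmul[OF linear_mixed(1)] linear_cmul[OF linear_mixed(2)] scaleR_diff_right)
  then show "lie_ad G A u (c *s v) = c *s lie_ad G A u v"
    by (simp add: vector_smult_eq add lie_ad_cJ_right)
qed

lemma nilpotent_unimodular:
  assumes "nilpotent_group G"
  shows "unimodular G A"
  unfolding unimodular_def
  by (intro allI nilpotent_traceless[OF assms] lie_ad_linear lie_ad_annihilated)

lemma nilpotent_killing_form:
  assumes "nilpotent_group G"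
  shows "killing_form G A u v = 0"
  unfolding killing_form_def
  by (rule nilpotent_traceless[OF assms])
    (simp_all add: lie_ad_linear lie_ad_preserves_annihilated lie_ad_annihilated del: annihilated.simps)

end

section \<open>Complexified tensors in a unitary frame\<close>

definition sesquilinear :: "(complex^'n \<Rightarrow> complex^'n \<Rightarrow> complex) \<Rightarrow> bool" where
  "sesquilinear B \<longleftrightarrow> (\<forall>x x' y. B (x + x') y = B x y + B x' y) \<and> (\<forall>c x y. B (c *s x) y = c * B x y) \<and>
     (\<forall>x y y'. B x (y + y') = B x y + B x y') \<and> (\<forall>c x y. B x (c *s y) = cnj c * B x y)"

lemma sesquilinear_expansion:
  fixes x y :: "complex^'n::finite"
  assumes "sesquilinear B"
  shows "B x y = (\<Sum>k\<in>UNIV. \<Sum>l\<in>UNIV. x $ k * cnj (y $ l) * B (axis k 1) (axis l 1))"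
proof -
  have add: "B (x + x') y = B x y + B x' y" "B x (y + y') = B x y + B x y'"
    and scale: "B (c *s x) y = c * B x y" "B x (c *s y) = cnj c * B x y" for x x' y y' c
    using assms by (auto simp: sesquilinear_def)
  have zero: "B 0 y = 0" "B x 0 = 0" for x y using scale(1)[of 0] scale(2)[of _ 0] by simp_all
  have sum: "B (\<Sum>k\<in>K. f k) y = (\<Sum>k\<in>K. B (f k) y)" "B x (\<Sum>k\<in>K. f k) = (\<Sum>k\<in>K. B x (f k))"
    for K and f :: "'n \<Rightarrow> _" and x y
    by (induction K rule: infinite_finite_induct) (simp_all add: add zero)
  have "B x y = B (\<Sum>k\<in>UNIV. x $ k *s axis k 1) (\<Sum>l\<in>UNIV. y $ l *s axis l 1)"
    by (simp only: basis_expansion)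
  then have "B x y = (\<Sum>l\<in>UNIV. \<Sum>k\<in>UNIV. x $ k * cnj (y $ l) * B (axis k 1) (axis l 1))"
    by (simp add: sum scale sum_distrib_left mult_ac)
  then show ?thesis by (subst sum.swap)
qed

text \<open>The value at \<open>(Z\<^sub>x, cnj Z\<^sub>y)\<close> of the complex bilinear extension of \<open>B\<close>, where \<open>Z\<^sub>x = (x - \<i> J x) / 2\<close>.\<close>

definition ext11 :: "(complex^'n \<Rightarrow> complex^'n \<Rightarrow> real) \<Rightarrow> complex^'n \<Rightarrow> complex^'n \<Rightarrow> complex" where
  "ext11 B x y = Complex (B x y + B (cJ x) (cJ y)) (B x (cJ y) - B (cJ x) y) / 4"

lemma Zf_eq: "Zf i = ((1/2) *\<^sub>R axis i 1, - ((1/2) *\<^sub>R cJ (axis i 1)))"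
  and Zbar_eq: "Zbar i = ((1/2) *\<^sub>R axis i 1, (1/2) *\<^sub>R cJ (axis i 1))"
  by (simp_all add: Zf_def Zbar_def)

lemma cext2_Zf_Zbar:
  assumes "bilinear B"
  shows "cext2 B (Zf i) (Zbar j) = ext11 B (axis i 1) (axis j 1)"
  using assms
  by (simp add: cext2_def cext_def ext11_def Zf_eq Zbar_eq complex_eq_iff bilinear_lmul bilinear_rmul
      bilinear_lneg bilinear_rneg field_simps)

lemma sesquilinear_ext11:
  assumes "bilinear B"
  shows "sesquilinear (ext11 B)"
  unfolding sesquilinear_def
  by (simp add: ext11_def vector_smult_eq complex_eq_iff bilinear_ladd[OF assms] bilinear_radd[OF assms]
     bilinear_lmul[OF assms] bilinear_rmul[OF assms] bilinear_lneg[OF assms] bilinear_rneg[OF assms]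
     bilinear_lsub[OF assms] bilinear_rsub[OF assms] field_simps)

lemma ext11_two_Re:
  fixes B :: "complex^'n::finite \<Rightarrow> complex^'n \<Rightarrow> complex"
  assumes "sesquilinear B"
  shows "ext11 (\<lambda>v w. 2 * Re (B v w)) x y = B x y"
proof -
  have "B (cJ x) y = \<i> * B x y" "B x (cJ y) = - \<i> * B x y" for x y
    using assms unfolding sesquilinear_def cJ_smult by simp_all
  then show ?thesis by (simp add: ext11_def complex_eq_iff)
qed

lemma bilinear_two_Re:
  fixes B :: "complex^'n::finite \<Rightarrow> complex^'n \<Rightarrow> complex"
  assumes "sesquilinear B"
  shows "bilinear (\<lambda>v w. 2 * Re (B v w))"
proof -
  have *: "B (x + x') y = B x y + B x' y" "B x (y + y') = B x y + B x y'"
    "B (of_real r *s x) y = of_real r * B x y" "B x (of_real r *s y) = of_real r * B x y" for x x' y y' r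
    using assms by (auto simp: sesquilinear_def)
  have r: "r *\<^sub>R x = complex_of_real r *s x" for r and x :: "complex^'n"
    by (simp add: vector_smult_eq)
  have "B (r *\<^sub>R x) y = of_real r * B x y" for r x y by (subst r) (rule *)
  moreover have "B x (r *\<^sub>R y) = of_real r * B x y" for r x y by (subst r) (rule *)
  ultimately show ?thesis by (simp add: bilinear_def linear_iff *)
qed

context hermitian_form
begin

lemma ext11_h: "ext11 h x y = H x y / 2"
  by (simp add: ext11_def H_def complex_eq_iff J_inv h_cJ_left)

text \<open>The completeness relation \<open>frame_dual\<close> exhibits the inverse of the Gram matrix of \<open>H\<close>; the factor \<open>2\<close> comes from
\<open>g(Z\<^sub>x, cnj Z\<^sub>y) = H x y / 2\<close>.\<close>

lemma gup_frame:
  assumes E: "unitary_frame E" and g: "g p = h"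
  shows "gup g p k l = 2 * (\<Sum>a\<in>UNIV. E a $ k * cnj (E a $ l))"
proof -
  define M where "M = (\<chi> i j. cext2 h (Zf i) (Zbar j))"
  define X where "X = (\<chi> l k. 2 * (\<Sum>a\<in>UNIV. E a $ k * cnj (E a $ l)))"
  have "(\<Sum>l\<in>UNIV. M $ i $ l * X $ l $ k) = (if i = k then 1 else 0)" for i k
  proof -
    have "(\<Sum>l\<in>UNIV. M $ i $ l * X $ l $ k) =
        (\<Sum>l\<in>UNIV. \<Sum>a\<in>UNIV. E a $ k * (cnj (E a $ l) * H (axis i 1) (axis l 1)))"
      by (simp add: M_def X_def cext2_Zf_Zbar[OF bilin] ext11_h sum_distrib_left mult_ac)
    also have "\<dots> = (\<Sum>a\<in>UNIV. E a $ k * (\<Sum>l\<in>UNIV. cnj (E a $ l) * H (axis i 1) (axis l 1)))"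
      by (subst sum.swap) (simp add: sum_distrib_left)
    also have "\<dots> = (\<Sum>a\<in>UNIV. E a $ k * H (axis i 1) (\<Sum>l\<in>UNIV. E a $ l *s axis l 1))"
      by (simp add: H_sum)
    also have "\<dots> = (if i = k then 1 else 0)"
      using frame_dual[OF E, of i k] by (simp add: basis_expansion mult.commute)
    finally show ?thesis .
  qed
  then have MX: "M ** X = mat 1" by (simp add: matrix_matrix_mult_def mat_def vec_eq_iff)
  then have XM: "X ** M = mat 1" by (simp add: matrix_left_right_inverse)
  have "M ** matrix_inv M = mat 1 \<and> matrix_inv M ** M = mat 1"
    unfolding matrix_inv_def by (rule someI[of _ X]) (use MX XM in simp)
  then have "matrix_inv M = X" using XM by (metis matrix_mul_assoc matrix_mul_lid matrix_mul_rid)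
  then show ?thesis by (simp add: gup_def g M_def[symmetric] X_def)
qed

lemma sum_gup:
  assumes E: "unitary_frame E" and g: "g p = h" and B: "sesquilinear B"
  shows "(\<Sum>k\<in>UNIV. \<Sum>l\<in>UNIV. gup g p k l * B (axis k 1) (axis l 1)) = 2 * (\<Sum>a\<in>UNIV. B (E a) (E a))"
proof -
  have "(\<Sum>k\<in>UNIV. \<Sum>l\<in>UNIV. gup g p k l * B (axis k 1) (axis l 1)) =
    (\<Sum>k\<in>UNIV. \<Sum>l\<in>UNIV. \<Sum>a\<in>UNIV. 2 * (E a $ k * cnj (E a $ l) * B (axis k 1) (axis l 1)))"
    by (simp add: gup_frame[where g = g and p = p, OF E g] sum_distrib_left sum_distrib_right mult_ac)
  also have "\<dots> = (\<Sum>k\<in>UNIV. \<Sum>a\<in>UNIV. \<Sum>l\<in>UNIV. 2 * (E a $ k * cnj (E a $ l) * B (axis k 1) (axis l 1)))"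
    by (intro sum.cong refl sum.swap)
  also have "\<dots> = (\<Sum>a\<in>UNIV. \<Sum>k\<in>UNIV. \<Sum>l\<in>UNIV. 2 * (E a $ k * cnj (E a $ l) * B (axis k 1) (axis l 1)))"
    by (rule sum.swap)
  also have "\<dots> = 2 * (\<Sum>a\<in>UNIV. B (E a) (E a))"
    by (simp only: sesquilinear_expansion[OF B, of "E _" "E _"] sum_distrib_left)
  finally show ?thesis .
qed

lemma sum_gup_gup:
  assumes E: "unitary_frame E" and g: "g p = h"
    and B: "\<And>z w. sesquilinear (\<lambda>x y. B x y z w)" "\<And>x y. sesquilinear (B x y)"
  shows "(\<Sum>k\<in>UNIV. \<Sum>l\<in>UNIV. \<Sum>m\<in>UNIV. \<Sum>n\<in>UNIV. gup g p k l * gup g p m n *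
      B (axis k 1) (axis l 1) (axis m 1) (axis n 1)) = 4 * (\<Sum>a\<in>UNIV. \<Sum>b\<in>UNIV. B (E a) (E a) (E b) (E b))"
proof -
  have "(\<Sum>k\<in>UNIV. \<Sum>l\<in>UNIV. \<Sum>m\<in>UNIV. \<Sum>n\<in>UNIV. gup g p k l * gup g p m n *
      B (axis k 1) (axis l 1) (axis m 1) (axis n 1)) =
    (\<Sum>k\<in>UNIV. \<Sum>l\<in>UNIV. gup g p k l * (2 * (\<Sum>b\<in>UNIV. B (axis k 1) (axis l 1) (E b) (E b))))"
    by (simp only: mult.assoc sum_distrib_left[symmetric] sum_gup[where g = g and p = p, OF E g B(2)])
  also have "\<dots> = (\<Sum>k\<in>UNIV. \<Sum>l\<in>UNIV. \<Sum>b\<in>UNIV. 2 * (gup g p k l * B (axis k 1) (axis l 1) (E b) (E b)))"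
    by (simp add: sum_distrib_left mult_ac)
  also have "\<dots> = (\<Sum>k\<in>UNIV. \<Sum>b\<in>UNIV. \<Sum>l\<in>UNIV. 2 * (gup g p k l * B (axis k 1) (axis l 1) (E b) (E b)))"
    by (intro sum.cong refl sum.swap)
  also have "\<dots> = (\<Sum>b\<in>UNIV. \<Sum>k\<in>UNIV. \<Sum>l\<in>UNIV. 2 * (gup g p k l * B (axis k 1) (axis l 1) (E b) (E b)))"
    by (rule sum.swap)
  also have "\<dots> = (\<Sum>b\<in>UNIV. 2 * (2 * (\<Sum>a\<in>UNIV. B (E a) (E a) (E b) (E b))))"
    by (simp only: sum_distrib_left[symmetric] sum_gup[where g = g and p = p, OF E g B(1)])
  also have "\<dots> = 4 * (\<Sum>b\<in>UNIV. \<Sum>a\<in>UNIV. B (E a) (E a) (E b) (E b))"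
    by (simp add: sum_distrib_left)
  also have "\<dots> = 4 * (\<Sum>a\<in>UNIV. \<Sum>b\<in>UNIV. B (E a) (E a) (E b) (E b))"
    by (subst sum.swap) simp
  finally show ?thesis .
qed

end

context hermitian_lie_algebra
begin

text \<open>The bracket is complex bilinear, so its extension satisfies \<open>[Z\<^sub>x, Z\<^sub>y] = Z\<^bsub>[x, y]\<^esub>\<close> for \<open>Z\<^sub>x = (x - \<i> J x) / 2\<close>.\<close>

lemma cext3_torsion:
  "cext3 (\<lambda>u v w. h (- br u v) w) (Zf i) (Zf j) (Zbar k) = - (H (br (axis i 1) (axis j 1)) (axis k 1) / 2)"
  "cext3 (\<lambda>u v w. h (- br u v) w) (Zbar i) (Zbar j) (Zf k) = - (cnj (H (br (axis i 1) (axis j 1)) (axis k 1)) / 2)"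
  by (simp_all add: cext3_def cext2_def cext_def Zf_eq Zbar_eq H_def complex_eq_iff h_cJ_left field_simps)

lemma sesquilinear_kappa: "sesquilinear (kappa E)"
  unfolding sesquilinear_def kappa_def q1_def q2_def q3_def q4_def
  by (simp add: sum.distrib sum_distrib_left sum_negf algebra_simps)

lemma tr_g_kappa:
  assumes E: "unitary_frame E" and g: "g p = h" and K: "K p = (\<lambda>v w. 2 * Re (kappa E v w))"
  shows "tr_g g K p = - of_real (br_norm E / 2 + tau_norm E)"
  unfolding tr_g_def K cext2_Zf_Zbar[OF bilinear_two_Re[OF sesquilinear_kappa]]
    ext11_two_Re[OF sesquilinear_kappa] sum_gup[where g = g and p = p, OF E g sesquilinear_kappa]
  by (rule trace_kappa[OF E])

text \<open>The imaginary part of the trace is \<open>ric_diff\<close> at \<open>E a\<close> and \<open>J (E a)\<close>, whose bracket is \<open>J [E a, E a] = 0\<close>.\<close>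

lemma tr_g_ric:
  assumes E: "unitary_frame E" and g: "g p = h" and R: "R p = ric"
  shows "tr_g g R p = - of_real (br_norm E / 2 + 2 * tau_norm E)"
proof -
  have "ric (E a) (cJ (E a)) - ric (cJ (E a)) (E a) = 0" for a
    by (simp add: ric_diff)
  then have "tr_g g R p = 2 * (\<Sum>a\<in>UNIV. of_real (ric (E a) (E a) + ric (cJ (E a)) (cJ (E a))) / 4)"
    unfolding tr_g_def R cext2_Zf_Zbar[OF ric_bilinear] sum_gup[where g = g and p = p, OF E g sesquilinear_ext11[OF ric_bilinear]]
    by (simp add: ext11_def complex_eq_iff)
  also have "\<dots> = of_real (\<Sum>a\<in>UNIV. ric (E a) (E a) + ric (cJ (E a)) (cJ (E a))) / 2"
    by (simp flip: sum_divide_distrib)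
  finally show ?thesis unfolding trace_ric[OF E] by (simp add: field_simps)
qed

text \<open>On a pair \<open>(Z, cnj Z')\<close> of vectors of types \<open>(1,0)\<close> and \<open>(0,1)\<close>, \<open>J\<close> acts by \<open>\<i>\<close> and \<open>- \<i>\<close>, so \<open>R(J _, J _)\<close> and \<open>R\<close> agree
there.\<close>

lemma tr_g_ric11:
  assumes R: "R p = ric" and R': "R' p = (\<lambda>v w. 1/2 * (ric v w + ric (cJ v) (cJ w)))"
  shows "tr_g g R' p = tr_g g R p"
proof -
  note b = bilinear_ladd[OF ric_bilinear] bilinear_radd[OF ric_bilinear] bilinear_lmul[OF ric_bilinear]
    bilinear_rmul[OF ric_bilinear] bilinear_lneg[OF ric_bilinear] bilinear_rneg[OF ric_bilinear]
  have "bilinear (R' p)" unfolding R' by (simp add: bilinear_def linear_iff b algebra_simps add_divide_distrib)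
  moreover have "ext11 (R' p) x y = ext11 (R p) x y" for x y
    unfolding R R' by (simp add: ext11_def complex_eq_iff b field_simps)
  ultimately show ?thesis unfolding tr_g_def by (simp add: cext2_Zf_Zbar R ric_bilinear)
qed

end

section \<open>The tensors of a left-invariant metric\<close>

lemma trace_matrix_conjugate:
  fixes f L M :: "complex^'n::finite \<Rightarrow> complex^'n"
  assumes f: "\<And>u v. f (u + v) = f u + f v" "\<And>c v. f (c *s v) = c *s f v"
    and L: "\<And>u v. L (u + v) = L u + L v" "\<And>c v. L (c *s v) = c *s L v"
    and M: "\<And>u v. M (u + v) = M u + M v" "\<And>c v. M (c *s v) = c *s M v"
    and left_inverse: "\<And>v. M (L v) = v"
  shows "trace (matrix (\<lambda>v. L (f (M v)))) = trace (matrix f)"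
proof -
  have lin: "Vector_Spaces.linear (*s) (*s) f" "Vector_Spaces.linear (*s) (*s) L" "Vector_Spaces.linear (*s) (*s) M"
    by (unfold_locales; simp add: assms algebra_simps)+
  have "matrix (L \<circ> (f \<circ> M)) = matrix L ** (matrix f ** matrix M)"
    by (simp add: matrix_compose_gen lin Vector_Spaces.linear_compose[OF lin(3,1)])
  moreover have "matrix M ** matrix L = mat 1"
  proof -
    have "matrix M ** matrix L = matrix (M \<circ> L)" by (simp add: matrix_compose_gen lin)
    also have "M \<circ> L = id" by (simp add: fun_eq_iff left_inverse)
    finally show ?thesis by (simp only: matrix_id_mat_1)
  qed
  ultimately have "trace (matrix (L \<circ> (f \<circ> M))) = trace (matrix f)"
    by (subst (asm) matrix_mul_assoc) (simp add: trace_mul_sym[of _ "matrix M"] matrix_mul_assoc trace_mul_sym[of "matrix M ** _"])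
  then show ?thesis by (simp add: o_def)
qed

locale hermitian_cx_lie_group_connections = hermitian_cx_lie_group G A g
  for G :: "'g::{t2_space, second_countable_topology} monoid" (structure)
    and A :: "('g, complex^'n::finite) chart set" and g :: "('g, 'n) metric" +
  fixes LC D :: "('g, 'n) conn"
  assumes LC: "levi_civita A g LC" and D: "chern_connection A g D"
begin

text \<open>\<open>ad_at p\<close> and \<open>nabla_at p\<close> are the bracket and the Levi-Civita connection, transported to the tangent space at \<open>p\<close>.\<close>

definition ad_at :: "'g \<Rightarrow> complex^'n \<Rightarrow> complex^'n \<Rightarrow> complex^'n" where
  "ad_at p u v = field (ad (to_one p u) (to_one p v)) p"

definition nabla_at :: "'g \<Rightarrow> complex^'n \<Rightarrow> complex^'n \<Rightarrow> complex^'n" where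
  "nabla_at p u v = field (LC (field (to_one p u)) (field (to_one p v)) \<one>) p"

lemma to_one_cJ: "to_one p (cJ v) = cJ (to_one p v)"
  using to_one_field[of p "cJ (to_one p v)"] by (simp add: field_cJ field_to_one)

lemmas field_linear = linear_add[OF linear_field] linear_cmul[OF linear_field] linear_neg[OF linear_field]
lemmas to_one_linear = linear_add[OF linear_to_one] linear_cmul[OF linear_to_one]

lemma field_smult: "field (c *s v) p = c *s field v p" and to_one_smult: "to_one p (c *s v) = c *s to_one p v"
  by (simp_all add: vector_smult_eq field_linear to_one_linear field_cJ to_one_cJ)

lemma hermitian_form_at: "hermitian_form (g p)"
  using herm by unfold_locales (auto simp: hermitian_metric_def)

lemma hermitian_lie_algebra_at: "hermitian_lie_algebra (g p) (ad_at p) (nabla_at p)"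
proof (intro hermitian_lie_algebra.intro hermitian_lie_algebra_axioms.intro hermitian_form_at)
  fix u u' v w r
  show "ad_at p (u + u') v = ad_at p u v + ad_at p u' v" "ad_at p (r *\<^sub>R u) v = r *\<^sub>R ad_at p u v"
    "ad_at p (cJ u) v = cJ (ad_at p u v)"
    by (simp_all add: ad_at_def to_one_linear to_one_cJ lie_ad_bilinear field_linear field_cJ)
  show "ad_at p v u = - ad_at p u v"
    unfolding ad_at_def by (subst lie_ad_antisym) (simp add: field_linear)
  have *: "g p (field a p) b = g \<one> a (to_one p b)" for a b
    using metric_field[of p a "to_one p b"] by (simp add: field_to_one)
  show "2 * g p (nabla_at p u v) w = g p (ad_at p u v) w - g p (ad_at p v w) u + g p (ad_at p w u) v"
    using levi_civita_koszul[OF LC, of \<one> "to_one p u" "to_one p v" "to_one p w"]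
    by (simp add: nabla_at_def ad_at_def * field_one)
qed

lemma torsion_at_eq: "torsion_at G A D p u v = - ad_at p u v"
  by (simp add: torsion_at_def torsion_def linv_eq_field[of p u] linv_eq_field[of p v] bracket_field chern_field[OF D] ad_at_def)

lemma curvature_at_chern: "curvature_at G A D p u v w = 0"
proof -
  have "D (field a) (field b) = field 0" for a b
    using linear_0[OF linear_field] by (simp add: fun_eq_iff chern_field[OF D])
  then show ?thesis
    using linear_0[OF linear_field]
    by (simp add: curvature_at_def curvature_def linv_eq_field[of p u] linv_eq_field[of p v]
        linv_eq_field[of p w] bracket_field)
qed

lemma curvature_at_levi_civita:
  "curvature_at G A LC p u v w =
    nabla_at p u (nabla_at p v w) - nabla_at p v (nabla_at p u w) - nabla_at p (ad_at p u v) w"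
proof -
  have 2: "LC (field a) (field b) p = nabla_at p (field a p) (field b p)" for a b
    unfolding nabla_at_def to_one_field by (rule fun_cong[OF levi_civita_field[OF LC]])
  have 1: "LC (field a) (LC (field b) (field c)) p = nabla_at p (field a p) (nabla_at p (field b p) (field c p))" for a b c
  proof -
    define n where "n = LC (field b) (field c) \<one>"
    have n: "LC (field b) (field c) = field n" unfolding n_def by (rule levi_civita_field[OF LC])
    then have "nabla_at p (field b p) (field c p) = field n p" using 2[of b c] by simp
    then show ?thesis unfolding n using 2[of a n] by simp
  qed
  show ?thesis
    unfolding curvature_at_def curvature_def linv_eq_field[of p u] linv_eq_field[of p v]
      linv_eq_field[of p w] bracket_field 1 2
    by (simp add: field_to_one ad_at_def)
qed

lemma Ric_at: "Ric G A LC p = hermitian_lie_algebra.ric (ad_at p) (nabla_at p)"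
  by (simp add: fun_eq_iff Ric_def hermitian_lie_algebra.ric_def[OF hermitian_lie_algebra_at] curvature_at_levi_civita)

lemma tau_at: "hermitian_lie_algebra.tau (ad_at p) z = trace (matrix (ad (to_one p z)))"
  unfolding hermitian_lie_algebra.tau_def[OF hermitian_lie_algebra_at] ad_at_def
  by (rule trace_matrix_conjugate[of "ad (to_one p z)" "\<lambda>v. field v p" "to_one p"])
    (simp_all add: lie_ad_linear field_linear field_smult to_one_linear to_one_smult to_one_field)

lemma killing_at: "hermitian_lie_algebra.killing (ad_at p) v w = killing_form G A (to_one p v) (to_one p w)"
proof -
  have "ad_at p v \<circ> ad_at p w = (\<lambda>z. field ((ad (to_one p v) \<circ> ad (to_one p w)) (to_one p z)) p)"
    by (simp add: fun_eq_iff ad_at_def to_one_field)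
  then show ?thesis
    unfolding hermitian_lie_algebra.killing_def[OF hermitian_lie_algebra_at] killing_form_def
    by (simp only:) (rule trace_matrix_conjugate[of "ad (to_one p v) \<circ> ad (to_one p w)"
          "\<lambda>v. field v p" "to_one p"], simp_all add: lie_ad_linear field_linear field_smult to_one_linear to_one_smult to_one_field)
qed

lemma unimodular_at: "unimodular G A \<longleftrightarrow> (\<forall>z. hermitian_lie_algebra.tau (ad_at p) z = 0)"
  unfolding unimodular_def tau_at by (metis to_one_field)

lemma Tc_at:
  "Tc G A g D p (Zf i) (Zf j) (Zbar k) =
    - (hermitian_form.H (g p) (ad_at p (axis i 1) (axis j 1)) (axis k 1) / 2)"
  "Tc G A g D p (Zbar i) (Zbar j) (Zf k) =
    - (cnj (hermitian_form.H (g p) (ad_at p (axis i 1) (axis j 1)) (axis k 1)) / 2)"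
  unfolding Tc_def torsion_at_eq hermitian_lie_algebra.cext3_torsion[OF hermitian_lie_algebra_at] by simp_all

lemma Kc_at:
  assumes E: "hermitian_form.unitary_frame (g p) E"
  shows "Kc G A g D p i j = hermitian_lie_algebra.kappa (g p) (ad_at p) E (axis i 1) (axis j 1)"
proof -
  interpret hermitian_lie_algebra "g p" "ad_at p" "nabla_at p" by (rule hermitian_lie_algebra_at)
  let ?i = "axis i 1 :: complex^'n" and ?j = "axis j 1 :: complex^'n"
  note sums = sum_gup_gup[where g = g and p = p, OF E refl]
  have S: "Sten G A g D p i j = 0"
    by (simp add: Sten_def Omc_def curvature_at_chern cext4_def cext3_def cext2_def cext_def)
  have Q1: "Q1 G A g D p i j = q1 E ?i ?j"
    using sums[of "\<lambda>k l m n. H (ad_at p ?i k) n * cnj (H (ad_at p ?j l) m) / 4"]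
    by (simp add: Q1_def Tc_at q1_def sesquilinear_def sum_distrib_left mult_ac algebra_simps add_divide_distrib)
  have Q2: "Q2 G A g D p i j = q2 E ?i ?j"
    using sums[of "\<lambda>k l m n. cnj (H (ad_at p l n) ?i) * H (ad_at p k m) ?j / 4"]
    by (simp add: Q2_def Tc_at q2_def sesquilinear_def sum_distrib_left mult_ac algebra_simps add_divide_distrib)
  have Q3: "Q3 G A g D p i j = q3 E ?i ?j"
    using sums[of "\<lambda>k l m n. H (ad_at p ?i k) l * cnj (H (ad_at p ?j n) m) / 4"]
    by (simp add: Q3_def Tc_at q3_def sesquilinear_def sum_distrib_left mult_ac algebra_simps add_divide_distrib)
  have Q4: "Q4 G A g D p i j = q4 E ?i ?j"
    using sums[of "\<lambda>k l m n. (H (ad_at p m k) l * cnj (H (ad_at p n ?j) ?i) +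
        cnj (H (ad_at p n l) k) * H (ad_at p m ?i) ?j) / 4"]
    by (simp add: Q4_def Tc_at q4_def sesquilinear_def sum_distrib_left mult_ac algebra_simps add_divide_distrib)
  show ?thesis unfolding Kc_def S Q1 Q2 Q3 Q4 kappa_def by simp
qed

lemma Kten_at:
  assumes E: "hermitian_form.unitary_frame (g p) E"
  shows "Kten G A g D p = (\<lambda>v w. 2 * Re (hermitian_lie_algebra.kappa (g p) (ad_at p) E v w))"
proof -
  interpret hermitian_lie_algebra "g p" "ad_at p" "nabla_at p" by (rule hermitian_lie_algebra_at)
  show ?thesis
  proof (intro ext)
    fix v w
    show "Kten G A g D p v w = 2 * Re (kappa E v w)"
      unfolding Kten_def Kc_at[OF E] sesquilinear_expansion[OF sesquilinear_kappa, of E v w]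
      by (simp add: mult_ac)
  qed
qed

lemma scalar_curvature_eq_iff:
  "tr_g g (Ric G A LC) p = tr_g g (Kten G A g D) p \<longleftrightarrow> unimodular G A"
proof -
  interpret hermitian_lie_algebra "g p" "ad_at p" "nabla_at p" by (rule hermitian_lie_algebra_at)
  obtain E where E: "unitary_frame E" using ex_unitary_frame by blast
  show ?thesis
    unfolding tr_g_ric[where g = g and p = p and R = "Ric G A LC", OF E refl Ric_at]
      tr_g_kappa[where g = g and p = p and K = "Kten G A g D", OF E refl Kten_at[OF E]] unimodular_at[of p]
      tau_norm_eq_0_iff[OF E, symmetric]
    by (simp add: complex_eq_iff)
qed

lemma Ric11_at: "Ric11 G A LC p = (\<lambda>v w. 1/2 * (hermitian_lie_algebra.ric (ad_at p) (nabla_at p) v w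
    + hermitian_lie_algebra.ric (ad_at p) (nabla_at p) (cJ v) (cJ w)))"
  by (simp add: fun_eq_iff Ric11_def Ric_at)

lemma tr_g_Ric11: "tr_g g (Ric11 G A LC) p = tr_g g (Ric G A LC) p"
  by (rule hermitian_lie_algebra.tr_g_ric11[where p = p and R = "Ric G A LC" and R' = "Ric11 G A LC",
        OF hermitian_lie_algebra_at Ric_at Ric11_at])

lemma K_eq_Ric11_if_unimodular:
  assumes "unimodular G A"
  shows "Kten G A g D p v w = Ric11 G A LC p v w"
proof -
  interpret hermitian_lie_algebra "g p" "ad_at p" "nabla_at p" by (rule hermitian_lie_algebra_at)
  obtain E where E: "unitary_frame E" using ex_unitary_frame by blast
  have "tau z = 0" for z using assms unimodular_at by blast
  from kappa_eq_ric11[OF E this] show ?thesis by (simp add: Kten_at[OF E] Ric11_at)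
qed

lemma K_eq_Ric_plus_killing_if_unimodular:
  assumes "unimodular G A"
  shows "Kten G A g D p v w = Ric G A LC p v w + Re (killing_form G A (to_one p v) (to_one p w))"
proof -
  interpret hermitian_lie_algebra "g p" "ad_at p" "nabla_at p" by (rule hermitian_lie_algebra_at)
  obtain E where E: "unitary_frame E" using ex_unitary_frame by blast
  have "tau z = 0" for z using assms unimodular_at by blast
  from kappa_unimodular[OF E this, of v w] show ?thesis
    unfolding Kten_at[OF E] Ric_at killing_at .
qed

text \<open>The imaginary part of a form that is complex linear in \<open>u\<close> is determined by its real part at \<open>J u\<close>.\<close>

lemma killing_form_eq_0_iff:
  "(\<forall>u v. killing_form G A u v = 0) \<longleftrightarrow> (\<forall>u v. Re (killing_form G A u v) = 0)"
proof
  assume re: "\<forall>u v. Re (killing_form G A u v) = 0"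
  interpret hermitian_lie_algebra "g \<one>" "ad_at \<one>" "nabla_at \<one>" by (rule hermitian_lie_algebra_at)
  have "killing v w = 0" for v w
    using re killing_cJ(1)[of v w] killing_at[of \<one> v w] killing_at[of \<one> "cJ v" w]
    by (simp add: complex_eq_iff)
  then show "\<forall>u v. killing_form G A u v = 0" unfolding killing_at by (metis to_one_field)
qed simp

lemma K_eq_Ric_iff:
  assumes "unimodular G A"
  shows "Kten G A g D = Ric G A LC \<longleftrightarrow> (\<forall>u v. killing_form G A u v = 0)"
proof -
  have "Kten G A g D = Ric G A LC \<longleftrightarrow> (\<forall>p v w. Re (killing_form G A (to_one p v) (to_one p w)) = 0)"
    by (simp add: fun_eq_iff K_eq_Ric_plus_killing_if_unimodular[OF assms])
  also have "\<dots> \<longleftrightarrow> (\<forall>u v. Re (killing_form G A u v) = 0)" by (metis to_one_field)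
  finally show ?thesis by (simp only: killing_form_eq_0_iff)
qed

end

theorem proposition2p3:
  fixes G :: "'g::{t2_space, second_countable_topology} monoid"
    and A :: "('g, complex^'n::finite) chart set"
    and g :: "('g, 'n) metric"
    and LC D :: "('g, 'n) conn"
  assumes "complex_lie_group G A"
    and "hermitian_metric A g"
    and "left_invariant G A g"
    and "levi_civita A g LC"
    and "chern_connection A g D"
  defines "r \<equiv> tr_g g (Ric G A LC)"
    and "k \<equiv> tr_g g (Kten G A g D)"
  shows "(r = k \<longleftrightarrow> unimodular G A) \<and>
         (unimodular G A \<longleftrightarrow> Kten G A g D = Ric11 G A LC) \<and>
         (r = k \<or> unimodular G A \<or> Kten G A g D = Ric11 G A LC \<longrightarrow>
            (Kten G A g D = Ric G A LC \<longleftrightarrow> (\<forall>u v. killing_form G A u v = 0))) \<and>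
         (nilpotent_group G \<longrightarrow> Kten G A g D = Ric G A LC)"
proof -
  interpret hermitian_cx_lie_group_connections G A g LC D
    by unfold_locales fact+
  have rk: "r = k \<longleftrightarrow> unimodular G A"
    unfolding r_def k_def fun_eq_iff scalar_curvature_eq_iff by simp
  have "unimodular G A" if "Kten G A g D = Ric11 G A LC"
    using scalar_curvature_eq_iff[of "\<one>\<^bsub>G\<^esub>"] tr_g_Ric11[of "\<one>\<^bsub>G\<^esub>"] that by simp
  then have K11: "unimodular G A \<longleftrightarrow> Kten G A g D = Ric11 G A LC"
    using K_eq_Ric11_if_unimodular by blast
  have "Kten G A g D = Ric G A LC" if "nilpotent_group G"
    using K_eq_Ric_iff[OF nilpotent_unimodular[OF that]] nilpotent_killing_form[OF that] by simp
  then show ?thesis using rk K11 K_eq_Ric_iff by blast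
qed

end
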